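(* There exists $C>0$ depending only on $\boldsymbol u_0$, $\rho_0$, $\mu$ and $\boldsymbol f$ such that, for any discrete velocity $\boldsymbol u$ satisfying the implicit MAC scheme (see context), the following estimates hold: $$\|\boldsymbol u\|^2_{L^2(0,T;\mathbf H_{\mathcal E,0})}=\sum_{n=0}^{N-1}\delta t\,\|\boldsymbol u^{n+1}\|^2_{1,\mathcal E,0}\le C,\qquad\|\boldsymbol u\|_{L^\infty(0,T;L^2(\Omega)^d)}=\max_{0\le n\le N-1}\|\boldsymbol u^{n+1}\|_{L^2(\Omega)^d}\le C.$$
   Context: **Data.** $T>0$, $d\in\{2,3\}$; $\Omega\subset\mathbb R^d$ is a bounded connected open set that is a finite union of rectangles ($d=2$) or rectangular parallelepipeds ($d=3$) with faces orthogonal to the canonical basis vectors $e_1,\dots,e_d$. $\rho_0\in L^\infty(\Omega)$, $\rho_{\min}=\operatorname{ess\,inf}\rho_0>0$, $\rho_{\max}=\operatorname{ess\,sup}\rho_0$, $\boldsymbol u_0\in L^2(\Omega)^d$, $\boldsymbol f\in L^2(0,T;L^2(\Omega)^d)$; $\mu:\mathbb R\to(0,\infty)$ is continuous. **MAC grid** $\mathcal D=(\mathcal M,\mathcal E)$. $\mathcal M$ is a conforming structured (possibly non-uniform) partition of $\Omega$ into axis-parallel rectangles/parallelepipeds $K$ (primal cells, centre $x_K$). $\mathcal E$ is the set of faces (edges if $d=2$) $\sigma$ of the cells, with centre $x_\sigma$; $\mathcal E(K)$: faces of $K$; $\mathcal E_{\rm int},\mathcal E_{\rm ext}$: faces in the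 interior / on the boundary of $\Omega$; $\mathcal E^{(i)}$: faces orthogonal to $e_i$, $\mathcal E^{(i)}_{\rm int}=\mathcal E^{(i)}\cap\mathcal E_{\rm int}$, $\mathcal E^{(i)}_{\rm ext}=\mathcal E^{(i)}\cap\mathcal E_{\rm ext}$. $\sigma=K|L$: interior face common to $K$ and $L$. $n_{K,\sigma}$: unit normal to $\sigma$ outward $K$. $D_{K,\sigma}$: half of $K$ adjacent to $\sigma\in\mathcal E(K)$; $D_\sigma=D_{K,\sigma}\cup D_{L,\sigma}$ if $\sigma=K|L$, $D_\sigma=D_{K,\sigma}$ if $\sigma\in\mathcal E_{\rm ext}\cap\mathcal E(K)$. $|\cdot|$ is $d$- or $(d-1)$-dimensional Lebesgue measure. **Dual faces.** $\widetilde{\mathcal E}(D_\sigma)$: faces of $D_\sigma$; $\widetilde{\mathcal E}^{(i)}$: all faces $\epsilon$ of the cells $D_\sigma$, $\sigma\in\mathcal E^{(i)}$; $\widetilde{\mathcal E}^{(i,j)}$: those orthogonal to $e_j$; $\epsilon=\sigma|\sigma'$: common face of $D_\sigma$ and $D_{\sigma'}$; $n_{\sigma,\epsilon}$: unit normal to $\epsilon$ outward $D_\sigma$. For $\epsilon\in\widetilde{\mathcal E}^{(i,j)}$: $D_\epsilon=\epsilon\times[x_\sigma,x_{\sigma'}]$, $d_\epsilon=|x_\sigma-x_{\sigma'}|$ if $\epsilon=\sigma|\sigma'$; $D_\epsilon=\epsilon\times[x_\sigma,x_{\sigma,\epsilon}]$, $d_\epsilon=|x_\sigma-x_{\sigma,\epsilon}|$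 if $\epsilon\subset\partial\Omega$ is a face of $D_\sigma$, with $x_{\sigma,\epsilon}$ the orthogonal projection of $x_\sigma$ on $\epsilon$ (degenerate ones with $d_\epsilon=0$ play no role). For each $(i,j)$ the $D_\epsilon$ partition $\Omega$; for $i=j$ they are the primal cells; the $(i,j)$- and $(j,i)$-partitions coincide. **Spaces.** $L_{\mathcal M}$: functions $q=\sum_Kq_K\mathbf 1_K$; $L_{\mathcal M,0}$: those with zero mean; $H_{\mathcal E^{(i)},0}$: functions $v=\sum_{\sigma\in\mathcal E^{(i)}}v_\sigma\mathbf 1_{D_\sigma}$ with $v_\sigma=0$ for $\sigma\in\mathcal E^{(i)}_{\rm ext}$; $\mathbf H_{\mathcal E,0}=\prod_iH_{\mathcal E^{(i)},0}$. **Operators.** For $\boldsymbol u=(u_1,\dots,u_d)\in\mathbf H_{\mathcal E,0}$, $\rho,p\in L_{\mathcal M}$: - $u_{K,\sigma}=u_\sigma\,n_{K,\sigma}\cdot e_i$ for $\sigma\in\mathcal E^{(i)}\cap\mathcal E(K)$. - Mass fluxes $F_{K,\sigma}=|\sigma|\rho_\sigma u_{K,\sigma}$ with upwind density, for $\sigma=K|L$: $\rho_\sigma=\rho_K$ if $u_{K,\sigma}\ge0$, $\rho_L$ otherwise ($F_{K,\sigma}=0$ on $\mathcal E_{\rm ext}$). - $|D_\sigma|\rho_{D_\sigma}=|D_{K,\sigma}|\rho_K+|D_{L,\sigma}|\rho_L$ for $\sigma=K|L$. - Dual fluxes, $\sigma=K|L\in\mathcal E^{(i)}_{\rm int}$,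 $\epsilon\in\widetilde{\mathcal E}(D_\sigma)$: if $\epsilon\perp e_i$, $\epsilon=\sigma|\sigma'\subset K$: $F_{\sigma,\epsilon}=\frac12(-F_{K,\sigma}+F_{K,\sigma'})$ (same with $L$ if $\epsilon\subset L$); if $\epsilon\perp e_j$, $j\ne i$, $\epsilon$ is the union of one half of $\tau\in\mathcal E(K)\cap\mathcal E^{(j)}$ and one half of $\tau'\in\mathcal E(L)\cap\mathcal E^{(j)}$: $F_{\sigma,\epsilon}=\frac12(F_{K,\tau}+F_{L,\tau'})$. Upwind velocity, $\epsilon=\sigma|\sigma'$: $u_\epsilon=u_\sigma$ if $F_{\sigma,\epsilon}\ge0$, $u_{\sigma'}$ otherwise (the flux is zero for $\epsilon\subset\partial\Omega$). - $(\eth_ju_i)_{D_\epsilon}=\frac{u_{\sigma'}-u_\sigma}{d_\epsilon}\,n_{\sigma,\epsilon}\cdot e_j$ for $\epsilon=\sigma|\sigma'\in\widetilde{\mathcal E}^{(i,j)}$; $(\eth_ju_i)_{D_\epsilon}=\frac{-u_\sigma}{d_\epsilon}\,n_{\sigma,\epsilon}\cdot e_j$ for $\epsilon\subset\partial\Omega$ a face of $D_\sigma$; $\eth_ju_i=\sum_{\epsilon\in\widetilde{\mathcal E}^{(i,j)}}(\eth_ju_i)_{D_\epsilon}\mathbf 1_{D_\epsilon}$; $\|\boldsymbol u\|^2_{1,\mathcal E,0}=\sum_{i,j=1}^d\|\eth_ju_i\|^2_{L^2(\Omega)}$. - Viscosity: $\mu_K=\mu(\rho_K)$; for $\epsilon\in\widetilde{\mathcal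 E}^{(i,i)}$, $\epsilon\subset K$: $\mu_\epsilon=\mu_K$; for $\epsilon=\sigma|\sigma'\in\widetilde{\mathcal E}^{(i,j)}$, $i\neq j$, $\sigma=K|L$, $\sigma'=K'|L'$: $|D_\epsilon|\mu_\epsilon=\frac14(|K|\mu_K+|L|\mu_L+|K'|\mu_{K'}+|L'|\mu_{L'})$; for $\epsilon\subset\partial\Omega$ a face of $D_\sigma$, $\sigma=K|L$: $|D_\epsilon|\mu_\epsilon=\frac14(|K|\mu_K+|L|\mu_L)$; $\mu_\epsilon$ depends only on the cell $D_\epsilon$ (same value in the $(i,j)$- and $(j,i)$-partitions). - Diffusion, $\sigma\in\mathcal E^{(i)}_{\rm int}$: $(\operatorname{div}_{\mathcal E}(\mu\mathbf D(\boldsymbol u)))_{D_\sigma}=\sum_{j=1}^d\sum_{\epsilon\in\widetilde{\mathcal E}(D_\sigma),\epsilon\perp e_j}\frac{|\epsilon|}{|D_\sigma|}\frac{\mu_\epsilon}2(\eth_ju_i+\eth_iu_j)_{D_\epsilon}\,n_{\sigma,\epsilon}\cdot e_j$. - Pressure gradient, $\sigma=K|L\in\mathcal E^{(i)}_{\rm int}$: $(\nabla_{\mathcal E}p)_{D_\sigma}=\frac{|\sigma|}{|D_\sigma|}(p_L-p_K)\,n_{K,\sigma}\cdot e_i$. **Scheme.** $T=N\delta t$, $t^n=n\delta t$. $\rho^0_K=\frac1{|K|}\int_K\rho_0$; $u^0_\sigma=\frac1{|D_\sigma|}\int_{D_\sigma}u_{0,i}$ for $\sigma\in\mathcal E^{(i)}_{\rm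 int}$ ($0$ on exterior faces); the discrete source is the cell average of $\boldsymbol f$ evaluated at time $t^{n+1}$: $f^{n+1}_\sigma=\frac1{|D_\sigma|}\int_{D_\sigma}f_i(t^{n+1},x)\,dx$ for $\sigma\in\mathcal E^{(i)}_{\rm int}$. For $n=0,\dots,N-1$, $(\rho^{n+1},\boldsymbol u^{n+1},p^{n+1})\in L_{\mathcal M}\times\mathbf H_{\mathcal E,0}\times L_{\mathcal M,0}$ satisfies $$\tfrac1{\delta t}(\rho^{n+1}_K-\rho^n_K)+\tfrac1{|K|}\sum_{\sigma\in\mathcal E(K)}F^{n+1}_{K,\sigma}=0,\qquad \sum_{\sigma\in\mathcal E(K)}|\sigma|u^{n+1}_{K,\sigma}=0\qquad\forall K\in\mathcal M,$$ $$\tfrac1{\delta t}(\rho^{n+1}_{D_\sigma}u^{n+1}_\sigma-\rho^n_{D_\sigma}u^n_\sigma)+\tfrac1{|D_\sigma|}\sum_{\epsilon\in\widetilde{\mathcal E}(D_\sigma)}F^{n+1}_{\sigma,\epsilon}u^{n+1}_\epsilon-(\operatorname{div}_{\mathcal E}(\mu^{n+1}\mathbf D(\boldsymbol u^{n+1})))_{D_\sigma}+(\nabla_{\mathcal E}p^{n+1})_{D_\sigma}=f^{n+1}_\sigma$$ for all $i$ and $\sigma\in\mathcal E^{(i)}_{\rm int}$, where fluxes, upwind values and viscosities are computed from $(\rho^{n+1},\boldsymbol u^{n+1})$. The discrete velocity is the function $\boldsymbol u(t,x)=\boldsymbol u^{n+1}(x)$ for $t\in(t^n,t^{n+1}]$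.
   Formalization: Since f(t^{n+1}) is undefined for f merely in L²(0,T;L²), f is taken as a pointwise representative with f(t,·) in L² for all t in (0,T] and the sums of δt‖f(t^{n+1})‖² bounded uniformly in N; without such a bound no uniform C exists. *)

theory Defs
  imports "HOL-Analysis.Analysis" "HOL-Probability.Essential_Supremum"
begin

definition ess_inf :: "'a measure \<Rightarrow> ('a \<Rightarrow> real) \<Rightarrow> ereal" where
  "ess_inf M g = - esssup M (\<lambda>x. ereal (- g x))"

definition in_Linf :: "'a::euclidean_space set \<Rightarrow> ('a \<Rightarrow> real) \<Rightarrow> bool" where
  "in_Linf S g \<longleftrightarrow> g \<in> borel_measurable (lebesgue_on S) \<and>
     esssup (lebesgue_on S) (\<lambda>x. ereal \<bar>g x\<bar>) < \<infinity>"

definition in_L2 :: "'a::euclidean_space set \<Rightarrow> ('a \<Rightarrow> 'b::euclidean_space) \<Rightarrow> bool" where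
  "in_L2 S v \<longleftrightarrow> v \<in> borel_measurable (lebesgue_on S) \<and>
     integrable (lebesgue_on S) (\<lambda>x. (norm (v x))\<^sup>2)"

definition L2norm :: "'a::euclidean_space set \<Rightarrow> ('a \<Rightarrow> 'b::euclidean_space) \<Rightarrow> real" where
  "L2norm S v = sqrt (LINT x|lebesgue_on S. (norm (v x))\<^sup>2)"

abbreviation vol :: "'a::euclidean_space set \<Rightarrow> real" where
  "vol S \<equiv> measure lebesgue S"

definition average :: "'a::euclidean_space set \<Rightarrow> ('a \<Rightarrow> real) \<Rightarrow> real" where
  "average S g = (LINT x|lebesgue_on S. g x) / vol S"

text \<open>An open set is a finite union of rectangles in the sense that its closure is a finite union
  of nondegenerate closed boxes and it is the interior of that union (no slits).\<close>

definition rectangular_domain :: "(real ^ 'n) set \<Rightarrow> bool" where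
  "rectangular_domain \<Omega> \<longleftrightarrow> \<Omega> \<noteq> {} \<and> open \<Omega> \<and> connected \<Omega> \<and> bounded \<Omega> \<and>
     (\<exists>B. finite B \<and> (\<forall>R\<in>B. \<exists>a b. R = cbox a b \<and> box a b \<noteq> {}) \<and> \<Omega> = interior (\<Union>B))"

text \<open>Cells are multi-indices in a Cartesian product of node sequences; only finitely many of
  them belong to the mesh, so that the nodes outside of its range play no role.
  The face \<open>(i, K)\<close>, orthogonal to \<open>e\<^sub>i\<close>, is the lower face of the cell \<open>K\<close> in the direction \<open>i\<close>;
  it is also the upper face of the cell \<open>K - e\<^sub>i\<close>.\<close>

type_synonym 'n cell = "'n \<Rightarrow> int"
type_synonym 'n face = "'n \<times> 'n cell"

record 'n grid =
  nodes :: "'n \<Rightarrow> int \<Rightarrow> real"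
  cells :: "'n cell set"

definition shift :: "'n cell \<Rightarrow> 'n \<Rightarrow> int \<Rightarrow> 'n cell" where
  "shift K i s = K(i := K i + s)"

definition cell_box :: "'n::finite grid \<Rightarrow> 'n cell \<Rightarrow> (real ^ 'n) set" where
  "cell_box G K = cbox (\<chi> i. nodes G i (K i)) (\<chi> i. nodes G i (K i + 1))"

definition region :: "'n::finite grid \<Rightarrow> (real ^ 'n) set" where
  "region G = interior (\<Union>K\<in>cells G. cell_box G K)"

definition mac_grid :: "(real ^ 'n::finite) set \<Rightarrow> 'n grid \<Rightarrow> bool" where
  "mac_grid \<Omega> G \<longleftrightarrow> (\<forall>i. strict_mono (nodes G i)) \<and> finite (cells G) \<and> \<Omega> = region G"

definition width :: "'n grid \<Rightarrow> 'n \<Rightarrow> int \<Rightarrow> real" where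
  "width G i m = nodes G i (m + 1) - nodes G i m"

definition mid :: "'n grid \<Rightarrow> 'n \<Rightarrow> int \<Rightarrow> real" where
  "mid G i m = (nodes G i m + nodes G i (m + 1)) / 2"

definition lo_cell :: "'n face \<Rightarrow> 'n cell" where
  "lo_cell \<sigma> = shift (snd \<sigma>) (fst \<sigma>) (- 1)"

definition up_cell :: "'n face \<Rightarrow> 'n cell" where
  "up_cell \<sigma> = snd \<sigma>"

definition faces :: "'n grid \<Rightarrow> 'n face set" where
  "faces G = {\<sigma>. lo_cell \<sigma> \<in> cells G \<or> up_cell \<sigma> \<in> cells G}"

definition int_faces :: "'n grid \<Rightarrow> 'n face set" where
  "int_faces G = {\<sigma>. lo_cell \<sigma> \<in> cells G \<and> up_cell \<sigma> \<in> cells G}"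

definition cell_faces :: "'n cell \<Rightarrow> 'n face set" where
  "cell_faces K = {\<sigma>. lo_cell \<sigma> = K \<or> up_cell \<sigma> = K}"

text \<open>The neighbour of \<open>K\<close> across \<open>\<sigma>\<close>, and \<open>n\<^bsub>K,\<sigma>\<^esub> \<cdot> e\<^sub>i\<close> for \<open>\<sigma>\<close> orthogonal to \<open>e\<^sub>i\<close>.\<close>

definition across :: "'n cell \<Rightarrow> 'n face \<Rightarrow> 'n cell" where
  "across K \<sigma> = (if up_cell \<sigma> = K then lo_cell \<sigma> else up_cell \<sigma>)"

definition nrm :: "'n cell \<Rightarrow> 'n face \<Rightarrow> real" where
  "nrm K \<sigma> = (if up_cell \<sigma> = K then - 1 else 1)"

definition face_centre :: "'n::finite grid \<Rightarrow> 'n face \<Rightarrow> real ^ 'n" where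
  "face_centre G \<sigma> = (\<chi> l. if l = fst \<sigma> then nodes G l (snd \<sigma> l) else mid G l (snd \<sigma> l))"

definition face_area :: "'n::finite grid \<Rightarrow> 'n face \<Rightarrow> real" where
  "face_area G \<sigma> = (\<Prod>l\<in>UNIV - {fst \<sigma>}. width G l (snd \<sigma> l))"

definition half_cell :: "'n::finite grid \<Rightarrow> 'n cell \<Rightarrow> 'n face \<Rightarrow> (real ^ 'n) set" where
  "half_cell G K \<sigma> =
     {x \<in> cell_box G K. 0 \<le> nrm K \<sigma> * (x $ fst \<sigma> - mid G (fst \<sigma>) (K (fst \<sigma>)))}"

definition dual_cell :: "'n::finite grid \<Rightarrow> 'n face \<Rightarrow> (real ^ 'n) set" where
  "dual_cell G \<sigma> = (\<Union>K\<in>{K \<in> cells G. \<sigma> \<in> cell_faces K}. half_cell G K \<sigma>)"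

text \<open>The dual face \<open>(i, j, K)\<close> is an element of the set of the faces orthogonal to \<open>e\<^sub>j\<close> of
  the dual cells of the \<open>i\<close>-th velocity component. For \<open>j = i\<close> it is the section of the cell \<open>K\<close>
  halfway between its two faces orthogonal to \<open>e\<^sub>i\<close>. For \<open>j \<noteq> i\<close> it lies in the
  hyperplane that contains the face \<open>(j, K)\<close>, between the dual cells of \<open>(i, K - e\<^sub>j)\<close> and \<open>(i, K)\<close>.\<close>

type_synonym 'n dface = "'n \<times> 'n \<times> 'n cell"

fun lo_face :: "'n dface \<Rightarrow> 'n face" where
  "lo_face (i, j, K) = (if j = i then (i, K) else (i, shift K j (- 1)))"

fun up_face :: "'n dface \<Rightarrow> 'n face" where
  "up_face (i, j, K) = (if j = i then (i, shift K i 1) else (i, K))"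

text \<open>The exterior faces seen as faces of their own dual cells, for which \<open>d\<^sub>\<epsilon> = 0\<close>, are left
  out.\<close>

definition dual_faces :: "'n grid \<Rightarrow> 'n \<Rightarrow> 'n \<Rightarrow> 'n dface set" where
  "dual_faces G i j = {\<epsilon>. fst \<epsilon> = i \<and> fst (snd \<epsilon>) = j \<and>
     (if i = j then snd (snd \<epsilon>) \<in> cells G
      else lo_face \<epsilon> \<in> faces G \<or> up_face \<epsilon> \<in> faces G)}"

definition dual_cell_faces :: "'n face \<Rightarrow> 'n dface set" where
  "dual_cell_faces \<sigma> = {\<epsilon>. lo_face \<epsilon> = \<sigma> \<or> up_face \<epsilon> = \<sigma>}"

definition dual_across :: "'n face \<Rightarrow> 'n dface \<Rightarrow> 'n face" where
  "dual_across \<sigma> \<epsilon> = (if lo_face \<epsilon> = \<sigma> then up_face \<epsilon> else lo_face \<epsilon>)"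

text \<open>\<open>n\<^bsub>\<sigma>,\<epsilon>\<^esub> \<cdot> e\<^sub>j\<close> for \<open>\<epsilon>\<close> orthogonal to \<open>e\<^sub>j\<close>.\<close>

definition dual_nrm :: "'n face \<Rightarrow> 'n dface \<Rightarrow> real" where
  "dual_nrm \<sigma> \<epsilon> = (if lo_face \<epsilon> = \<sigma> then 1 else - 1)"

text \<open>The measure of \<open>\<epsilon>\<close> as a face of the dual cell of an interior face.\<close>

fun dual_area :: "'n::finite grid \<Rightarrow> 'n dface \<Rightarrow> real" where
  "dual_area G (i, j, K) =
     (\<Prod>l\<in>UNIV - {j}. if l = i then mid G i (K i) - mid G i (K i - 1) else width G l (K l))"

text \<open>\<open>d\<^sub>\<epsilon>\<close>: distance between the two face centres, or from the only one to the boundary.\<close>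

fun dual_dist :: "'n::finite grid \<Rightarrow> 'n dface \<Rightarrow> real" where
  "dual_dist G (i, j, K) =
     (let \<sigma> = lo_face (i, j, K); \<sigma>' = up_face (i, j, K) in
      if \<sigma> \<in> faces G \<and> \<sigma>' \<in> faces G then dist (face_centre G \<sigma>) (face_centre G \<sigma>')
      else if \<sigma> \<in> faces G then \<bar>face_centre G \<sigma> $ j - nodes G j (K j)\<bar>
      else \<bar>face_centre G \<sigma>' $ j - nodes G j (K j)\<bar>)"

text \<open>\<open>D\<^sub>\<epsilon>\<close>. For \<open>i \<noteq> j\<close> the box is made of one quarter of each of the four cells around
  the dual face. Its intersection with the domain is \<open>\<epsilon> \<times> [x\<^sub>\<sigma>, x\<^sub>\<sigma>\<^sub>'\<^sub>]\<close> inside the domain, and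
  \<open>\<epsilon> \<times> [x\<^sub>\<sigma>, x\<^bsub>\<sigma>,\<epsilon>\<^esub>]\<close> along a flat part of the boundary. At a reentrant corner, where \<open>\<epsilon>\<close> is
  only partially on the boundary, it consists of three quarters, and the dual face is treated as
  one between \<open>\<sigma>\<close> and the exterior face \<open>\<sigma>'\<close> (of zero velocity). Thus the sets for \<open>(i, j, K)\<close>
  and \<open>(j, i, K)\<close> coincide in all cases.\<close>

fun diamond :: "'n::finite grid \<Rightarrow> 'n dface \<Rightarrow> (real ^ 'n) set" where
  "diamond G (i, j, K) =
     (if i = j then cell_box G K
      else region G \<inter>
        cbox (\<chi> l. if l = i \<or> l = j then mid G l (K l - 1) else nodes G l (K l))
             (\<chi> l. if l = i \<or> l = j then mid G l (K l) else nodes G l (K l + 1)))"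

text \<open>Elements of \<open>L\<^sub>\<M>\<close> are given by their values on the cells (those off the mesh are never used).
  Discrete velocities are given by their values on all the faces, \<open>u (i, K)\<close> being
  a value of the \<open>i\<close>-th component.\<close>

definition H_zero :: "'n grid \<Rightarrow> ('n face \<Rightarrow> real) set" where
  "H_zero G = {u. \<forall>\<sigma>. \<sigma> \<notin> int_faces G \<longrightarrow> u \<sigma> = 0}"

definition L_zero :: "'n::finite grid \<Rightarrow> ('n cell \<Rightarrow> real) set" where
  "L_zero G = {q. (\<Sum>K\<in>cells G. vol (cell_box G K) * q K) = 0}"

definition velocity :: "'n::finite grid \<Rightarrow> ('n face \<Rightarrow> real) \<Rightarrow> real ^ 'n \<Rightarrow> real ^ 'n" where
  "velocity G u x =
     (\<chi> i. \<Sum>\<sigma>\<in>{\<sigma> \<in> faces G. fst \<sigma> = i}. u \<sigma> * indicator (dual_cell G \<sigma>) x)"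

text \<open>Since the velocity vanishes off the interior faces, the difference also
  gives \<open>- u\<^sub>\<sigma> n\<^bsub>\<sigma>,\<epsilon>\<^esub> \<cdot> e\<^sub>j / d\<^sub>\<epsilon>\<close> on the boundary.\<close>

definition ddiff :: "'n::finite grid \<Rightarrow> ('n face \<Rightarrow> real) \<Rightarrow> 'n dface \<Rightarrow> real" where
  "ddiff G u \<epsilon> = (u (up_face \<epsilon>) - u (lo_face \<epsilon>)) / dual_dist G \<epsilon>"

definition ddiff_fun ::
    "'n::finite grid \<Rightarrow> ('n face \<Rightarrow> real) \<Rightarrow> 'n \<Rightarrow> 'n \<Rightarrow> real ^ 'n \<Rightarrow> real" where
  "ddiff_fun G u i j x = (\<Sum>\<epsilon>\<in>dual_faces G i j. ddiff G u \<epsilon> * indicator (diamond G \<epsilon>) x)"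

definition H_norm :: "'n::finite grid \<Rightarrow> ('n face \<Rightarrow> real) \<Rightarrow> real" where
  "H_norm G u = sqrt (\<Sum>i\<in>UNIV. \<Sum>j\<in>UNIV. (L2norm (region G) (ddiff_fun G u i j))\<^sup>2)"

definition out_vel :: "('n face \<Rightarrow> real) \<Rightarrow> 'n cell \<Rightarrow> 'n face \<Rightarrow> real" where
  "out_vel u K \<sigma> = u \<sigma> * nrm K \<sigma>"

definition mass_flux ::
    "'n::finite grid \<Rightarrow> ('n cell \<Rightarrow> real) \<Rightarrow> ('n face \<Rightarrow> real) \<Rightarrow> 'n cell \<Rightarrow> 'n face \<Rightarrow> real" where
  "mass_flux G \<rho> u K \<sigma> =
     (if \<sigma> \<in> int_faces G
      then face_area G \<sigma> * (if out_vel u K \<sigma> \<ge> 0 then \<rho> K else \<rho> (across K \<sigma>)) * out_vel u K \<sigma>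
      else 0)"

definition dual_density :: "'n::finite grid \<Rightarrow> ('n cell \<Rightarrow> real) \<Rightarrow> 'n face \<Rightarrow> real" where
  "dual_density G \<rho> \<sigma> =
     (vol (half_cell G (lo_cell \<sigma>) \<sigma>) * \<rho> (lo_cell \<sigma>) +
      vol (half_cell G (up_cell \<sigma>) \<sigma>) * \<rho> (up_cell \<sigma>)) / vol (dual_cell G \<sigma>)"

text \<open>In the second case, \<open>(j, K)\<close> and \<open>(j, K - e\<^sub>i)\<close> are the faces of the upper and of the lower
  cell of \<open>\<sigma>\<close> which contain the two halves of \<open>\<epsilon>\<close>.\<close>

fun dual_flux ::
    "'n::finite grid \<Rightarrow> ('n cell \<Rightarrow> real) \<Rightarrow> ('n face \<Rightarrow> real) \<Rightarrow> 'n face \<Rightarrow> 'n dface \<Rightarrow> real" where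
  "dual_flux G \<rho> u \<sigma> (i, j, K) =
     (if j = i
      then (- mass_flux G \<rho> u K \<sigma> + mass_flux G \<rho> u K (dual_across \<sigma> (i, j, K))) / 2
      else (mass_flux G \<rho> u (up_cell \<sigma>) (j, K) +
            mass_flux G \<rho> u (lo_cell \<sigma>) (j, shift K i (- 1))) / 2)"

definition upwind_vel ::
    "'n::finite grid \<Rightarrow> ('n cell \<Rightarrow> real) \<Rightarrow> ('n face \<Rightarrow> real) \<Rightarrow> 'n face \<Rightarrow> 'n dface \<Rightarrow> real" where
  "upwind_vel G \<rho> u \<sigma> \<epsilon> = (if dual_flux G \<rho> u \<sigma> \<epsilon> \<ge> 0 then u \<sigma> else u (dual_across \<sigma> \<epsilon>))"

text \<open>For \<open>i \<noteq> j\<close>, the cells around the dual face are the four cells adjacent to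
  \<open>\<sigma>\<close> and \<open>\<sigma>'\<close> in the interior, and those adjacent to \<open>\<sigma>\<close> on the boundary.\<close>

fun viscosity ::
    "'n::finite grid \<Rightarrow> (real \<Rightarrow> real) \<Rightarrow> ('n cell \<Rightarrow> real) \<Rightarrow> 'n dface \<Rightarrow> real" where
  "viscosity G \<mu> \<rho> (i, j, K) =
     (if i = j then \<mu> (\<rho> K)
      else (1 / 4) * (\<Sum>L\<in>cells G \<inter>
               {K, shift K i (- 1), shift K j (- 1), shift (shift K i (- 1)) j (- 1)}.
               vol (cell_box G L) * \<mu> (\<rho> L)) / vol (diamond G (i, j, K)))"

fun transp :: "'n dface \<Rightarrow> 'n dface" where
  "transp (i, j, K) = (j, i, K)"

definition diffusion ::
    "'n::finite grid \<Rightarrow> (real \<Rightarrow> real) \<Rightarrow> ('n cell \<Rightarrow> real) \<Rightarrow> ('n face \<Rightarrow> real) \<Rightarrow> 'n face \<Rightarrow> real" where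
  "diffusion G \<mu> \<rho> u \<sigma> =
     (\<Sum>\<epsilon>\<in>dual_cell_faces \<sigma>. dual_area G \<epsilon> / vol (dual_cell G \<sigma>) * (viscosity G \<mu> \<rho> \<epsilon> / 2) *
        (ddiff G u \<epsilon> + ddiff G u (transp \<epsilon>)) * dual_nrm \<sigma> \<epsilon>)"

text \<open>For \<open>K\<close> and \<open>L\<close> the lower and the upper cell of \<open>\<sigma>\<close>, \<open>n\<^bsub>K,\<sigma>\<^esub> \<cdot> e\<^sub>i = 1\<close>.\<close>

definition pressure_grad :: "'n::finite grid \<Rightarrow> ('n cell \<Rightarrow> real) \<Rightarrow> 'n face \<Rightarrow> real" where
  "pressure_grad G p \<sigma> =
     face_area G \<sigma> / vol (dual_cell G \<sigma>) * (p (up_cell \<sigma>) - p (lo_cell \<sigma>))"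

definition mac_scheme ::
    "'n::finite grid \<Rightarrow> nat \<Rightarrow> real \<Rightarrow>
     (real ^ 'n \<Rightarrow> real) \<Rightarrow> (real ^ 'n \<Rightarrow> real ^ 'n) \<Rightarrow> (real \<Rightarrow> real) \<Rightarrow> (real \<Rightarrow> real ^ 'n \<Rightarrow> real ^ 'n) \<Rightarrow>
     (nat \<Rightarrow> 'n cell \<Rightarrow> real) \<Rightarrow> (nat \<Rightarrow> 'n face \<Rightarrow> real) \<Rightarrow> (nat \<Rightarrow> 'n cell \<Rightarrow> real) \<Rightarrow> bool" where
  "mac_scheme G N \<delta>t \<rho>0 u0 \<mu> f \<rho> u p \<longleftrightarrow>
     (\<forall>K\<in>cells G. \<rho> 0 K = average (cell_box G K) \<rho>0) \<and>
     u 0 \<in> H_zero G \<and>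
     (\<forall>\<sigma>\<in>int_faces G. u 0 \<sigma> = average (dual_cell G \<sigma>) (\<lambda>x. u0 x $ fst \<sigma>)) \<and>
     (\<forall>n<N. u (Suc n) \<in> H_zero G \<and> p (Suc n) \<in> L_zero G \<and>
       (\<forall>K\<in>cells G.
          (\<rho> (Suc n) K - \<rho> n K) / \<delta>t +
          (\<Sum>\<sigma>\<in>cell_faces K. mass_flux G (\<rho> (Suc n)) (u (Suc n)) K \<sigma>) / vol (cell_box G K) = 0) \<and>
       (\<forall>K\<in>cells G. (\<Sum>\<sigma>\<in>cell_faces K. face_area G \<sigma> * out_vel (u (Suc n)) K \<sigma>) = 0) \<and>
       (\<forall>\<sigma>\<in>int_faces G.
          (dual_density G (\<rho> (Suc n)) \<sigma> * u (Suc n) \<sigma> - dual_density G (\<rho> n) \<sigma> * u n \<sigma>) / \<delta>t +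
          (\<Sum>\<epsilon>\<in>dual_cell_faces \<sigma>. dual_flux G (\<rho> (Suc n)) (u (Suc n)) \<sigma> \<epsilon> *
              upwind_vel G (\<rho> (Suc n)) (u (Suc n)) \<sigma> \<epsilon>) / vol (dual_cell G \<sigma>) -
          diffusion G \<mu> (\<rho> (Suc n)) (u (Suc n)) \<sigma> +
          pressure_grad G (p (Suc n)) \<sigma>
          = average (dual_cell G \<sigma>) (\<lambda>x. f (real (Suc n) * \<delta>t) x $ fst \<sigma>)))"

text \<open>The function of time which is equal to \<open>u\<^sup>n\<^sup>+\<^sup>1\<close> on \<open>(n \<delta>t, (n + 1) \<delta>t]\<close>.\<close>

definition in_time :: "real \<Rightarrow> (nat \<Rightarrow> 'a) \<Rightarrow> real \<Rightarrow> 'a" where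
  "in_time \<delta>t u t = u (nat \<lceil>t / \<delta>t\<rceil>)"

text \<open>The momentum equation samples the source at the discrete times, which is not a well-defined
  operation on \<open>L\<^sup>2(0,T;L\<^sup>2(\<Omega>)\<^sup>d)\<close>: the values on a null set of times of an arbitrary
  representative are unrelated to its norm. The representative is therefore required to have
  bounded discrete norms; this holds for sources in \<open>C([0,T];L\<^sup>2(\<Omega>)\<^sup>d)\<close>, and every class
  has such representatives.\<close>

definition bounded_samples :: "real \<Rightarrow> 'a::euclidean_space set \<Rightarrow> (real \<Rightarrow> 'a \<Rightarrow> 'a) \<Rightarrow> bool" where
  "bounded_samples T \<Omega> f \<longleftrightarrow>
     (\<exists>B. \<forall>N\<ge>1. (\<Sum>n<N. T / real N * (L2norm \<Omega> (f (real (Suc n) * (T / real N))))\<^sup>2) \<le> B)"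

end

theory Submission
  imports Defs
begin

text \<open>The upwind mass balance and the discrete divergence constraint give a maximum principle, so
  that the density stays between the essential bounds of \<open>\<rho>\<^sub>0\<close> and the viscosity is bounded below.
  Testing the momentum balance with \<open>u\<^sup>n\<^sup>+\<^sup>1\<close>, the time derivative and the upwind convection combine,
  through the mass balance on dual cells, into the increment of the kinetic energy plus nonnegative
  terms; the pressure drops out, and Korn's identity for velocities of zero divergence bounds the
  viscous term below. If \<open>M\<close> is the maximal \<open>L\<^sup>2\<close> norm of the velocity, the summed inequality reads
  \<open>\<rho>\<^sub>m\<^sub>i\<^sub>n M\<^sup>2 / 2 + (\<mu>\<^sub>m\<^sub>i\<^sub>n / 2) \<Sum> \<delta>t \<parallel>u\<parallel>\<^sup>2 \<le> E\<^sub>0 + M \<Sum> \<delta>t \<parallel>f\<parallel>\<close>; it first bounds \<open>M\<close>, then the dissipation, and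
  neither Poincare's inequality nor Gronwall's lemma is needed.\<close>

section \<open>Faces, dual faces and fluxes\<close>

text \<open>Korn's identity is exact here: after translations of the index, the products of
  \<open>ddiff\<close> at \<open>(i, j, K)\<close> and \<open>(j, i, K)\<close> become products of
  diagonal differences, so the cross terms of the strain add up to the squared norm of the discrete
  divergence, which is zero. The boundary shapes the proof. A variable viscosity can be replaced by
  a lower bound only where the terms of \<open>(i, j, K)\<close> and \<open>(j, i, K)\<close>
  combine to a square, which needs equal weights; but on a flat boundary the two weights differ, and
  at a reentrant corner they exceed the volume of the diamond. Both defects are harmless: with
  unequal weights at least one of the two dual faces is inactive and has zero difference, and a
  weight above the volume errs in the favourable direction. All sums over dual faces run over one
  finite index set \<open>near\<close>, so that translations produce no boundary terms. The source
  is kept linear in the velocity norm; the time sum of its norms is bounded through Young's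
  inequality by the sampled squares, so that no constant sees the grid or the time step.\<close>

lemma shift_apply: "shift K i s l = (if l = i then K l + s else K l)"
  by (simp add: shift_def)

lemma shift_shift [simp]: "shift (shift K i s) i t = shift K i (s + t)"
  by (simp add: shift_def algebra_simps)

lemma shift_zero [simp]: "shift K i 0 = K"
  by (simp add: shift_def)

lemma shift_commute: "shift (shift K i s) j t = shift (shift K j t) i s"
  by (auto simp: shift_def fun_eq_iff)

lemma shift_eq_iff: "shift K i s = L \<longleftrightarrow> K = shift L i (- s)"
  by (auto simp: shift_def fun_eq_iff)

lemma shift_neq [simp]: "s \<noteq> 0 \<Longrightarrow> shift K i s \<noteq> K" "s \<noteq> 0 \<Longrightarrow> K \<noteq> shift K i s"
  by (auto simp: shift_def fun_eq_iff)

lemma shift_inject [simp]: "shift K i s = shift L i s \<longleftrightarrow> K = L"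
  by (auto simp: shift_def fun_eq_iff)

lemma lo_cell_simp [simp]: "lo_cell (i, K) = shift K i (- 1)"
  by (simp add: lo_cell_def)

lemma up_cell_simp [simp]: "up_cell (i, K) = K"
  by (simp add: up_cell_def)

lemma cell_faces_eq:
  "cell_faces (K :: 'n::finite cell) = range (\<lambda>i. (i, K)) \<union> range (\<lambda>i. (i, shift K i 1))"
  by (auto simp: cell_faces_def shift_eq_iff)

lemma finite_cell_faces [simp]: "finite (cell_faces (K :: 'n::finite cell))"
  by (simp add: cell_faces_eq)

lemma sum_cell_faces:
  "(\<Sum>\<sigma>\<in>cell_faces (K :: 'n::finite cell). g \<sigma>) = (\<Sum>i\<in>UNIV. g (i, K) + g (i, shift K i 1))"
  unfolding cell_faces_eq
  by (subst sum.union_disjoint) (auto simp: sum.reindex inj_on_def sum.distrib)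

text \<open>One dual face below and one above in each direction. Along \<open>i\<close> they are
  mid-sections of the two adjacent primal cells and carry the indices of those cells; in another
  direction a dual face carries the index of the upper of the two faces that it separates.\<close>

lemma dual_cell_faces_eq:
  "dual_cell_faces (i :: 'n::finite, K) =
     range (\<lambda>j. if j = i then (i, i, shift K i (- 1)) else (i, j, K)) \<union>
     range (\<lambda>j. if j = i then (i, i, K) else (i, j, shift K j 1))"
proof -
  have "(lo_face (a, b, L) = (i, K) \<or> up_face (a, b, L) = (i, K)) \<longleftrightarrow>
    (a, b, L) \<in> range (\<lambda>j. if j = i then (i, i, shift K i (- 1)) else (i, j, K)) \<union>
     range (\<lambda>j. if j = i then (i, i, K) else (i, j, shift K j 1))" for a b L
    by (auto simp: shift_eq_iff image_iff split: if_splits)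
  then show ?thesis
    unfolding dual_cell_faces_def by (intro set_eqI) (simp only: split_paired_all mem_Collect_eq)
qed

lemma finite_dual_cell_faces [simp]: "finite (dual_cell_faces (\<sigma> :: 'n::finite face))"
  by (cases \<sigma>) (simp add: dual_cell_faces_eq)

lemma sum_dual_cell_faces:
  "(\<Sum>\<epsilon>\<in>dual_cell_faces (i :: 'n::finite, K). g \<epsilon>) =
     (\<Sum>j\<in>UNIV. g (if j = i then (i, i, shift K i (- 1)) else (i, j, K)) +
       g (if j = i then (i, i, K) else (i, j, shift K j 1)))"
proof -
  let ?a = "\<lambda>j. if j = i then (i, i, shift K i (- 1)) else (i, j, K)"
  let ?b = "\<lambda>j. if j = i then (i, i, K) else (i, j, shift K j 1)"
  have inj: "inj ?a" "inj ?b"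
    by (simp_all add: inj_def)
  have "range ?a \<inter> range ?b = {}"
    by (auto simp del: if_image_distrib split: if_splits)
  then show ?thesis
    unfolding dual_cell_faces_eq
    by (simp only: sum.union_disjoint finite_imageI finite_code
        sum.reindex[OF inj(1)] sum.reindex[OF inj(2)] sum.distrib o_def)
qed

lemma lo_face_neq_up_face [simp]: "lo_face \<epsilon> \<noteq> up_face \<epsilon>" "up_face \<epsilon> \<noteq> lo_face \<epsilon>"
  by (cases \<epsilon>; auto)+

lemma nrm_simps [simp]: "nrm (up_cell \<sigma>) \<sigma> = - 1" "nrm (lo_cell \<sigma>) \<sigma> = 1"
  by (cases \<sigma>; simp add: nrm_def)+

lemma across_simps [simp]: "across (up_cell \<sigma>) \<sigma> = lo_cell \<sigma>" "across (lo_cell \<sigma>) \<sigma> = up_cell \<sigma>"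
  by (cases \<sigma>; simp add: across_def)+

lemma dual_across_simps [simp]:
  "dual_across (lo_face \<epsilon>) \<epsilon> = up_face \<epsilon>" "dual_across (up_face \<epsilon>) \<epsilon> = lo_face \<epsilon>"
  by (auto simp: dual_across_def)

lemma dual_nrm_simps [simp]: "dual_nrm (lo_face \<epsilon>) \<epsilon> = 1" "dual_nrm (up_face \<epsilon>) \<epsilon> = - 1"
  by (auto simp: dual_nrm_def)

lemma sum_incidence:
  fixes g :: "'a \<Rightarrow> 'b \<Rightarrow> real"
  assumes "finite S" "finite E"
    and zero: "\<And>\<sigma> \<epsilon>. \<sigma> \<notin> S \<Longrightarrow> g \<sigma> \<epsilon> = 0"
    and neq: "\<And>\<epsilon>. a \<epsilon> \<noteq> b \<epsilon>"
    and sub: "\<And>\<sigma> \<epsilon>. \<sigma> \<in> S \<Longrightarrow> a \<epsilon> = \<sigma> \<or> b \<epsilon> = \<sigma> \<Longrightarrow> \<epsilon> \<in> E"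
  shows "(\<Sum>\<sigma>\<in>S. \<Sum>\<epsilon>\<in>{\<epsilon>. a \<epsilon> = \<sigma> \<or> b \<epsilon> = \<sigma>}. g \<sigma> \<epsilon>) = (\<Sum>\<epsilon>\<in>E. g (a \<epsilon>) \<epsilon> + g (b \<epsilon>) \<epsilon>)"
proof -
  have "(\<Sum>\<sigma>\<in>S. \<Sum>\<epsilon>\<in>{\<epsilon>. a \<epsilon> = \<sigma> \<or> b \<epsilon> = \<sigma>}. g \<sigma> \<epsilon>) =
      (\<Sum>\<sigma>\<in>S. \<Sum>\<epsilon>\<in>{\<epsilon>. \<epsilon> \<in> E \<and> (a \<epsilon> = \<sigma> \<or> b \<epsilon> = \<sigma>)}. g \<sigma> \<epsilon>)"
    using sub by (intro sum.cong refl) auto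
  also have "\<dots> = (\<Sum>\<epsilon>\<in>E. \<Sum>\<sigma>\<in>{\<sigma>. \<sigma> \<in> S \<and> (a \<epsilon> = \<sigma> \<or> b \<epsilon> = \<sigma>)}. g \<sigma> \<epsilon>)"
    using assms by (intro sum.swap_restrict)
  also have "\<dots> = (\<Sum>\<epsilon>\<in>E. \<Sum>\<sigma>\<in>{a \<epsilon>, b \<epsilon>}. g \<sigma> \<epsilon>)"
    using zero by (intro sum.cong refl sum.mono_neutral_left) auto
  also have "\<dots> = (\<Sum>\<epsilon>\<in>E. g (a \<epsilon>) \<epsilon> + g (b \<epsilon>) \<epsilon>)"
    using neq by (intro sum.cong refl) auto
  finally show ?thesis .
qed

text \<open>The two sides see opposite velocities and hence choose the same upwind density. For zero
  velocity the choices differ, but both fluxes vanish.\<close>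

lemma mass_flux_antisym: "mass_flux G \<rho> u (up_cell \<sigma>) \<sigma> = - mass_flux G \<rho> u (lo_cell \<sigma>) \<sigma>"
  by (auto simp: mass_flux_def out_vel_def)

lemma mass_flux_antisym_pair: "mass_flux G \<rho> u (shift K i (- 1)) (i, K) = - mass_flux G \<rho> u K (i, K)"
  using mass_flux_antisym[of G \<rho> u "(i, K)"] by simp

text \<open>For \<open>j = i\<close> the two terms of the half-difference change places. For
  \<open>j \<noteq> i\<close> both ends use the same two primal faces, seen from opposite cells, so
  conservativity of the primal flux applies to each half.\<close>

lemma dual_flux_antisym: "dual_flux G \<rho> u (up_face \<epsilon>) \<epsilon> = - dual_flux G \<rho> u (lo_face \<epsilon>) \<epsilon>"
proof -
  obtain i j K where e: "\<epsilon> = (i, j, K)" by (cases \<epsilon>)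
  have 1: "dual_across (i, K) (i, i, K) = (i, shift K i 1)"
    "dual_across (i, shift K i 1) (i, i, K) = (i, K)"
    using dual_across_simps[of "(i, i, K)"] by auto
  show ?thesis
    using mass_flux_antisym_pair[of G \<rho> u K j] mass_flux_antisym_pair[of G \<rho> u "shift K i (- 1)" j]
    by (auto simp: e 1 shift_commute[of K j "-1" i "-1"] field_simps)
qed

text \<open>The primal fluxes through \<open>\<sigma>\<close> itself enter from both cells and
  cancel; what remains are the outer fluxes of the two cells, each with the factor one half. This is
  why a mass balance on dual cells follows from the primal one.\<close>

lemma sum_dual_flux:
  "(\<Sum>\<epsilon>\<in>dual_cell_faces \<sigma>. dual_flux G \<rho> u \<sigma> \<epsilon>) =
     ((\<Sum>\<tau>\<in>cell_faces (lo_cell \<sigma>). mass_flux G \<rho> u (lo_cell \<sigma>) \<tau>) +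
      (\<Sum>\<tau>\<in>cell_faces (up_cell \<sigma>). mass_flux G \<rho> u (up_cell \<sigma>) \<tau>)) / 2"
proof -
  obtain i K where s: "\<sigma> = (i, K)" by (cases \<sigma>)
  let ?F = "mass_flux G \<rho> u" and ?L = "shift K i (- 1)"
  have 1: "dual_across (i, K) (i, i, K) = (i, shift K i 1)"
    "dual_across (i, K) (i, i, shift K i (- 1)) = (i, shift K i (- 1))"
    using dual_across_simps[of "(i, i, K)"] dual_across_simps[of "(i, i, shift K i (- 1))"] by auto
  have "(\<Sum>\<epsilon>\<in>dual_cell_faces \<sigma>. dual_flux G \<rho> u \<sigma> \<epsilon>) =
      (\<Sum>j\<in>UNIV. (?F K (j, K) + ?F K (j, shift K j 1)) / 2 + (?F ?L (j, ?L) + ?F ?L (j, shift ?L j 1)) / 2)"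
    unfolding s sum_dual_cell_faces
  proof (intro sum.cong refl)
    fix j
    show "dual_flux G \<rho> u (i, K) (if j = i then (i, i, shift K i (- 1)) else (i, j, K)) +
         dual_flux G \<rho> u (i, K) (if j = i then (i, i, K) else (i, j, shift K j 1)) =
         (?F K (j, K) + ?F K (j, shift K j 1)) / 2 + (?F ?L (j, ?L) + ?F ?L (j, shift ?L j 1)) / 2"
    proof (cases "j = i")
      case True
      then show ?thesis
        using mass_flux_antisym_pair[of G \<rho> u K i] by (simp add: 1 field_simps)
    next
      case False
      then show ?thesis
        by (simp add: shift_commute[of K j "1" i "-1"] field_simps)
    qed
  qed
  also have "\<dots> = ((\<Sum>\<tau>\<in>cell_faces ?L. ?F ?L \<tau>) + (\<Sum>\<tau>\<in>cell_faces K. ?F K \<tau>)) / 2"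
    unfolding sum_cell_faces sum.distrib sum_divide_distrib[symmetric] by (simp add: field_simps)
  finally show ?thesis by (simp add: s)
qed

text \<open>The expression equals \<open>\<bar>F\<bar> * (a - b)\<^sup>2\<close>, the numerical
  dissipation of upwinding across one dual face. Zero flux is split off because then each end
  selects its own value.\<close>

lemma upwind_energy_nonneg:
  fixes F F' a b :: real
  assumes "F' = - F"
  shows "0 \<le> F * (2 * (if F \<ge> 0 then a else b) * a - a\<^sup>2) + F' * (2 * (if F' \<ge> 0 then b else a) * b - b\<^sup>2)"
proof (cases "F = 0")
  case True
  then show ?thesis using assms by simp
next
  case False
  then consider "F > 0" | "F < 0" by linarith
  then show ?thesis
  proof cases
    case 1
    have "F * (2 * a * a - a\<^sup>2) + F' * (2 * a * b - b\<^sup>2) = F * (a - b)\<^sup>2"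
      by (simp add: assms power2_eq_square algebra_simps)
    then show ?thesis using 1 by (simp add: assms)
  next
    case 2
    have "F * (2 * b * a - a\<^sup>2) + F' * (2 * b * b - b\<^sup>2) = (- F) * (a - b)\<^sup>2"
      by (simp add: assms power2_eq_square algebra_simps)
    moreover have "\<dots> \<ge> 0" using 2 by (intro mult_nonneg_nonneg) auto
    ultimately show ?thesis using 2 by (simp add: assms)
  qed
qed

text \<open>The domain is left out so that the locale can also be interpreted at
  \<open>mid_grid\<close>, whose cells cover a different set.\<close>

locale mac_mesh =
  fixes G :: "'n::finite grid"
  assumes nodes_mono: "\<And>i. strict_mono (nodes G i)" and finite_cells: "finite (cells G)"
begin

lemma finite_int_faces: "finite (int_faces G)"
  by (rule finite_subset[of _ "UNIV \<times> cells G"]) (auto simp: int_faces_def finite_cells)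

text \<open>A common finite index set for sums over faces and dual faces. Radius 2 leaves room for
  two unit shifts of a mesh cell, possibly in the same direction, so that the translates of products
  of velocity values stay inside.\<close>

definition near :: "'n cell set" where
  "near = (\<Union>L\<in>cells G. {K. \<forall>i. K i \<in> {L i - 2..L i + 2}})"

lemma finite_near: "finite near"
proof -
  have "{K. \<forall>i. K i \<in> {L i - 2..L i + 2}} = PiE UNIV (\<lambda>i. {L i - 2..L i + 2})" for L :: "'n cell"
    by (auto simp: PiE_def Pi_def extensional_def)
  moreover have "finite (PiE UNIV (\<lambda>i. {L i - 2..L i + 2}))" for L :: "'n cell"
    by (intro finite_PiE) auto
  ultimately show ?thesis
    unfolding near_def using finite_cells by auto
qed

lemma near_shift:
  assumes "L \<in> cells G"
  shows "L \<in> near" "\<bar>s\<bar> \<le> 1 \<Longrightarrow> shift L i s \<in> near"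
    "\<bar>s\<bar> \<le> 1 \<Longrightarrow> \<bar>t\<bar> \<le> 1 \<Longrightarrow> shift (shift L i s) j t \<in> near"
  using assms unfolding near_def by (auto simp: shift_apply intro!: bexI[of _ L])

text \<open>Nothing is lost at the rim of \<open>near\<close>, since the index of a nonzero term and
  its translate both lie inside.\<close>

lemma sum_near_shift:
  fixes h :: "'n cell \<Rightarrow> real"
  assumes "\<And>K. h K \<noteq> 0 \<Longrightarrow> K \<in> near \<and> shift K i (- s) \<in> near"
  shows "(\<Sum>K\<in>near. h (shift K i s)) = (\<Sum>K\<in>near. h K)"
proof -
  have inj: "inj_on (\<lambda>K. shift K i s) near" by (auto simp: inj_on_def)
  have "(\<Sum>K\<in>near. h (shift K i s)) = (\<Sum>K\<in>(\<lambda>K. shift K i s) ` near. h K)"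
    by (simp add: sum.reindex[OF inj])
  also have "\<dots> = (\<Sum>K\<in>near \<union> (\<lambda>K. shift K i s) ` near. h K)"
  proof (intro sum.mono_neutral_left)
    show "\<forall>K\<in>near \<union> (\<lambda>K. shift K i s) ` near - (\<lambda>K. shift K i s) ` near. h K = 0"
    proof
      fix K assume "K \<in> near \<union> (\<lambda>K. shift K i s) ` near - (\<lambda>K. shift K i s) ` near"
      then have "K \<notin> (\<lambda>K. shift K i s) ` near" by auto
      moreover have "K = shift (shift K i (- s)) i s" by simp
      ultimately have "shift K i (- s) \<notin> near" by (metis imageI)
      with assms[of K] show "h K = 0" by auto
    qed
  qed (auto simp: finite_near)
  also have "\<dots> = (\<Sum>K\<in>near. h K)"
    using assms finite_near by (intro sum.mono_neutral_right) auto
  finally show ?thesis .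
qed

end

section \<open>Volumes of cells and dual cells\<close>

lemma vol_cbox_vec:
  fixes a b :: "'n::finite \<Rightarrow> real"
  assumes "\<And>l. a l \<le> b l"
  shows "vol (cbox (\<chi> l. a l) (\<chi> l. b l)) = (\<Prod>l\<in>UNIV. b l - a l)"
proof -
  have "cbox (\<chi> l. a l) (\<chi> l. b l) \<noteq> {}"
    using assms by (auto simp: interval_ne_empty_cart less_eq_vec_def)
  then show ?thesis
    using content_cbox_cart[of "\<chi> l. a l" "\<chi> l. b l"] by (simp add: measure_completion)
qed

lemma negligible_coordinate_hyperplane: "negligible {x :: real ^ 'n::finite. x $ l = c}"
  using negligible_standard_hyperplane[of "axis l (1 :: real)" c]
  by (simp add: cart_eq_inner_axis axis_in_Basis_iff)

lemma cell_box_iff: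
  "x \<in> cell_box G K \<longleftrightarrow> (\<forall>l. nodes G l (K l) \<le> x $ l \<and> x $ l \<le> nodes G l (K l + 1))"
  by (simp add: cell_box_def mem_box_cart)

lemma cell_box_lmeasurable [simp]: "cell_box G K \<in> lmeasurable"
  by (simp add: cell_box_def)

text \<open>The grid whose nodes are the midpoints of the original one in the directions of \<open>A\<close>:
  its cells are the dual cells (\<open>A\<close> a singleton) and the diamonds (\<open>A\<close> a pair).\<close>

definition mid_grid :: "'n grid \<Rightarrow> 'n set \<Rightarrow> 'n grid" where
  "mid_grid G A =
     \<lparr>nodes = (\<lambda>l m. if l \<in> A then mid G l (m - 1) else nodes G l m), cells = cells G\<rparr>"

lemma nodes_mid_grid:
  "nodes (mid_grid G A) l m = (if l \<in> A then mid G l (m - 1) else nodes G l m)"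
  by (simp add: mid_grid_def)

context mac_mesh
begin

lemma nodes_less: "k < m \<Longrightarrow> nodes G i k < nodes G i m"
  using nodes_mono[of i] by (simp add: strict_mono_def)

lemma nodes_le: "k \<le> m \<Longrightarrow> nodes G i k \<le> nodes G i m"
  using nodes_less[of k m i] by (cases "k = m") auto

lemma width_pos [simp]: "0 < width G i m"
  using nodes_less[of m "m + 1" i] by (simp add: width_def)

lemma width_nonneg [simp]: "0 \<le> width G i m"
  using width_pos[of i m] by linarith

lemma mid_between: "nodes G i m < mid G i m" "mid G i m < nodes G i (m + 1)"
  using nodes_less[of m "m + 1" i] by (simp_all add: mid_def)

lemma mid_mono: "k < m \<Longrightarrow> mid G i k < mid G i m"
  using nodes_less[of k m i] nodes_less[of "k + 1" "m + 1" i] by (simp add: mid_def)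

lemma mid_diff: "mid G i k - mid G i (k - 1) = (width G i (k - 1) + width G i k) / 2"
  by (simp add: mid_def width_def field_simps)

lemma vol_cell_box: "vol (cell_box G K) = (\<Prod>l\<in>UNIV. width G l (K l))"
  using vol_cbox_vec[of "\<lambda>l. nodes G l (K l)" "\<lambda>l. nodes G l (K l + 1)"]
  by (simp add: cell_box_def width_def nodes_le)

lemma vol_cell_box_pos [simp]: "0 < vol (cell_box G K)"
  by (simp add: vol_cell_box prod_pos)

lemma negligible_cell_box_Int:
  assumes "K \<noteq> L"
  shows "negligible (cell_box G K \<inter> cell_box G L)"
proof -
  have *: "negligible (cell_box G K \<inter> cell_box G L)" if l: "K l < L l" for K L :: "'n cell" and l
  proof (rule negligible_subset)
    show "negligible {x :: real ^ 'n. x $ l = nodes G l (L l)}"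
      by (rule negligible_coordinate_hyperplane)
    show "cell_box G K \<inter> cell_box G L \<subseteq> {x. x $ l = nodes G l (L l)}"
    proof
      fix x assume "x \<in> cell_box G K \<inter> cell_box G L"
      then have "x $ l \<le> nodes G l (K l + 1)" "nodes G l (L l) \<le> x $ l"
        by (auto simp: cell_box_iff)
      moreover have "nodes G l (K l + 1) \<le> nodes G l (L l)"
        using l by (intro nodes_le) auto
      ultimately show "x \<in> {x. x $ l = nodes G l (L l)}" by simp
    qed
  qed
  obtain l where "K l \<noteq> L l" using assms by auto
  then show ?thesis
    using *[of K l L] *[of L l K] by (cases "K l < L l") (auto simp: Int_commute)
qed

lemma mid_grid_mesh: "mac_mesh (mid_grid G A)"
proof
  show "strict_mono (nodes (mid_grid G A) i)" for i
    using nodes_less mid_mono by (auto simp: strict_mono_def nodes_mid_grid)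
  show "finite (cells (mid_grid G A))"
    by (simp add: mid_grid_def finite_cells)
qed

section \<open>Half cells and dual cells\<close>

lemma half_cell_eq:
  assumes "\<sigma> \<in> cell_faces K"
  shows "half_cell G K \<sigma> =
    cbox (\<chi> l. if l = fst \<sigma> \<and> up_cell \<sigma> \<noteq> K then mid G l (K l) else nodes G l (K l))
         (\<chi> l. if l = fst \<sigma> \<and> up_cell \<sigma> = K then mid G l (K l) else nodes G l (K l + 1))"
proof (rule set_eqI)
  fix x
  let ?i = "fst \<sigma>"
  have split: "(\<forall>l. P l) \<longleftrightarrow> P ?i \<and> (\<forall>l. l \<noteq> ?i \<longrightarrow> P l)" for P by metis
  have "nodes G ?i (K ?i) < mid G ?i (K ?i)" "mid G ?i (K ?i) < nodes G ?i (K ?i + 1)"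
    by (rule mid_between)+
  then have m: "a \<le> mid G ?i (K ?i) \<Longrightarrow> a \<le> nodes G ?i (K ?i + 1)"
    "mid G ?i (K ?i) \<le> a \<Longrightarrow> nodes G ?i (K ?i) \<le> a" for a by auto
  show "x \<in> half_cell G K \<sigma> \<longleftrightarrow> x \<in>
    cbox (\<chi> l. if l = ?i \<and> up_cell \<sigma> \<noteq> K then mid G l (K l) else nodes G l (K l))
         (\<chi> l. if l = ?i \<and> up_cell \<sigma> = K then mid G l (K l) else nodes G l (K l + 1))"
    unfolding half_cell_def mem_Collect_eq cell_box_iff mem_box_cart vec_lambda_beta
    by (subst (1 2) split) (use m in \<open>auto simp: nrm_def\<close>)
qed

lemma half_cell_lmeasurable: "\<sigma> \<in> cell_faces K \<Longrightarrow> half_cell G K \<sigma> \<in> lmeasurable"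
  by (simp add: half_cell_eq)

lemma vol_half_cell:
  assumes "\<sigma> \<in> cell_faces K"
  shows "vol (half_cell G K \<sigma>) = vol (cell_box G K) / 2"
proof -
  let ?a = "\<lambda>l. if l = fst \<sigma> \<and> up_cell \<sigma> \<noteq> K then mid G l (K l) else nodes G l (K l)"
  let ?b = "\<lambda>l. if l = fst \<sigma> \<and> up_cell \<sigma> = K then mid G l (K l) else nodes G l (K l + 1)"
  have "vol (half_cell G K \<sigma>) = (\<Prod>l\<in>UNIV. ?b l - ?a l)"
    unfolding half_cell_eq[OF assms]
    by (rule vol_cbox_vec) (use mid_between[THEN less_imp_le] nodes_le in auto)
  also have "\<dots> = (\<Prod>l\<in>UNIV. width G l (K l) * (if l = fst \<sigma> then 1 / 2 else 1))"
    by (intro prod.cong refl) (auto simp: mid_def width_def field_simps)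
  also have "\<dots> = vol (cell_box G K) / 2"
    by (simp add: prod.distrib vol_cell_box)
  finally show ?thesis .
qed

lemma int_faces_cells: "\<sigma> \<in> int_faces G \<Longrightarrow> {K \<in> cells G. \<sigma> \<in> cell_faces K} = {lo_cell \<sigma>, up_cell \<sigma>}"
  by (auto simp: int_faces_def cell_faces_def)

lemma in_cell_faces [simp]: "\<sigma> \<in> cell_faces (lo_cell \<sigma>)" "\<sigma> \<in> cell_faces (up_cell \<sigma>)"
  by (auto simp: cell_faces_def)

lemma dual_cell_lmeasurable [simp]: "dual_cell G \<sigma> \<in> lmeasurable"
  unfolding dual_cell_def using finite_cells
  by (intro fmeasurable.finite_UN) (auto simp: half_cell_lmeasurable)

lemma dual_cell_subset: "dual_cell G \<sigma> \<subseteq> (\<Union>K\<in>cells G. cell_box G K)"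
  unfolding dual_cell_def half_cell_def by auto

lemma vol_dual_cell:
  assumes "\<sigma> \<in> int_faces G"
  shows "vol (dual_cell G \<sigma>) = (vol (cell_box G (lo_cell \<sigma>)) + vol (cell_box G (up_cell \<sigma>))) / 2"
proof -
  let ?A = "half_cell G (lo_cell \<sigma>) \<sigma>" and ?B = "half_cell G (up_cell \<sigma>) \<sigma>"
  have eq: "dual_cell G \<sigma> = ?A \<union> ?B"
    by (simp add: dual_cell_def int_faces_cells[OF assms])
  have "lo_cell \<sigma> \<noteq> up_cell \<sigma>" by (cases \<sigma>) simp
  then have "negligible (?A \<inter> ?B)"
    by (intro negligible_subset[OF negligible_cell_box_Int]) (auto simp: half_cell_def)
  then have "vol (?A \<union> ?B) = vol ?A + vol ?B"
    by (simp add: measure_Un3 half_cell_lmeasurable negligible_imp_measure0)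
  then show ?thesis
    by (simp add: eq vol_half_cell)
qed

lemma vol_dual_cell_pos: "\<sigma> \<in> int_faces G \<Longrightarrow> 0 < vol (dual_cell G \<sigma>)"
  by (simp add: vol_dual_cell add_pos_pos)

text \<open>The mean of the two primal masses is the form that matches \<open>sum_dual_flux\<close>,
  where the flux balances are averaged in the same way.\<close>

lemma dual_density_eq:
  assumes "\<sigma> \<in> int_faces G"
  shows "vol (dual_cell G \<sigma>) * dual_density G \<rho> \<sigma> =
    (vol (cell_box G (lo_cell \<sigma>)) * \<rho> (lo_cell \<sigma>) + vol (cell_box G (up_cell \<sigma>)) * \<rho> (up_cell \<sigma>)) / 2"
  using vol_dual_cell_pos[OF assms] by (simp add: dual_density_def vol_half_cell field_simps)

text \<open>Only an inclusion, since an exterior face owns just one part of the midpoint cell. It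
  suffices to transfer almost disjointness from grid cells to the dual cells of one
  direction.\<close>

lemma dual_cell_subset_mid_grid: "dual_cell G (i, K) \<subseteq> cell_box (mid_grid G {i}) K"
proof
  fix x assume "x \<in> dual_cell G (i, K)"
  then obtain L where L: "(i, K) \<in> cell_faces L" "x \<in> half_cell G L (i, K)"
    by (auto simp: dual_cell_def)
  have m: "mid G i (K i - 1) < nodes G i (K i)" "nodes G i (K i) < mid G i (K i)"
    using mid_between[of i "K i - 1"] mid_between[of i "K i"] by auto
  have K: "L = K \<or> L = shift K i (- 1)"
    using L by (auto simp: cell_faces_def)
  have n: "nodes G l (L l) \<le> x $ l" "x $ l \<le> nodes G l (L l + 1)" for l
    using L by (auto simp: half_cell_def cell_box_iff)
  have s: "0 \<le> nrm L (i, K) * (x $ i - mid G i (L i))"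
    using L by (auto simp: half_cell_def)
  have "nodes (mid_grid G {i}) l (K l) \<le> x $ l \<and>
      x $ l \<le> nodes (mid_grid G {i}) l (K l + 1)" for l
    using K n[of l] m s by (cases "l = i") (auto simp: nrm_def shift_apply nodes_mid_grid)
  then show "x \<in> cell_box (mid_grid G {i}) K"
    by (simp add: cell_box_iff)
qed

lemma negligible_dual_cell_Int:
  assumes "\<sigma> \<noteq> \<tau>" "fst \<sigma> = fst \<tau>"
  shows "negligible (dual_cell G \<sigma> \<inter> dual_cell G \<tau>)"
proof -
  obtain i K L where s: "\<sigma> = (i, K)" "\<tau> = (i, L)" using assms by (cases \<sigma>; cases \<tau>) auto
  interpret m: mac_mesh "mid_grid G {i}" by (rule mid_grid_mesh)
  show ?thesis
    unfolding s
    by (rule negligible_subset[OF m.negligible_cell_box_Int[of K L]])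
       (use s assms dual_cell_subset_mid_grid in auto)
qed

lemma region_lmeasurable [simp]: "region G \<in> lmeasurable"
  unfolding region_def
  by (rule lmeasurable_open)
     (use finite_cells in \<open>auto simp: cell_box_def intro!: bounded_interior bounded_UN\<close>)

text \<open>The region is the interior of the union of closed cells, so what is missing lies on cell
  frontiers. The scheme averages over closed sets while the data live on the open domain; this
  bridges the gap.\<close>

lemma negligible_cells_minus_region: "negligible ((\<Union>K\<in>cells G. cell_box G K) - region G)"
proof -
  have "(\<Union>K\<in>cells G. cell_box G K) - region G \<subseteq> (\<Union>K\<in>cells G. frontier (cell_box G K))"
  proof
    fix x assume x: "x \<in> (\<Union>K\<in>cells G. cell_box G K) - region G"
    then obtain K where K: "K \<in> cells G" "x \<in> cell_box G K" by auto
    have "interior (cell_box G K) \<subseteq> region G"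
      unfolding region_def using K by (intro interior_mono) auto
    then show "x \<in> (\<Union>K\<in>cells G. frontier (cell_box G K))"
      using x K by (auto simp: frontier_def intro!: closure_subset[THEN subsetD])
  qed
  moreover have "negligible (\<Union>K\<in>cells G. frontier (cell_box G K))"
    using finite_cells by (intro negligible_Union) (auto simp: cell_box_def negligible_convex_frontier)
  ultimately show ?thesis by (rule negligible_subset[rotated])
qed

lemma diamond_eq:
  "i \<noteq> j \<Longrightarrow> diamond G (i, j, K) = region G \<inter> cell_box (mid_grid G {i, j}) K"
  by (simp add: cell_box_def nodes_mid_grid cong: if_cong)

lemma diamond_lmeasurable [simp]: "diamond G \<epsilon> \<in> lmeasurable"
proof (cases \<epsilon>)
  case (fields i j K)
  then show ?thesis
    by (cases "i = j") (simp, simp add: diamond_eq fmeasurable.Int del: diamond.simps)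
qed

lemma negligible_diamond_Int:
  assumes "K \<noteq> L"
  shows "negligible (diamond G (i, j, K) \<inter> diamond G (i, j, L))"
proof (cases "i = j")
  case True
  then show ?thesis using negligible_cell_box_Int[OF assms] by simp
next
  case False
  interpret m: mac_mesh "mid_grid G {i, j}" by (rule mid_grid_mesh)
  show ?thesis
    using False by (intro negligible_subset[OF m.negligible_cell_box_Int[OF assms]])
      (auto simp: diamond_eq simp del: diamond.simps)
qed

end

section \<open>Diamond cells\<close>

lemma norm_axis_real: "norm (axis j c :: real ^ 'n::finite) = \<bar>c\<bar>"
  by (simp add: norm_eq_sqrt_inner inner_axis_axis power2_eq_square[symmetric])

definition corner_cells :: "'n \<Rightarrow> 'n \<Rightarrow> 'n cell \<Rightarrow> 'n cell set" where
  "corner_cells i j K =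
     {K, shift K i (- 1), shift K j (- 1), shift (shift K i (- 1)) j (- 1)}"

lemma corner_cells_commute: "corner_cells i j K = corner_cells j i K"
  by (auto simp: corner_cells_def shift_commute[of K i "-1" j])

lemma corner_cells_iff:
  assumes "i \<noteq> j"
  shows "L \<in> corner_cells i j K \<longleftrightarrow>
    (\<forall>l. if l = i \<or> l = j then L l = K l \<or> L l = K l - 1 else L l = K l)" (is "_ \<longleftrightarrow> ?R")
proof
  assume "L \<in> corner_cells i j K"
  then show ?R using assms by (auto simp: corner_cells_def shift_apply)
next
  assume R: ?R
  then have d: "L i = K i \<or> L i = K i - 1" "L j = K j \<or> L j = K j - 1"
    by metis+
  have "L = K(i := L i, j := L j)"
    using R by (intro ext) auto
  moreover have "K(i := a, j := b) \<in> corner_cells i j K"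
    if "a = K i \<or> a = K i - 1" "b = K j \<or> b = K j - 1" for a b
    using that assms by (auto simp: corner_cells_def shift_def fun_upd_twist)
  ultimately show "L \<in> corner_cells i j K"
    using d by metis
qed

context mac_mesh
begin

text \<open>For a corner cell \<open>L\<close>, the part of \<open>L\<close> next to the corner: the
  lower half in a direction among \<open>i\<close>, \<open>j\<close> where \<open>L\<close> agrees
  with \<open>K\<close>, the upper half where it does not.\<close>

definition quarter :: "'n \<Rightarrow> 'n \<Rightarrow> 'n cell \<Rightarrow> 'n cell \<Rightarrow> (real ^ 'n) set" where
  "quarter i j K L =
     cbox (\<chi> l. if (l = i \<or> l = j) \<and> L l \<noteq> K l then mid G l (L l) else nodes G l (L l))
          (\<chi> l. if (l = i \<or> l = j) \<and> L l = K l then mid G l (L l) else nodes G l (L l + 1))"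

lemma quarter_lmeasurable [simp]: "quarter i j K L \<in> lmeasurable"
  by (simp add: quarter_def)

lemma vol_quarter:
  assumes "i \<noteq> j"
  shows "vol (quarter i j K L) = vol (cell_box G L) / 4"
proof -
  let ?a = "\<lambda>l. if (l = i \<or> l = j) \<and> L l \<noteq> K l then mid G l (L l) else nodes G l (L l)"
  let ?b = "\<lambda>l. if (l = i \<or> l = j) \<and> L l = K l then mid G l (L l) else nodes G l (L l + 1)"
  have "vol (quarter i j K L) = (\<Prod>l\<in>UNIV. ?b l - ?a l)"
    unfolding quarter_def
    by (rule vol_cbox_vec) (use mid_between[THEN less_imp_le] nodes_le in auto)
  also have "\<dots> = (\<Prod>l\<in>UNIV. width G l (L l) *
      ((if l = i then 1 / 2 else 1) * (if l = j then 1 / 2 else 1)))"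
    using assms by (intro prod.cong refl) (auto simp: mid_def width_def field_simps)
  also have "\<dots> = vol (cell_box G L) / 4"
    by (simp add: prod.distrib vol_cell_box)
  finally show ?thesis .
qed

text \<open>If \<open>L\<close> is no corner cell, some direction \<open>l\<close> separates the two
  boxes: strictly if \<open>l\<close> is \<open>i\<close> or \<open>j\<close>, by a common node
  plane otherwise. The hyperplanes serve as a negligible exceptional set.\<close>

lemma cell_box_Int_mid_grid:
  assumes "i \<noteq> j"
  shows "cell_box G L \<inter> cell_box (mid_grid G {i, j}) K \<subseteq>
    (if L \<in> corner_cells i j K then quarter i j K L else {x. \<exists>l. x $ l = nodes G l (K l) \<or> x $ l = nodes G l (K l + 1)})"
proof
  fix x assume x: "x \<in> cell_box G L \<inter> cell_box (mid_grid G {i, j}) K"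
  have L: "nodes G l (L l) \<le> x $ l" "x $ l \<le> nodes G l (L l + 1)" for l
    using x by (auto simp: cell_box_iff)
  have K: "nodes (mid_grid G {i, j}) l (K l) \<le> x $ l" "x $ l \<le> nodes (mid_grid G {i, j}) l (K l + 1)" for l
    using x by (auto simp: cell_box_iff)
  show "x \<in> (if L \<in> corner_cells i j K then quarter i j K L
      else {x. \<exists>l. x $ l = nodes G l (K l) \<or> x $ l = nodes G l (K l + 1)})"
  proof (cases "L \<in> corner_cells i j K")
    case True
    then have c: "if l = i \<or> l = j then L l = K l \<or> L l = K l - 1 else L l = K l" for l
      using corner_cells_iff[OF assms] by blast
    have "(if (l = i \<or> l = j) \<and> L l \<noteq> K l then mid G l (L l) else nodes G l (L l)) \<le> x $ l \<and>
      x $ l \<le> (if (l = i \<or> l = j) \<and> L l = K l then mid G l (L l) else nodes G l (L l + 1))" for l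
      using c[of l] L[of l] K[of l] by (auto simp: nodes_mid_grid split: if_splits)
    with True show ?thesis
      by (simp add: quarter_def mem_box_cart)
  next
    case False
    then obtain l where l: "\<not> (if l = i \<or> l = j then L l = K l \<or> L l = K l - 1 else L l = K l)"
      using corner_cells_iff[OF assms] by blast
    have "x $ l = nodes G l (K l) \<or> x $ l = nodes G l (K l + 1)"
    proof (cases "l = i \<or> l = j")
      case True
      then have "mid G l (K l - 1) \<le> x $ l" "x $ l \<le> mid G l (K l)"
        using K[of l] by (auto simp: nodes_mid_grid)
      moreover have "L l + 1 \<le> K l - 1 \<or> K l + 1 \<le> L l"
        using l True by auto
      then have "nodes G l (L l + 1) \<le> nodes G l (K l - 1) \<or> nodes G l (K l + 1) \<le> nodes G l (L l)"
        using nodes_le by blast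
      ultimately show ?thesis
        using L[of l] mid_between[of l "K l - 1"] mid_between[of l "K l"] by auto
    next
      case False
      then have "nodes G l (K l) \<le> x $ l" "x $ l \<le> nodes G l (K l + 1)"
        using K[of l] by (auto simp: nodes_mid_grid)
      moreover have "L l + 1 \<le> K l \<or> K l + 1 \<le> L l"
        using l False by auto
      then have "nodes G l (L l + 1) \<le> nodes G l (K l) \<or> nodes G l (K l + 1) \<le> nodes G l (L l)"
        using nodes_le by blast
      ultimately show ?thesis
        using L[of l] by auto
    qed
    then show ?thesis using False by auto
  qed
qed

text \<open>The diamond is cut by the region, so up to a null set it is covered by the quarters of
  those corner cells that belong to the mesh. The right-hand side is the total weight in the sum
  that defines \<open>viscosity\<close>.\<close>

lemma vol_diamond_le:
  assumes "i \<noteq> j"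
  shows "vol (diamond G (i, j, K)) \<le> (1 / 4) * (\<Sum>L\<in>cells G \<inter> corner_cells i j K. vol (cell_box G L))"
proof -
  define N :: "(real ^ 'n) set"
    where "N = (\<Union>l. {x. x $ l = nodes G l (K l)} \<union> {x. x $ l = nodes G l (K l + 1)})"
  have N: "negligible N"
    unfolding N_def by (intro negligible_Union) (auto intro: negligible_coordinate_hyperplane)
  let ?C = "cells G \<inter> corner_cells i j K"
  have "diamond G (i, j, K) \<subseteq> (\<Union>L\<in>?C. quarter i j K L) \<union> N"
  proof
    fix x assume "x \<in> diamond G (i, j, K)"
    then have x: "x \<in> region G" "x \<in> cell_box (mid_grid G {i, j}) K"
      using diamond_eq[OF assms] by auto
    then obtain L where L: "L \<in> cells G" "x \<in> cell_box G L"
      using interior_subset unfolding region_def by fastforce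
    with x have "x \<in> (if L \<in> corner_cells i j K then quarter i j K L
        else {x. \<exists>l. x $ l = nodes G l (K l) \<or> x $ l = nodes G l (K l + 1)})"
      using cell_box_Int_mid_grid[OF assms] by blast
    with L show "x \<in> (\<Union>L\<in>?C. quarter i j K L) \<union> N"
      by (auto simp: N_def split: if_splits)
  qed
  moreover have fin: "finite ?C" using finite_cells by auto
  then have U: "(\<Union>L\<in>?C. quarter i j K L) \<in> lmeasurable"
    by (intro fmeasurable.finite_UN) auto
  ultimately have "vol (diamond G (i, j, K)) \<le> vol ((\<Union>L\<in>?C. quarter i j K L) \<union> N)"
    using N by (intro measure_mono_fmeasurable)
      (auto intro!: fmeasurableD fmeasurable.Un simp: negligible_iff_measure simp del: diamond.simps)
  also have "\<dots> = vol (\<Union>L\<in>?C. quarter i j K L)"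
    using N U by (simp add: measure_Un_null_set fmeasurableD negligible_iff_null_sets)
  also have "\<dots> \<le> (\<Sum>L\<in>?C. vol (quarter i j K L))"
    using fin by (intro measure_UNION_le) (auto intro: fmeasurableD)
  also have "\<dots> = (1 / 4) * (\<Sum>L\<in>?C. vol (cell_box G L))"
    by (simp add: vol_quarter[OF assms] sum_divide_distrib)
  finally show ?thesis .
qed

text \<open>The interior of one quarter already lies in the diamond. Positivity matters because
  \<open>viscosity\<close> divides by this volume.\<close>

lemma vol_diamond_pos:
  assumes "i \<noteq> j" "L \<in> cells G" "L \<in> corner_cells i j K"
  shows "0 < vol (diamond G (i, j, K))"
proof -
  have c: "if l = i \<or> l = j then L l = K l \<or> L l = K l - 1 else L l = K l" for l
    using corner_cells_iff[OF assms(1)] assms(3) by blast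
  have m: "nodes G l (L l) < mid G l (L l)" "mid G l (L l) < nodes G l (L l + 1)" for l
    by (rule mid_between)+
  have q: "quarter i j K L \<subseteq> cell_box G L"
  proof
    fix x assume "x \<in> quarter i j K L"
    then have x: "(if (l = i \<or> l = j) \<and> L l \<noteq> K l then mid G l (L l) else nodes G l (L l)) \<le> x $ l \<and>
      x $ l \<le> (if (l = i \<or> l = j) \<and> L l = K l then mid G l (L l) else nodes G l (L l + 1))" for l
      by (simp add: quarter_def mem_box_cart)
    have "nodes G l (L l) \<le> x $ l \<and> x $ l \<le> nodes G l (L l + 1)" for l
      using x[of l] m[of l] by (auto split: if_splits)
    then show "x \<in> cell_box G L" by (simp add: cell_box_iff)
  qed
  have "interior (quarter i j K L) \<subseteq> region G"
    unfolding region_def using q assms(2) by (intro interior_mono) auto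
  moreover have "quarter i j K L \<subseteq> cell_box (mid_grid G {i, j}) K"
  proof
    fix x assume "x \<in> quarter i j K L"
    then have x: "(if (l = i \<or> l = j) \<and> L l \<noteq> K l then mid G l (L l) else nodes G l (L l)) \<le> x $ l \<and>
      x $ l \<le> (if (l = i \<or> l = j) \<and> L l = K l then mid G l (L l) else nodes G l (L l + 1))" for l
      by (simp add: quarter_def mem_box_cart)
    have "nodes (mid_grid G {i, j}) l (K l) \<le> x $ l \<and> x $ l \<le> nodes (mid_grid G {i, j}) l (K l + 1)" for l
      using x[of l] c[of l] mid_between[of l "K l"] mid_between[of l "K l - 1"]
      by (auto simp: nodes_mid_grid split: if_splits)
    then show "x \<in> cell_box (mid_grid G {i, j}) K" by (simp add: cell_box_iff)
  qed
  ultimately have "interior (quarter i j K L) \<subseteq> diamond G (i, j, K)"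
    using interior_subset unfolding diamond_eq[OF assms(1)] by blast
  then have "vol (interior (quarter i j K L)) \<le> vol (diamond G (i, j, K))"
    by (intro measure_mono_fmeasurable)
       (auto simp: quarter_def interior_cbox simp del: diamond.simps)
  moreover have "vol (interior (quarter i j K L)) = vol (quarter i j K L)"
    unfolding quarter_def by (intro measure_interior) (auto intro: negligible_convex_frontier)
  ultimately show ?thesis
    using vol_quarter[OF assms(1), of K L] vol_cell_box_pos[of L] by linarith
qed

lemma vol_diamond_le_mid_grid:
  assumes "i \<noteq> j"
  shows "vol (diamond G (i, j, K)) \<le> vol (cell_box (mid_grid G {i, j}) K)"
  by (rule measure_mono_fmeasurable)
     (use diamond_lmeasurable[of "(i, j, K)"] in \<open>auto simp: diamond_eq[OF assms] fmeasurableD simp del: diamond.simps\<close>)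

text \<open>The factor shared by cells, midpoint boxes and dual faces around a corner (1 in two
  dimensions). Its invariance under shifts along \<open>i\<close> and \<open>j\<close> is what
  allows the cross terms to be translated.\<close>

definition transverse :: "'n \<Rightarrow> 'n \<Rightarrow> 'n cell \<Rightarrow> real" where
  "transverse i j K = (\<Prod>l\<in>UNIV - {i} - {j}. width G l (K l))"

lemma transverse_commute: "transverse i j K = transverse j i K"
  by (auto simp: transverse_def intro!: prod.cong)

lemma transverse_shift [simp]: "transverse i j (shift K i s) = transverse i j K"
  "transverse i j (shift K j s) = transverse i j K"
  by (auto simp: transverse_def shift_apply intro!: prod.cong)

lemma prod_split2:
  assumes "i \<noteq> j"
  shows "(\<Prod>l\<in>UNIV. g l) = g i * g j * (\<Prod>l\<in>UNIV - {i} - {j :: 'n}. (g l :: real))"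
proof -
  have "prod g UNIV = g i * prod g (UNIV - {i})"
    by (rule prod.remove) auto
  also have "prod g (UNIV - {i}) = g j * prod g (UNIV - {i} - {j})"
    using assms by (intro prod.remove) auto
  finally show ?thesis by simp
qed

lemma vol_cell_box_split:
  assumes "i \<noteq> j"
  shows "vol (cell_box G K) = width G i (K i) * width G j (K j) * transverse i j K"
  unfolding vol_cell_box transverse_def by (rule prod_split2[OF assms])

lemma vol_mid_grid_split:
  assumes "i \<noteq> j"
  shows "vol (cell_box (mid_grid G {i, j}) K) =
    (mid G i (K i) - mid G i (K i - 1)) * (mid G j (K j) - mid G j (K j - 1)) * transverse i j K"
proof -
  interpret m: mac_mesh "mid_grid G {i, j}" by (rule mid_grid_mesh)
  show ?thesis
    unfolding m.vol_cell_box prod_split2[OF assms] transverse_def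
    by (simp add: width_def nodes_mid_grid)
qed

lemma dual_area_offdiag:
  assumes "i \<noteq> j"
  shows "dual_area G (i, j, K) = (mid G i (K i) - mid G i (K i - 1)) * transverse i j K"
proof -
  have "dual_area G (i, j, K) = (\<Prod>l\<in>UNIV - {j}. if l = i then mid G i (K i) - mid G i (K i - 1) else width G l (K l))"
    by simp
  also have "\<dots> = (mid G i (K i) - mid G i (K i - 1)) * (\<Prod>l\<in>UNIV - {j} - {i}. width G l (K l))"
    using assms by (subst prod.remove[of _ i]) (auto intro!: prod.cong)
  also have "(\<Prod>l\<in>UNIV - {j} - {i}. width G l (K l)) = transverse j i K"
    by (simp add: transverse_def)
  finally show ?thesis by (simp add: transverse_commute)
qed

text \<open>This includes the reentrant corner, where one of the two faces is exterior but its
  centre still counts.\<close>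

lemma dual_dist_full:
  assumes "i \<noteq> j" "(i, shift K j (- 1)) \<in> faces G" "(i, K) \<in> faces G"
  shows "dual_dist G (i, j, K) = mid G j (K j) - mid G j (K j - 1)"
proof -
  have "face_centre G (i, K) - face_centre G (i, shift K j (- 1)) =
      axis j (mid G j (K j) - mid G j (K j - 1))"
    using assms(1) by (auto simp: vec_eq_iff face_centre_def axis_def shift_apply)
  then have "dist (face_centre G (i, shift K j (- 1))) (face_centre G (i, K)) =
      \<bar>mid G j (K j) - mid G j (K j - 1)\<bar>"
    by (metis dist_commute dist_norm norm_axis_real)
  then show ?thesis
    using assms mid_mono[of "K j - 1" "K j" j] by simp
qed

lemma dual_dist_upper:
  assumes "i \<noteq> j" "(i, shift K j (- 1)) \<notin> faces G"
  shows "dual_dist G (i, j, K) = width G j (K j) / 2"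
  using assms mid_between(1)[of j "K j"]
  by (simp add: Let_def face_centre_def) (simp add: mid_def width_def field_simps)

lemma dual_dist_lower:
  assumes "i \<noteq> j" "(i, shift K j (- 1)) \<in> faces G" "(i, K) \<notin> faces G"
  shows "dual_dist G (i, j, K) = width G j (K j - 1) / 2"
  using assms mid_between(2)[of j "K j - 1"]
  by (simp add: Let_def face_centre_def shift_apply) (simp add: mid_def width_def field_simps)

lemma dual_dist_diag:
  assumes "K \<in> cells G"
  shows "dual_dist G (i, i, K) = width G i (K i)"
proof -
  have f: "(i, K) \<in> faces G" "(i, shift K i 1) \<in> faces G"
    using assms by (auto simp: faces_def)
  have "face_centre G (i, shift K i 1) - face_centre G (i, K) = axis i (width G i (K i))"
    by (auto simp: vec_eq_iff face_centre_def axis_def shift_apply width_def)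
  then have "dist (face_centre G (i, K)) (face_centre G (i, shift K i 1)) = \<bar>width G i (K i)\<bar>"
    by (metis dist_commute dist_norm norm_axis_real)
  then show ?thesis
    using f by simp
qed

end

section \<open>Viscous dissipation and a discrete Korn inequality\<close>

lemma H_zeroD: "u \<in> H_zero G \<Longrightarrow> \<sigma> \<notin> int_faces G \<Longrightarrow> u \<sigma> = 0"
  unfolding H_zero_def by blast

context mac_mesh
begin

text \<open>The dual faces on which a discrete velocity can have a nonzero difference.\<close>

definition active :: "'n dface \<Rightarrow> bool" where
  "active \<epsilon> \<longleftrightarrow> lo_face \<epsilon> \<in> int_faces G \<or> up_face \<epsilon> \<in> int_faces G"

text \<open>The volume of \<open>D\<^sub>\<epsilon>\<close>, except at a reentrant corner, where it also counts the quarter outside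
  of the domain, and on flat boundaries for the inactive one of \<open>\<epsilon>\<close> and its transpose.\<close>

definition weight :: "'n dface \<Rightarrow> real" where
  "weight \<epsilon> = dual_area G \<epsilon> * dual_dist G \<epsilon>"

lemma width_nonzero [simp]: "width G i m \<noteq> 0"
  using width_pos[of i m] by linarith

section \<open>Active dual faces and their weights\<close>

lemma active_diag: "active (i, i, K) \<Longrightarrow> K \<in> cells G"
  by (auto simp: active_def int_faces_def)

lemma active_offdiag:
  "i \<noteq> j \<Longrightarrow> active (i, j, K) \<longleftrightarrow>
     shift (shift K i (- 1)) j (- 1) \<in> cells G \<and> shift K j (- 1) \<in> cells G \<or>
     shift K i (- 1) \<in> cells G \<and> K \<in> cells G"
  by (auto simp: active_def int_faces_def shift_commute[of K j "-1" i])

lemma in_faces_iff: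
  "(i, K) \<in> faces G \<longleftrightarrow> shift K i (- 1) \<in> cells G \<or> K \<in> cells G"
  "(i, shift K j (- 1)) \<in> faces G \<longleftrightarrow>
     shift (shift K i (- 1)) j (- 1) \<in> cells G \<or> shift K j (- 1) \<in> cells G"
  by (simp_all add: faces_def shift_commute[of K j "-1" i])

lemma ddiff_inactive:
  assumes "u \<in> H_zero G" "\<not> active \<epsilon>"
  shows "ddiff G u \<epsilon> = 0" "u (lo_face \<epsilon>) = 0" "u (up_face \<epsilon>) = 0"
  using assms by (auto simp: active_def ddiff_def H_zeroD)

lemma weight_diag:
  assumes "K \<in> cells G"
  shows "weight (i, i, K) = vol (cell_box G K)"
proof -
  have "dual_area G (i, i, K) = (\<Prod>l\<in>UNIV - {i}. width G l (K l))"
    by (auto intro!: prod.cong)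
  then show ?thesis
    unfolding weight_def dual_dist_diag[OF assms] vol_cell_box
    by (simp add: prod.remove[of UNIV i] mult.commute)
qed

lemma mid_diff_pos [simp]: "0 < mid G i k - mid G i (k - 1)"
  using mid_mono[of "k - 1" k i] by simp

lemma weight_full:
  assumes "i \<noteq> j" "(i, shift K j (- 1)) \<in> faces G" "(i, K) \<in> faces G"
  shows "weight (i, j, K) = vol (cell_box (mid_grid G {i, j}) K)"
  unfolding weight_def dual_dist_full[OF assms] dual_area_offdiag[OF assms(1)]
    vol_mid_grid_split[OF assms(1)] by simp

text \<open>For \<open>i \<noteq> j\<close>, if both are active then at least three of the four
  corner cells are in the mesh, so all four faces exist and both weights are the volume of the same
  midpoint box.\<close>

lemma weight_transp:
  assumes "active (i, j, K)" "active (j, i, K)"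
  shows "weight (i, j, K) = weight (j, i, K)"
proof (cases "i = j")
  case False
  then have "(i, shift K j (- 1)) \<in> faces G" "(i, K) \<in> faces G"
    "(j, shift K i (- 1)) \<in> faces G" "(j, K) \<in> faces G"
    using assms unfolding in_faces_iff active_offdiag[OF False] active_offdiag[OF False[symmetric]]
    by (auto simp: shift_commute[of K j "-1" i])
  with False show ?thesis
    by (simp add: weight_full insert_commute)
qed simp

lemma dual_dist_pos:
  assumes "active \<epsilon>"
  shows "0 < dual_dist G \<epsilon>"
proof -
  obtain i j K where e: "\<epsilon> = (i, j, K)" by (cases \<epsilon>)
  show ?thesis
  proof (cases "i = j")
    case True
    then show ?thesis using assms active_diag[of i K] by (simp add: e dual_dist_diag del: dual_dist.simps)
  next
    case False
    then show ?thesis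
      using dual_dist_full[OF False, of K] dual_dist_upper[OF False, of K] dual_dist_lower[OF False, of K]
        mid_diff_pos[of j "K j"] width_pos[of j "K j"] width_pos[of j "K j - 1"]
      unfolding e by (metis half_gt_zero)
  qed
qed

text \<open>With both faces present the diamond lies in the midpoint box. Otherwise at most two
  quarters remain, and they add up to the area times half a cell width. This is the direction
  needed: the energy argument controls \<open>weight\<close>, whereas \<open>H_norm\<close>
  integrates over diamonds.\<close>

lemma vol_diamond_le_weight:
  assumes "active \<epsilon>"
  shows "vol (diamond G \<epsilon>) \<le> weight \<epsilon>"
proof -
  obtain i j K where e: "\<epsilon> = (i, j, K)" by (cases \<epsilon>)
  show ?thesis
  proof (cases "i = j")
    case True
    then show ?thesis using assms active_diag[of i K] by (simp add: e weight_diag)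
  next
    case False
    let ?I = "shift K i (- 1)" and ?J = "shift K j (- 1)" and ?IJ = "shift (shift K i (- 1)) j (- 1)"
    let ?t = "transverse i j K" and ?w = "width G"
    have vol: "vol (cell_box G K) = ?w i (K i) * ?w j (K j) * ?t"
      "vol (cell_box G ?I) = ?w i (K i - 1) * ?w j (K j) * ?t"
      "vol (cell_box G ?J) = ?w i (K i) * ?w j (K j - 1) * ?t"
      "vol (cell_box G ?IJ) = ?w i (K i - 1) * ?w j (K j - 1) * ?t"
      using False by (simp_all add: vol_cell_box_split[OF False] shift_apply)
    have *: "vol (diamond G (i, j, K)) \<le> (1 / 4) * (vol (cell_box G A) + vol (cell_box G B))"
      if "cells G \<inter> corner_cells i j K \<subseteq> {A, B}" "A \<noteq> B" for A B
    proof -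
      have "(\<Sum>L\<in>cells G \<inter> corner_cells i j K. vol (cell_box G L)) \<le> (\<Sum>L\<in>{A, B}. vol (cell_box G L))"
        using that by (intro sum_mono2) auto
      with vol_diamond_le[OF False, of K] that show ?thesis by simp
    qed
    consider (full) "(i, ?J) \<in> faces G" "(i, K) \<in> faces G"
      | (lower) "(i, ?J) \<in> faces G" "(i, K) \<notin> faces G"
      | (upper) "(i, ?J) \<notin> faces G"
      by blast
    then show ?thesis
    proof cases
      case full
      show ?thesis
        unfolding e weight_full[OF False full] by (rule vol_diamond_le_mid_grid[OF False])
    next
      case lower
      then have "cells G \<inter> corner_cells i j K \<subseteq> {?IJ, ?J}"
        by (auto simp: corner_cells_def in_faces_iff shift_commute[of K j "-1" i])
      from *[OF this] show ?thesis
        unfolding e weight_def dual_dist_lower[OF False lower] dual_area_offdiag[OF False] mid_diff vol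
        by (simp add: field_simps)
    next
      case upper
      then have "cells G \<inter> corner_cells i j K \<subseteq> {?I, K}"
        by (auto simp: corner_cells_def in_faces_iff shift_commute[of K j "-1" i])
      from *[OF this] show ?thesis
        unfolding e weight_def dual_dist_upper[OF False upper] dual_area_offdiag[OF False] mid_diff vol
        by (simp add: field_simps)
    qed
  qed
qed

lemma weight_nonneg: "active \<epsilon> \<Longrightarrow> 0 \<le> weight \<epsilon>"
  using vol_diamond_le_weight[of \<epsilon>] measure_nonneg[of lebesgue "diamond G \<epsilon>"] by linarith

section \<open>Lower bounds for the viscosity and the viscous form\<close>

lemma viscosity_offdiag:
  "i \<noteq> j \<Longrightarrow> viscosity G \<mu> \<rho> (i, j, K) =
     (1 / 4) * (\<Sum>L\<in>cells G \<inter> corner_cells i j K. vol (cell_box G L) * \<mu> (\<rho> L)) /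
       vol (diamond G (i, j, K))"
  by (simp add: corner_cells_def del: diamond.simps)

lemma viscosity_transp: "viscosity G \<mu> \<rho> (i, j, K) = viscosity G \<mu> \<rho> (j, i, K)"
  by (cases "i = j")
     (simp_all add: viscosity_offdiag diamond_eq corner_cells_commute[of i j] insert_commute
       del: viscosity.simps diamond.simps)

text \<open>Off the diagonal, a weighted sum of values of \<open>\<mu>\<close> is divided by the
  volume of the diamond, which by \<open>vol_diamond_le\<close> is at most the sum of the weights.
  So the quotient is no smaller than a true weighted mean.\<close>

lemma viscosity_ge:
  assumes "active \<epsilon>" "0 \<le> m" "\<And>L. L \<in> cells G \<Longrightarrow> m \<le> \<mu> (\<rho> L)"
  shows "m \<le> viscosity G \<mu> \<rho> \<epsilon>"
proof -
  obtain i j K where e: "\<epsilon> = (i, j, K)" by (cases \<epsilon>)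
  show ?thesis
  proof (cases "i = j")
    case True
    then show ?thesis using assms active_diag[of i K] by (simp add: e)
  next
    case False
    obtain L where L: "L \<in> cells G" "L \<in> corner_cells i j K"
      using assms(1) unfolding e active_offdiag[OF False] corner_cells_def by blast
    have pos: "0 < vol (diamond G (i, j, K))"
      using vol_diamond_pos[OF False L] .
    have "m * vol (diamond G (i, j, K)) \<le> m * ((1 / 4) * (\<Sum>L\<in>cells G \<inter> corner_cells i j K. vol (cell_box G L)))"
      using assms(2) by (intro mult_left_mono vol_diamond_le[OF False])
    also have "\<dots> = (1 / 4) * (\<Sum>L\<in>cells G \<inter> corner_cells i j K. vol (cell_box G L) * m)"
      by (simp add: sum_distrib_left sum_distrib_right mult_ac)
    also have "\<dots> \<le> (1 / 4) * (\<Sum>L\<in>cells G \<inter> corner_cells i j K. vol (cell_box G L) * \<mu> (\<rho> L))"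
      using assms(3) by (intro mult_left_mono sum_mono) auto
    finally show ?thesis
      unfolding e viscosity_offdiag[OF False] using pos by (simp add: pos_le_divide_eq del: diamond.simps)
  qed
qed

text \<open>A single term has no sign, so the viscosity is compared with \<open>m\<close> in pairs.
  If both dual faces are active, their common weight and viscosity make the pair a multiple of
  \<open>(x + y)\<^sup>2\<close>; if one is inactive its difference is zero and a multiple of one
  square is left.\<close>

lemma viscous_pair:
  assumes u: "u \<in> H_zero G" and m: "0 \<le> m" "\<And>L. L \<in> cells G \<Longrightarrow> m \<le> \<mu> (\<rho> L)"
  defines "d \<equiv> ddiff G u" and "v \<equiv> viscosity G \<mu> \<rho>"
  shows "m / 2 * (weight (i, j, K) * (d (i, j, K) + d (j, i, K)) * d (i, j, K) +
      weight (j, i, K) * (d (j, i, K) + d (i, j, K)) * d (j, i, K)) \<le>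
    weight (i, j, K) * (v (i, j, K) / 2) * (d (i, j, K) + d (j, i, K)) * d (i, j, K) +
    weight (j, i, K) * (v (j, i, K) / 2) * (d (j, i, K) + d (i, j, K)) * d (j, i, K)"
proof -
  define W W' x y where "W = weight (i, j, K)" and "W' = weight (j, i, K)"
    and "x = d (i, j, K)" and "y = d (j, i, K)"
  have vT: "v (j, i, K) = v (i, j, K)"
    unfolding v_def by (rule viscosity_transp)
  have inactive: "\<not> active (i, j, K) \<Longrightarrow> x = 0" "\<not> active (j, i, K) \<Longrightarrow> y = 0"
    using ddiff_inactive(1)[OF u] by (auto simp: x_def y_def d_def)
  have ge: "m \<le> v (i, j, K)" if "active (i, j, K) \<or> active (j, i, K)"
    using that viscosity_ge[where \<epsilon> = "(i, j, K)" and m = m and \<mu> = \<mu> and \<rho> = \<rho>]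
      viscosity_ge[where \<epsilon> = "(j, i, K)" and m = m and \<mu> = \<mu> and \<rho> = \<rho>] vT m
    by (auto simp: v_def simp del: viscosity.simps)
  have "0 \<le> (v (i, j, K) - m) / 2 * (W * (x + y) * x + W' * (y + x) * y)"
  proof (cases "active (i, j, K)")
    case a: True
    show ?thesis
    proof (cases "active (j, i, K)")
      case True
      have "W' = W" unfolding W_def W'_def using weight_transp[OF a True] by simp
      then have "W * (x + y) * x + W' * (y + x) * y = W * (x + y)\<^sup>2"
        by (simp add: power2_eq_square algebra_simps)
      then show ?thesis
        using ge a weight_nonneg[OF a] by (simp add: W_def)
    next
      case False
      then show ?thesis
        using ge a weight_nonneg[OF a] inactive by (simp add: W_def power2_eq_square[symmetric] mult.assoc)
    qed
  next
    case a: False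
    show ?thesis
    proof (cases "active (j, i, K)")
      case True
      then show ?thesis
        using ge a weight_nonneg[OF True] inactive by (simp add: W'_def power2_eq_square[symmetric] mult.assoc)
    qed (use a inactive in simp)
  qed
  then show ?thesis
    unfolding vT W_def[symmetric] W'_def[symmetric] x_def[symmetric] y_def[symmetric]
    by (simp add: field_simps)
qed

text \<open>The two distances cancel the two midpoint widths in the volume and leave a product of
  plain jumps. If one of the dual faces is inactive, its end values are zero and so are both
  sides.\<close>

lemma cross_term_offdiag:
  assumes u: "u \<in> H_zero G" and ij: "i \<noteq> j"
  shows "weight (i, j, K) * ddiff G u (i, j, K) * ddiff G u (j, i, K) =
    transverse i j K * (u (i, K) - u (i, shift K j (- 1))) * (u (j, K) - u (j, shift K i (- 1)))"
proof (cases "active (i, j, K) \<and> active (j, i, K)")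
  case True
  then have f: "(i, shift K j (- 1)) \<in> faces G" "(i, K) \<in> faces G"
    "(j, shift K i (- 1)) \<in> faces G" "(j, K) \<in> faces G"
    using True unfolding in_faces_iff active_offdiag[OF ij] active_offdiag[OF ij[symmetric]]
    by (auto simp: shift_commute[of K j "-1" i])
  have "x * y * t * (a / y) * (b / x) = t * a * b" if "0 < x" "0 < y" for x y t a b :: real
    using that by (simp add: field_simps)
  from this[OF mid_diff_pos[of i "K i"] mid_diff_pos[of j "K j"]] show ?thesis
    using ij
    unfolding weight_full[OF ij f(1,2)] vol_mid_grid_split[OF ij] ddiff_def
      dual_dist_full[OF ij f(1,2)] dual_dist_full[OF ij[symmetric] f(3,4)]
    by simp
next
  case False
  then show ?thesis
    using ij ddiff_inactive[OF u, of "(i, j, K)"] ddiff_inactive[OF u, of "(j, i, K)"] by auto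
qed

lemma cross_term_diag:
  assumes u: "u \<in> H_zero G"
  shows "weight (i, i, K) * ddiff G u (i, i, K) * ddiff G u (i, i, K) =
    vol (cell_box G K) * ((u (i, shift K i 1) - u (i, K)) / width G i (K i))\<^sup>2"
proof (cases "active (i, i, K)")
  case True
  then show ?thesis
    using active_diag[OF True]
    by (simp add: weight_diag ddiff_def dual_dist_diag power2_eq_square del: dual_dist.simps)
next
  case False
  then show ?thesis
    using ddiff_inactive[OF u, of "(i, i, K)"] by auto
qed

lemma H_zero_nonzero:
  assumes "u \<in> H_zero G" "u (i, K) \<noteq> 0"
  shows "K \<in> cells G"
  using H_zeroD[OF assms(1), of "(i, K)"] assms(2) by (auto simp: int_faces_def)

text \<open>A mixed product is integrated by parts twice. Expansion gives four products; translating
  the second along \<open>i\<close>, the third along \<open>j\<close> and the fourth along both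
  turns them into the expansion of the product of diagonal jumps. No boundary terms arise because
  the velocity vanishes off the interior faces.\<close>

lemma cross_term_sum:
  assumes u: "u \<in> H_zero G" and ij: "i \<noteq> j"
  shows "(\<Sum>K\<in>near. weight (i, j, K) * ddiff G u (i, j, K) * ddiff G u (j, i, K)) =
    (\<Sum>K\<in>near. transverse i j K * (u (i, shift K i 1) - u (i, K)) * (u (j, shift K j 1) - u (j, K)))"
proof -
  define t where "t = transverse i j"
  have t: "t (shift K i s) = t K" "t (shift K j s) = t K" for K s
    by (simp_all add: t_def)
  have nz: "u (k, L) \<noteq> 0 \<Longrightarrow> L \<in> cells G" for k L
    using H_zero_nonzero[OF u] .
  define h1 h2 h3 h4 h5 where "h1 K = t K * u (i, K) * u (j, K)"
    and "h2 K = t K * u (i, K) * u (j, shift K i (- 1))"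
    and "h3 K = t K * u (i, shift K j (- 1)) * u (j, K)"
    and "h4 K = t K * u (i, shift K j (- 1)) * u (j, shift K i (- 1))"
    and "h5 K = t K * u (i, shift (shift K i 1) j (- 1)) * u (j, K)" for K
  have s2: "(\<Sum>K\<in>near. h2 (shift K i 1)) = (\<Sum>K\<in>near. h2 K)"
    by (rule sum_near_shift) (auto simp: h2_def dest!: nz intro: near_shift)
  have s3: "(\<Sum>K\<in>near. h3 (shift K j 1)) = (\<Sum>K\<in>near. h3 K)"
    by (rule sum_near_shift) (auto simp: h3_def dest!: nz intro: near_shift)
  have s4: "(\<Sum>K\<in>near. h4 (shift K i 1)) = (\<Sum>K\<in>near. h4 K)"
  proof (rule sum_near_shift)
    fix K assume "h4 K \<noteq> 0"
    then have "shift K j (- 1) \<in> cells G" by (auto simp: h4_def dest: nz)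
    from near_shift(2)[OF this, of 1 j] near_shift(3)[OF this, of 1 "-1" j i]
    show "K \<in> near \<and> shift K i (- 1) \<in> near" by simp
  qed
  have s5: "(\<Sum>K\<in>near. h5 (shift K j 1)) = (\<Sum>K\<in>near. h5 K)"
    by (rule sum_near_shift) (auto simp: h5_def dest!: nz intro: near_shift)
  \<comment> \<open>The fourth product needs both translations; \<open>h5\<close> is the
    intermediate stage, after the one along \<open>i\<close>.\<close>
  have e45: "h4 (shift K i 1) = h5 K" for K
    by (simp add: h4_def h5_def t)
  have "(\<Sum>K\<in>near. weight (i, j, K) * ddiff G u (i, j, K) * ddiff G u (j, i, K)) =
      (\<Sum>K\<in>near. h1 K - h2 K - h3 K + h4 K)"
    unfolding cross_term_offdiag[OF u ij]
    by (intro sum.cong refl) (simp add: h1_def h2_def h3_def h4_def t_def algebra_simps)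
  also have "\<dots> = (\<Sum>K\<in>near. h1 K) - (\<Sum>K\<in>near. h2 (shift K i 1)) - (\<Sum>K\<in>near. h3 (shift K j 1)) +
      (\<Sum>K\<in>near. h5 (shift K j 1))"
    by (simp add: sum.distrib sum_subtractf s2 s3 s5 s4[symmetric] e45)
  also have "\<dots> = (\<Sum>K\<in>near. h1 K - h2 (shift K i 1) - h3 (shift K j 1) + h5 (shift K j 1))"
    by (simp add: sum.distrib sum_subtractf)
  also have "\<dots> = (\<Sum>K\<in>near. transverse i j K * (u (i, shift K i 1) - u (i, K)) * (u (j, shift K j 1) - u (j, K)))"
  proof (intro sum.cong refl)
    fix K
    have "shift (shift (shift K j 1) i 1) j (- 1) = shift K i 1"
      by (simp add: shift_commute[of "shift K j 1" i])
    then show "h1 K - h2 (shift K i 1) - h3 (shift K j 1) + h5 (shift K j 1) =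
      transverse i j K * (u (i, shift K i 1) - u (i, K)) * (u (j, shift K j 1) - u (j, K))"
      by (simp add: h1_def h2_def h3_def h5_def t) (simp add: t_def algebra_simps)
  qed
  finally show ?thesis .
qed

section \<open>The discrete divergence\<close>

lemma face_area_eq:
  "face_area G (i, K) = vol (cell_box G K) / width G i (K i)"
  "face_area G (i, shift K i 1) = vol (cell_box G K) / width G i (K i)"
proof -
  have "(\<Prod>l\<in>UNIV - {i}. width G l (K l)) = vol (cell_box G K) / width G i (K i)"
    by (simp add: vol_cell_box prod.remove[of UNIV i] )
  moreover have "(\<Prod>l\<in>UNIV - {i}. width G l (shift K i 1 l)) = (\<Prod>l\<in>UNIV - {i}. width G l (K l))"
    by (intro prod.cong refl) (auto simp: shift_apply)
  ultimately show "face_area G (i, K) = vol (cell_box G K) / width G i (K i)"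
    "face_area G (i, shift K i 1) = vol (cell_box G K) / width G i (K i)"
    by (simp_all add: face_area_def)
qed

lemma discrete_div:
  "(\<Sum>\<sigma>\<in>cell_faces K. face_area G \<sigma> * out_vel u K \<sigma>) =
     vol (cell_box G K) * (\<Sum>i\<in>UNIV. (u (i, shift K i 1) - u (i, K)) / width G i (K i))"
  unfolding sum_cell_faces sum_distrib_left face_area_eq(2) face_area_eq(1)[of _ K]
  by (intro sum.cong refl) (simp add: out_vel_def nrm_def algebra_simps diff_divide_distrib)

text \<open>The cross terms sum up to the squared norm of the discrete divergence, by two discrete
  integrations by parts in each pair of directions. Korn's inequality follows.\<close>

lemma cross_term_total:
  assumes u: "u \<in> H_zero G"
    and div: "\<And>K. K \<in> cells G \<Longrightarrow> (\<Sum>\<sigma>\<in>cell_faces K. face_area G \<sigma> * out_vel u K \<sigma>) = 0"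
  shows "(\<Sum>i\<in>UNIV. \<Sum>j\<in>UNIV. \<Sum>K\<in>near.
    weight (i, j, K) * ddiff G u (i, j, K) * ddiff G u (j, i, K)) = 0"
proof -
  define a where "a i K = (u (i, shift K i 1) - u (i, K)) / width G i (K i)" for i K
  have "(\<Sum>K\<in>near. weight (i, j, K) * ddiff G u (i, j, K) * ddiff G u (j, i, K)) =
      (\<Sum>K\<in>near. vol (cell_box G K) * a i K * a j K)" for i j
  proof (cases "i = j")
    case True
    then show ?thesis
      by (intro sum.cong refl) (simp add: cross_term_diag[OF u] a_def power2_eq_square)
  next
    case False
    show ?thesis
      unfolding cross_term_sum[OF u False]
      using width_pos by (intro sum.cong refl) (simp add: vol_cell_box_split[OF False] a_def)
  qed
  then have "(\<Sum>i\<in>UNIV. \<Sum>j\<in>UNIV. \<Sum>K\<in>near.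
      weight (i, j, K) * ddiff G u (i, j, K) * ddiff G u (j, i, K)) =
      (\<Sum>i\<in>UNIV. \<Sum>j\<in>UNIV. \<Sum>K\<in>near. vol (cell_box G K) * a i K * a j K)"
    by simp
  also have "\<dots> = (\<Sum>i\<in>UNIV. \<Sum>K\<in>near. \<Sum>j\<in>UNIV. vol (cell_box G K) * a i K * a j K)"
    by (intro sum.cong refl sum.swap)
  also have "\<dots> = (\<Sum>K\<in>near. \<Sum>i\<in>UNIV. \<Sum>j\<in>UNIV. vol (cell_box G K) * a i K * a j K)"
    by (rule sum.swap)
  also have "\<dots> = (\<Sum>K\<in>near. vol (cell_box G K) * (\<Sum>i\<in>UNIV. a i K) * (\<Sum>j\<in>UNIV. a j K))"
    unfolding mult.assoc sum_product[of "\<lambda>i. a i _" UNIV "\<lambda>j. a j _" UNIV]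
    by (simp add: sum_distrib_left mult.assoc)
  also have "\<dots> = 0"
  proof (intro sum.neutral ballI)
    fix K
    have "(\<Sum>i\<in>UNIV. a i K) = 0"
    proof (cases "K \<in> cells G")
      case True
      then show ?thesis
        using div[of K] vol_cell_box_pos[of K] unfolding discrete_div by (simp add: a_def)
    next
      case False
      \<comment> \<open>Indices of \<open>near\<close> off the mesh contribute nothing: no face of
        such a cell is interior.\<close>
      then have "u (i, K) = 0" "u (i, shift K i 1) = 0" for i
        using H_zeroD[OF u] by (auto simp: int_faces_def)
      then show ?thesis by (simp add: a_def)
    qed
    then show "vol (cell_box G K) * (\<Sum>i\<in>UNIV. a i K) * (\<Sum>j\<in>UNIV. a j K) = 0" by simp
  qed
  finally show ?thesis .
qed

section \<open>The viscous term tested with the velocity\<close>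

lemma dual_cell_faces_near:
  assumes "\<sigma> \<in> int_faces G" "lo_face (i, j, K) = \<sigma> \<or> up_face (i, j, K) = \<sigma>"
  shows "K \<in> near"
  using assms near_shift(1)[of K] near_shift(2)[of "shift K j (- 1)" 1 j]
  by (auto simp: int_faces_def split: if_splits)

text \<open>The instance of \<open>sum_incidence\<close> shared by the viscous and the convective
  terms.\<close>

lemma sum_dual_faces_swap:
  assumes "\<And>\<sigma> \<epsilon>. \<sigma> \<notin> int_faces G \<Longrightarrow> g \<sigma> \<epsilon> = (0 :: real)"
  shows "(\<Sum>\<sigma>\<in>int_faces G. \<Sum>\<epsilon>\<in>dual_cell_faces \<sigma>. g \<sigma> \<epsilon>) =
    (\<Sum>i\<in>UNIV. \<Sum>j\<in>UNIV. \<Sum>K\<in>near. g (lo_face (i, j, K)) (i, j, K) + g (up_face (i, j, K)) (i, j, K))"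
proof -
  have "(\<Sum>\<sigma>\<in>int_faces G. \<Sum>\<epsilon>\<in>dual_cell_faces \<sigma>. g \<sigma> \<epsilon>) =
      (\<Sum>\<epsilon>\<in>UNIV \<times> UNIV \<times> near. g (lo_face \<epsilon>) \<epsilon> + g (up_face \<epsilon>) \<epsilon>)"
    unfolding dual_cell_faces_def
  proof (rule sum_incidence)
    show "\<epsilon> \<in> UNIV \<times> UNIV \<times> near"
      if "\<sigma> \<in> int_faces G" "lo_face \<epsilon> = \<sigma> \<or> up_face \<epsilon> = \<sigma>" for \<sigma> and \<epsilon> :: "'n dface"
      using that dual_cell_faces_near by (cases \<epsilon>) blast
  qed (use assms in \<open>auto simp: finite_int_faces finite_near\<close>)
  then show ?thesis
    by (simp only: sum.cartesian_product' split_paired_all)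
qed

text \<open>The ends of a dual face carry opposite normals, so each dual face collects minus the
  jump of \<open>u\<close>. That jump is \<open>ddiff\<close> times \<open>dual_dist\<close>, and
  area times distance is \<open>weight\<close>.\<close>

lemma diffusion_energy_eq:
  assumes u: "u \<in> H_zero G"
  shows "(\<Sum>\<sigma>\<in>int_faces G. vol (dual_cell G \<sigma>) * diffusion G \<mu> \<rho> u \<sigma> * u \<sigma>) =
    - (\<Sum>i\<in>UNIV. \<Sum>j\<in>UNIV. \<Sum>K\<in>near. weight (i, j, K) * (viscosity G \<mu> \<rho> (i, j, K) / 2) *
        (ddiff G u (i, j, K) + ddiff G u (j, i, K)) * ddiff G u (i, j, K))"
proof -
  define g where "g \<sigma> \<epsilon> = dual_area G \<epsilon> * (viscosity G \<mu> \<rho> \<epsilon> / 2) *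
    (ddiff G u \<epsilon> + ddiff G u (transp \<epsilon>)) * dual_nrm \<sigma> \<epsilon> * u \<sigma>" for \<sigma> \<epsilon>
  have "(\<Sum>\<sigma>\<in>int_faces G. vol (dual_cell G \<sigma>) * diffusion G \<mu> \<rho> u \<sigma> * u \<sigma>) =
      (\<Sum>\<sigma>\<in>int_faces G. \<Sum>\<epsilon>\<in>dual_cell_faces \<sigma>. g \<sigma> \<epsilon>)"
  proof (intro sum.cong refl)
    fix \<sigma> assume "\<sigma> \<in> int_faces G"
    then have "0 < vol (dual_cell G \<sigma>)" by (rule vol_dual_cell_pos)
    then show "vol (dual_cell G \<sigma>) * diffusion G \<mu> \<rho> u \<sigma> * u \<sigma> = (\<Sum>\<epsilon>\<in>dual_cell_faces \<sigma>. g \<sigma> \<epsilon>)"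
      unfolding diffusion_def g_def sum_distrib_left sum_distrib_right
      by (intro sum.cong refl) simp
  qed
  also have "\<dots> = (\<Sum>i\<in>UNIV. \<Sum>j\<in>UNIV. \<Sum>K\<in>near.
      g (lo_face (i, j, K)) (i, j, K) + g (up_face (i, j, K)) (i, j, K))"
    by (rule sum_dual_faces_swap) (simp add: g_def H_zeroD[OF u])
  also have "\<dots> = (\<Sum>i\<in>UNIV. \<Sum>j\<in>UNIV. \<Sum>K\<in>near. - (weight (i, j, K) * (viscosity G \<mu> \<rho> (i, j, K) / 2) *
        (ddiff G u (i, j, K) + ddiff G u (j, i, K)) * ddiff G u (i, j, K)))"
  proof (intro sum.cong refl)
    fix i j :: 'n and K :: "'n cell"
    let ?e = "(i, j, K)"
    \<comment> \<open>The division in \<open>ddiff\<close> can be undone everywhere: distances are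
      positive on active dual faces, and on inactive ones both sides are zero.\<close>
    have "u (up_face ?e) - u (lo_face ?e) = ddiff G u ?e * dual_dist G ?e"
      using ddiff_inactive[OF u, of ?e] dual_dist_pos[of ?e]
      by (cases "active ?e") (auto simp: ddiff_def simp del: dual_dist.simps lo_face.simps up_face.simps)
    then have d: "u (up_face ?e) = u (lo_face ?e) + ddiff G u ?e * dual_dist G ?e" by linarith
    show "g (lo_face ?e) ?e + g (up_face ?e) ?e = - (weight ?e * (viscosity G \<mu> \<rho> ?e / 2) *
        (ddiff G u ?e + ddiff G u (j, i, K)) * ddiff G u ?e)"
      unfolding g_def d dual_nrm_simps weight_def transp.simps
      by (simp add: field_simps del: dual_dist.simps lo_face.simps up_face.simps viscosity.simps dual_area.simps)
  qed
  finally show ?thesis by (simp add: sum_negf)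
qed

text \<open>Adding the vanishing sum of cross terms turns the squared gradient into the strain form
  with constant viscosity \<open>m\<close>. Symmetrising in \<open>i\<close> and \<open>j\<close>
  then brings it into the pairs to which \<open>viscous_pair\<close> applies, and so to the actual
  viscosity.\<close>

lemma diffusion_energy_le:
  assumes u: "u \<in> H_zero G"
    and div: "\<And>K. K \<in> cells G \<Longrightarrow> (\<Sum>\<sigma>\<in>cell_faces K. face_area G \<sigma> * out_vel u K \<sigma>) = 0"
    and m: "0 \<le> m" "\<And>L. L \<in> cells G \<Longrightarrow> m \<le> \<mu> (\<rho> L)"
  shows "(\<Sum>\<sigma>\<in>int_faces G. vol (dual_cell G \<sigma>) * diffusion G \<mu> \<rho> u \<sigma> * u \<sigma>) \<le>
    - (m / 2) * (\<Sum>i\<in>UNIV. \<Sum>j\<in>UNIV. \<Sum>K\<in>near. vol (diamond G (i, j, K)) * (ddiff G u (i, j, K))\<^sup>2)"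
proof -
  define d v W where "d i j K = ddiff G u (i, j, K)" and "v i j K = viscosity G \<mu> \<rho> (i, j, K)"
    and "W i j K = weight (i, j, K)" for i j K
  let ?S = "\<lambda>g. \<Sum>i\<in>UNIV. \<Sum>j\<in>UNIV. \<Sum>K\<in>near. (g (i :: 'n) (j :: 'n) K :: real)"
  have sym: "?S g = (1 / 2) * ?S (\<lambda>i j K. g i j K + g j i K)" for g
  proof -
    have "?S g = ?S (\<lambda>i j K. g j i K)" by (rule sum.swap)
    then have "?S g = (1 / 2) * (?S g + ?S (\<lambda>i j K. g j i K))" by simp
    also have "\<dots> = (1 / 2) * ?S (\<lambda>i j K. g i j K + g j i K)" by (simp add: sum.distrib)
    finally show ?thesis .
  qed
  have "m / 2 * ?S (\<lambda>i j K. vol (diamond G (i, j, K)) * (d i j K)\<^sup>2) \<le> m / 2 * ?S (\<lambda>i j K. W i j K * (d i j K)\<^sup>2)"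
  proof (intro mult_left_mono sum_mono)
    fix i j K
    show "vol (diamond G (i, j, K)) * (d i j K)\<^sup>2 \<le> W i j K * (d i j K)\<^sup>2"
      using vol_diamond_le_weight[of "(i, j, K)"] ddiff_inactive(1)[OF u, of "(i, j, K)"]
      by (cases "active (i, j, K)") (auto simp: W_def d_def mult_right_mono simp del: diamond.simps)
  qed (use m in auto)
  also have "\<dots> = m / 2 * (?S (\<lambda>i j K. W i j K * (d i j K)\<^sup>2) + ?S (\<lambda>i j K. W i j K * d i j K * d j i K))"
    using cross_term_total[OF u div] by (simp add: W_def d_def)
  also have "\<dots> = m / 2 * ?S (\<lambda>i j K. W i j K * (d i j K + d j i K) * d i j K)"
    by (simp only: sum.distrib[symmetric]) (simp add: power2_eq_square algebra_simps)
  also have "\<dots> = (1 / 2) * ?S (\<lambda>i j K. m / 2 * (W i j K * (d i j K + d j i K) * d i j K + W j i K * (d j i K + d i j K) * d j i K))"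
    by (subst sym) (simp add: sum_distrib_left)
  also have "\<dots> \<le> (1 / 2) * ?S (\<lambda>i j K. W i j K * (v i j K / 2) * (d i j K + d j i K) * d i j K + W j i K * (v j i K / 2) * (d j i K + d i j K) * d j i K)"
    unfolding W_def d_def v_def 
    by (intro mult_left_mono sum_mono viscous_pair[OF u, where m = m and \<mu> = \<mu> and \<rho> = \<rho>])
      (use m in auto)
  also have "\<dots> = ?S (\<lambda>i j K. W i j K * (v i j K / 2) * (d i j K + d j i K) * d i j K)"
    by (rule sym[symmetric])
  finally show ?thesis
    unfolding diffusion_energy_eq[OF u] W_def d_def v_def by simp
qed

end

section \<open>The discrete energy inequality\<close>

text \<open>Upwinding looks only at the sign of the velocity, so the mass balance is linear in the
  densities once the velocity is fixed. This turns the maximum principle \<open>density_le\<close>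
  into the minimum principle \<open>density_ge\<close>.\<close>

lemma mass_flux_uminus: "mass_flux G (\<lambda>K. - \<rho> K) u K \<sigma> = - mass_flux G \<rho> u K \<sigma>"
  by (simp add: mass_flux_def)

lemma sum_weighted_cauchy_schwarz:
  fixes w a b :: "'a \<Rightarrow> real"
  assumes "\<And>x. x \<in> S \<Longrightarrow> 0 \<le> w x"
  shows "(\<Sum>x\<in>S. w x * a x * b x) \<le> sqrt (\<Sum>x\<in>S. w x * (a x)\<^sup>2) * sqrt (\<Sum>x\<in>S. w x * (b x)\<^sup>2)"
proof -
  have "(\<Sum>x\<in>S. w x * a x * b x) = (\<Sum>x\<in>S. (sqrt (w x) * a x) * (sqrt (w x) * b x))"
  proof (intro sum.cong refl)
    fix x assume "x \<in> S"
    then have "sqrt (w x) * sqrt (w x) = w x" using assms by simp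
    then show "w x * a x * b x = (sqrt (w x) * a x) * (sqrt (w x) * b x)"
      by (metis mult.assoc mult.left_commute)
  qed
  also have "\<dots> \<le> (\<Sum>x\<in>S. \<bar>sqrt (w x) * a x\<bar> * \<bar>sqrt (w x) * b x\<bar>)"
    by (intro sum_mono) (metis abs_ge_self abs_mult)
  also have "\<dots> \<le> L2_set (\<lambda>x. sqrt (w x) * a x) S * L2_set (\<lambda>x. sqrt (w x) * b x) S"
    by (rule L2_set_mult_ineq)
  also have "\<dots> = sqrt (\<Sum>x\<in>S. w x * (a x)\<^sup>2) * sqrt (\<Sum>x\<in>S. w x * (b x)\<^sup>2)"
    using assms by (simp add: L2_set_def power_mult_distrib cong: sum.cong)
  finally show ?thesis .
qed

lemma discrete_energy_bound:
  fixes e s h \<phi> :: "nat \<Rightarrow> real"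
  assumes step: "\<And>n. n < N \<Longrightarrow> e (Suc n) - e n + \<delta> * (m / 2) * h (Suc n) \<le> \<delta> * (\<phi> (Suc n) * sqrt (s (Suc n)))"
    and coercive: "\<And>n. n < N \<Longrightarrow> a / 2 * s (Suc n) \<le> e (Suc n)"
    and e0: "e 0 \<le> A" and sources: "(\<Sum>n<N. \<delta> * (\<phi> (Suc n))\<^sup>2) \<le> B"
    and pos: "0 < a" "0 < m" "0 < \<delta>" "0 < N" "real N * \<delta> = T"
    and nonneg: "\<And>n. 0 \<le> s n" "\<And>n. 0 \<le> h n" "\<And>n. 0 \<le> \<phi> n"
  defines "R \<equiv> (T + B) / 2"
  defines "M \<equiv> 1 + 4 * A / a + 4 * R\<^sup>2 / a\<^sup>2"
  shows "n < N \<Longrightarrow> sqrt (s (Suc n)) \<le> M"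
    and "(\<Sum>n<N. \<delta> * h (Suc n)) \<le> 2 / m * (A + R * M)"
proof -
  define q where "q = Max ((\<lambda>n. sqrt (s (Suc n))) ` {..<N})"
  have q_ge: "sqrt (s (Suc n)) \<le> q" if "n < N" for n
    unfolding q_def using that by (intro Max_ge) auto
  have "q \<in> (\<lambda>n. sqrt (s (Suc n))) ` {..<N}"
    unfolding q_def using pos by (intro Max_in) auto
  then obtain k where k: "k < N" "q = sqrt (s (Suc k))" by auto
  have q0: "0 \<le> q" using k nonneg by simp
  \<comment> \<open>Young's inequality \<open>\<phi> \<le> 1 / 2 + \<phi>\<^sup>2 / 2\<close>,
    summed with weight \<open>\<delta>\<close>, is the origin of \<open>R\<close>.\<close>
  have total: "(\<Sum>n<N. \<delta> * \<phi> (Suc n)) \<le> R"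
  proof -
    have "(\<Sum>n<N. \<delta> * \<phi> (Suc n)) \<le> (\<Sum>n<N. \<delta> / 2 + \<delta> * (\<phi> (Suc n))\<^sup>2 / 2)"
    proof (intro sum_mono)
      fix n
      have "0 \<le> \<delta> / 2 * (\<phi> (Suc n) - 1)\<^sup>2" using pos by simp
      then show "\<delta> * \<phi> (Suc n) \<le> \<delta> / 2 + \<delta> * (\<phi> (Suc n))\<^sup>2 / 2"
        by (simp add: power2_eq_square algebra_simps)
    qed
    also have "\<dots> = T / 2 + (\<Sum>n<N. \<delta> * (\<phi> (Suc n))\<^sup>2) / 2"
      using pos by (simp add: sum.distrib sum_divide_distrib)
    finally show ?thesis using sources by (simp add: R_def)
  qed
  have acc: "e l + (\<Sum>n<l. \<delta> * (m / 2) * h (Suc n)) \<le> e 0 + (\<Sum>n<l. \<delta> * \<phi> (Suc n)) * q" if "l \<le> N" for l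
    using that
  proof (induction l)
    case (Suc l)
    have "\<delta> * (\<phi> (Suc l) * sqrt (s (Suc l))) \<le> \<delta> * (\<phi> (Suc l) * q)"
      using pos nonneg Suc.prems by (intro mult_left_mono q_ge) auto
    moreover have "\<delta> * (\<phi> (Suc l) * q) = \<delta> * \<phi> (Suc l) * q" by simp
    ultimately show ?case
      using Suc step[of l] by (simp add: distrib_right)
  qed simp
  have sums: "(\<Sum>n<l. \<delta> * \<phi> (Suc n)) * q \<le> R * q" if "l \<le> N" for l
  proof -
    have "(\<Sum>n<l. \<delta> * \<phi> (Suc n)) \<le> (\<Sum>n<N. \<delta> * \<phi> (Suc n))"
      using that pos nonneg by (intro sum_mono2) auto
    with total q0 show ?thesis by (intro mult_right_mono) auto
  qed
  have "0 \<le> (\<Sum>n<Suc k. \<delta> * (m / 2) * h (Suc n))"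
    using pos nonneg by (intro sum_nonneg) auto
  \<comment> \<open>The summation stops at the step that attains the maximum, so that coercivity
    gives an inequality for \<open>q\<close> alone.\<close>
  then have e: "e (Suc k) \<le> A + R * q"
    using acc[of "Suc k"] sums[of "Suc k"] k e0 by linarith
  have "a / 2 * q\<^sup>2 \<le> A + R * q"
    using coercive[OF k(1)] e k nonneg by simp
  \<comment> \<open>Young's inequality, weighted so as to absorb half of
    \<open>a / 2 * q\<^sup>2\<close>; the quotients in \<open>M\<close> come from here.\<close>
  moreover have "R * q \<le> a / 4 * q\<^sup>2 + R\<^sup>2 / a"
  proof -
    have "0 \<le> (a * q / 2 - R)\<^sup>2 / a" using pos by simp
    also have "\<dots> = a / 4 * q\<^sup>2 + R\<^sup>2 / a - R * q"
      using pos by (simp add: power2_eq_square field_simps)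
    finally show ?thesis by simp
  qed
  ultimately have "a / 4 * q\<^sup>2 \<le> A + R\<^sup>2 / a" by linarith
  then have "4 / a * (a / 4 * q\<^sup>2) \<le> 4 / a * (A + R\<^sup>2 / a)"
    using pos by (intro mult_left_mono) auto
  then have "q\<^sup>2 \<le> 4 * A / a + 4 * R\<^sup>2 / a\<^sup>2"
    using pos by (simp add: field_simps power2_eq_square)
  \<comment> \<open>This avoids a square root in \<open>M\<close> and explains its summand
    1.\<close>
  moreover have "q \<le> 1 + q\<^sup>2"
  proof -
    have "0 \<le> (q - 1 / 2)\<^sup>2" by simp
    then show ?thesis by (simp add: power2_eq_square algebra_simps)
  qed
  ultimately have qM: "q \<le> M" by (simp add: M_def)
  then show "n < N \<Longrightarrow> sqrt (s (Suc n)) \<le> M" using q_ge by force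
  have R0: "0 \<le> R"
    using total pos nonneg by (meson mult_nonneg_nonneg less_imp_le order_trans sum_nonneg)
  have "0 \<le> e N"
  proof -
    obtain N' where "N = Suc N'" using pos by (cases N) auto
    then show ?thesis using coercive[of N'] pos nonneg(1)[of N]
      by (smt (verit) half_gt_zero lessI mult_nonneg_nonneg)
  qed
  then have "(\<Sum>n<N. \<delta> * (m / 2) * h (Suc n)) \<le> A + R * q"
    using acc[of N] sums[of N] e0 by linarith
  also have "\<dots> \<le> A + R * M" using qM R0 by (simp add: mult_left_mono)
  finally have "(m / 2) * (\<Sum>n<N. \<delta> * h (Suc n)) \<le> A + R * M"
    by (simp add: sum_distrib_left mult_ac)
  then have "2 / m * ((m / 2) * (\<Sum>n<N. \<delta> * h (Suc n))) \<le> 2 / m * (A + R * M)"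
    using pos by (intro mult_left_mono) auto
  then show "(\<Sum>n<N. \<delta> * h (Suc n)) \<le> 2 / m * (A + R * M)" using pos by simp
qed

context mac_mesh
begin

text \<open>At a cell \<open>L\<close> where the new density is maximal, each upwind flux is at
  least \<open>\<rho>' L\<close> times the volume flux: outflow carries \<open>\<rho>' L\<close>,
  inflow a density that is no larger. The volume fluxes sum to zero, so the net mass outflow is
  nonnegative and \<open>\<rho>' L \<le> \<rho> L\<close>. No restriction on the time step
  arises.\<close>

lemma density_le:
  assumes u: "u \<in> H_zero G"
    and mass: "\<And>K. K \<in> cells G \<Longrightarrow>
      (\<rho>' K - \<rho> K) / \<delta> + (\<Sum>\<sigma>\<in>cell_faces K. mass_flux G \<rho>' u K \<sigma>) / vol (cell_box G K) = 0"
    and div: "\<And>K. K \<in> cells G \<Longrightarrow> (\<Sum>\<sigma>\<in>cell_faces K. face_area G \<sigma> * out_vel u K \<sigma>) = 0"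
    and bound: "\<And>K. K \<in> cells G \<Longrightarrow> \<rho> K \<le> b" and "0 < \<delta>" and K: "K \<in> cells G"
  shows "\<rho>' K \<le> b"
proof -
  have "Max (\<rho>' ` cells G) \<in> \<rho>' ` cells G"
    using K finite_cells by (intro Max_in) auto
  then obtain L where L: "L \<in> cells G" "\<rho>' L = Max (\<rho>' ` cells G)" by auto
  have max: "\<rho>' K \<le> \<rho>' L" if "K \<in> cells G" for K
    unfolding L using finite_cells that by (intro Max_ge) auto
  have "0 = \<rho>' L * (\<Sum>\<sigma>\<in>cell_faces L. face_area G \<sigma> * out_vel u L \<sigma>)"
    using div[OF L(1)] by simp
  also have "\<dots> \<le> (\<Sum>\<sigma>\<in>cell_faces L. mass_flux G \<rho>' u L \<sigma>)"
    unfolding sum_distrib_left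
  proof (intro sum_mono)
    fix \<sigma> assume \<sigma>: "\<sigma> \<in> cell_faces L"
    have area: "0 \<le> face_area G \<sigma>"
      unfolding face_area_def by (intro prod_nonneg) auto
    show "\<rho>' L * (face_area G \<sigma> * out_vel u L \<sigma>) \<le> mass_flux G \<rho>' u L \<sigma>"
    proof (cases "\<sigma> \<in> int_faces G")
      case True
      have "across L \<sigma> \<in> cells G"
        using True by (auto simp: across_def int_faces_def)
      then have "\<rho>' (across L \<sigma>) \<le> \<rho>' L" by (rule max)
      then have "\<rho>' L * out_vel u L \<sigma> \<le> (if 0 \<le> out_vel u L \<sigma> then \<rho>' L else \<rho>' (across L \<sigma>)) * out_vel u L \<sigma>"
        by (auto intro: mult_right_mono_neg)
      then have "face_area G \<sigma> * (\<rho>' L * out_vel u L \<sigma>) \<le>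
          face_area G \<sigma> * ((if 0 \<le> out_vel u L \<sigma> then \<rho>' L else \<rho>' (across L \<sigma>)) * out_vel u L \<sigma>)"
        using area by (rule mult_left_mono)
      then show ?thesis
        unfolding mass_flux_def using True by (simp only: if_True) (simp only: mult_ac)
    next
      case False
      then show ?thesis by (simp add: mass_flux_def out_vel_def H_zeroD[OF u])
    qed
  qed
  finally have "0 \<le> (\<Sum>\<sigma>\<in>cell_faces L. mass_flux G \<rho>' u L \<sigma>) / vol (cell_box G L)" by simp
  then have "(\<rho>' L - \<rho> L) / \<delta> \<le> 0" using mass[OF L(1)] by linarith
  then have "\<rho>' L \<le> \<rho> L" using \<open>0 < \<delta>\<close> by (simp add: divide_le_0_iff)
  then show ?thesis using max[OF K] bound[OF L(1)] by linarith
qed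

lemma density_ge:
  assumes u: "u \<in> H_zero G"
    and mass: "\<And>K. K \<in> cells G \<Longrightarrow>
      (\<rho>' K - \<rho> K) / \<delta> + (\<Sum>\<sigma>\<in>cell_faces K. mass_flux G \<rho>' u K \<sigma>) / vol (cell_box G K) = 0"
    and div: "\<And>K. K \<in> cells G \<Longrightarrow> (\<Sum>\<sigma>\<in>cell_faces K. face_area G \<sigma> * out_vel u K \<sigma>) = 0"
    and bound: "\<And>K. K \<in> cells G \<Longrightarrow> a \<le> \<rho> K" and "0 < \<delta>" and K: "K \<in> cells G"
  shows "a \<le> \<rho>' K"
proof -
  have "- \<rho>' K \<le> - a"
  proof (rule density_le[where \<rho> = "\<lambda>K. - \<rho> K" and \<rho>' = "\<lambda>K. - \<rho>' K" and \<delta> = \<delta>, OF u _ div])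
    fix K assume "K \<in> cells G"
    from mass[OF this] show "(- \<rho>' K - - \<rho> K) / \<delta> +
        (\<Sum>\<sigma>\<in>cell_faces K. mass_flux G (\<lambda>K. - \<rho>' K) u K \<sigma>) / vol (cell_box G K) = 0"
      by (simp add: mass_flux_uminus sum_negf diff_divide_distrib)
  qed (use assms in auto)
  then show ?thesis by simp
qed

text \<open>Gradient and divergence are dual: the volume balances weighted by \<open>p K\<close> sum
  to zero, and regrouping by faces leaves the pressure jump times the face velocity.\<close>

lemma pressure_work:
  assumes u: "u \<in> H_zero G"
    and div: "\<And>K. K \<in> cells G \<Longrightarrow> (\<Sum>\<sigma>\<in>cell_faces K. face_area G \<sigma> * out_vel u K \<sigma>) = 0"
  shows "(\<Sum>\<sigma>\<in>int_faces G. vol (dual_cell G \<sigma>) * pressure_grad G p \<sigma> * u \<sigma>) = 0"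
proof -
  \<comment> \<open>The cut-off is needed because \<open>sum_incidence\<close> requires cells
    outside the summation set to contribute zero.\<close>
  define g where "g K \<sigma> = (if K \<in> cells G then p K * (face_area G \<sigma> * out_vel u K \<sigma>) else 0)" for K \<sigma>
  let ?E = "\<Union>K\<in>cells G. cell_faces K"
  have "0 = (\<Sum>K\<in>cells G. \<Sum>\<sigma>\<in>cell_faces K. g K \<sigma>)"
    using div by (simp add: g_def sum_distrib_left[symmetric])
  also have "\<dots> = (\<Sum>\<sigma>\<in>?E. g (lo_cell \<sigma>) \<sigma> + g (up_cell \<sigma>) \<sigma>)"
    unfolding cell_faces_def
  proof (rule sum_incidence)
    show "lo_cell \<sigma> \<noteq> up_cell \<sigma>" for \<sigma> :: "'n face" by (cases \<sigma>) simp
    show "finite (\<Union>K\<in>cells G. {\<sigma>. lo_cell \<sigma> = K \<or> up_cell \<sigma> = K})"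
      using finite_cells finite_cell_faces unfolding cell_faces_def by auto
  qed (auto simp: g_def finite_cells)
  also have "\<dots> = (\<Sum>\<sigma>\<in>int_faces G. g (lo_cell \<sigma>) \<sigma> + g (up_cell \<sigma>) \<sigma>)"
  proof (rule sum.mono_neutral_right)
    show "finite ?E" using finite_cells by auto
    show "int_faces G \<subseteq> ?E" by (auto simp: int_faces_def cell_faces_def)
    show "\<forall>\<sigma>\<in>?E - int_faces G. g (lo_cell \<sigma>) \<sigma> + g (up_cell \<sigma>) \<sigma> = 0"
      using H_zeroD[OF u] by (auto simp: g_def out_vel_def)
  qed
  also have "\<dots> = (\<Sum>\<sigma>\<in>int_faces G. - (vol (dual_cell G \<sigma>) * pressure_grad G p \<sigma> * u \<sigma>))"
  proof (intro sum.cong refl)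
    fix \<sigma> assume \<sigma>: "\<sigma> \<in> int_faces G"
    then have "lo_cell \<sigma> \<in> cells G" "up_cell \<sigma> \<in> cells G" by (auto simp: int_faces_def)
    moreover have "vol (dual_cell G \<sigma>) \<noteq> 0" using vol_dual_cell_pos[OF \<sigma>] by simp
    ultimately show "g (lo_cell \<sigma>) \<sigma> + g (up_cell \<sigma>) \<sigma> = - (vol (dual_cell G \<sigma>) * pressure_grad G p \<sigma> * u \<sigma>)"
      by (simp add: g_def pressure_grad_def out_vel_def field_simps)
  qed
  finally show ?thesis by (simp add: sum_negf)
qed

text \<open>Regrouped by dual faces, twice this sum consists of the terms of
  \<open>upwind_energy_nonneg\<close>. The subtracted half of the flux balance is what
  \<open>dual_mass_balance\<close> ties to the change of density in time.\<close>

lemma convection_work: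
  assumes u: "u \<in> H_zero G"
  shows "0 \<le> (\<Sum>\<sigma>\<in>int_faces G. (\<Sum>\<epsilon>\<in>dual_cell_faces \<sigma>. dual_flux G \<rho> u \<sigma> \<epsilon> * upwind_vel G \<rho> u \<sigma> \<epsilon>) * u \<sigma> -
      (\<Sum>\<epsilon>\<in>dual_cell_faces \<sigma>. dual_flux G \<rho> u \<sigma> \<epsilon>) * (u \<sigma>)\<^sup>2 / 2)"
proof -
  define g where "g \<sigma> \<epsilon> = dual_flux G \<rho> u \<sigma> \<epsilon> * (2 * upwind_vel G \<rho> u \<sigma> \<epsilon> * u \<sigma> - (u \<sigma>)\<^sup>2)" for \<sigma> \<epsilon>
  have "0 \<le> (\<Sum>i\<in>UNIV. \<Sum>j\<in>UNIV. \<Sum>K\<in>near.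
      g (lo_face (i, j, K)) (i, j, K) + g (up_face (i, j, K)) (i, j, K))"
  proof (intro sum_nonneg)
    fix i j K
    show "0 \<le> g (lo_face (i, j, K)) (i, j, K) + g (up_face (i, j, K)) (i, j, K)"
      using upwind_energy_nonneg[OF dual_flux_antisym[of G \<rho> u "(i, j, K)"],
          of "u (lo_face (i, j, K))" "u (up_face (i, j, K))"]
      unfolding g_def upwind_vel_def dual_across_simps .
  qed
  also have "\<dots> = (\<Sum>\<sigma>\<in>int_faces G. \<Sum>\<epsilon>\<in>dual_cell_faces \<sigma>. g \<sigma> \<epsilon>)"
    by (rule sum_dual_faces_swap[symmetric]) (simp add: g_def H_zeroD[OF u])
  also have "\<dots> = (\<Sum>\<sigma>\<in>int_faces G. 2 * ((\<Sum>\<epsilon>\<in>dual_cell_faces \<sigma>. dual_flux G \<rho> u \<sigma> \<epsilon> * upwind_vel G \<rho> u \<sigma> \<epsilon>) * u \<sigma> -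
      (\<Sum>\<epsilon>\<in>dual_cell_faces \<sigma>. dual_flux G \<rho> u \<sigma> \<epsilon>) * (u \<sigma>)\<^sup>2 / 2))"
    by (intro sum.cong refl)
      (simp add: g_def sum_distrib_right sum_distrib_left sum_subtractf algebra_simps)
  finally have "0 \<le> 2 * (\<Sum>\<sigma>\<in>int_faces G. (\<Sum>\<epsilon>\<in>dual_cell_faces \<sigma>. dual_flux G \<rho> u \<sigma> \<epsilon> * upwind_vel G \<rho> u \<sigma> \<epsilon>) * u \<sigma> -
      (\<Sum>\<epsilon>\<in>dual_cell_faces \<sigma>. dual_flux G \<rho> u \<sigma> \<epsilon>) * (u \<sigma>)\<^sup>2 / 2)"
    by (simp only: sum_distrib_left)
  then show ?thesis by (simp only: zero_le_mult_iff) simp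
qed

text \<open>The half-sum of the mass balances of the two cells sharing \<open>\<sigma>\<close>:
  \<open>sum_dual_flux\<close> matches the fluxes and \<open>dual_density_eq\<close> the
  masses.\<close>

lemma dual_mass_balance:
  assumes \<sigma>: "\<sigma> \<in> int_faces G" and "\<delta> \<noteq> 0"
    and mass: "\<And>K. K \<in> cells G \<Longrightarrow>
      (\<rho>' K - \<rho> K) / \<delta> + (\<Sum>\<sigma>\<in>cell_faces K. mass_flux G \<rho>' u K \<sigma>) / vol (cell_box G K) = 0"
  shows "\<delta> * (\<Sum>\<epsilon>\<in>dual_cell_faces \<sigma>. dual_flux G \<rho>' u \<sigma> \<epsilon>) =
    - vol (dual_cell G \<sigma>) * (dual_density G \<rho>' \<sigma> - dual_density G \<rho> \<sigma>)"
proof -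
  have cell: "\<delta> * (\<Sum>\<sigma>\<in>cell_faces K. mass_flux G \<rho>' u K \<sigma>) = - vol (cell_box G K) * (\<rho>' K - \<rho> K)"
    if "K \<in> cells G" for K
  proof -
    have "vol (cell_box G K) \<noteq> 0" using vol_cell_box_pos[of K] by linarith
    then show ?thesis
      using mass[OF that] \<open>\<delta> \<noteq> 0\<close> by (simp add: field_simps)
  qed
  have "lo_cell \<sigma> \<in> cells G" "up_cell \<sigma> \<in> cells G" using \<sigma> by (auto simp: int_faces_def)
  note c = this[THEN cell]
  have "\<delta> * (\<Sum>\<epsilon>\<in>dual_cell_faces \<sigma>. dual_flux G \<rho>' u \<sigma> \<epsilon>) =
      (\<delta> * (\<Sum>\<tau>\<in>cell_faces (lo_cell \<sigma>). mass_flux G \<rho>' u (lo_cell \<sigma>) \<tau>) +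
       \<delta> * (\<Sum>\<tau>\<in>cell_faces (up_cell \<sigma>). mass_flux G \<rho>' u (up_cell \<sigma>) \<tau>)) / 2"
    unfolding sum_dual_flux by (simp add: field_simps)
  also have "\<dots> = - (vol (dual_cell G \<sigma>) * dual_density G \<rho>' \<sigma> - vol (dual_cell G \<sigma>) * dual_density G \<rho> \<sigma>)"
    unfolding c dual_density_eq[OF \<sigma>] by (simp add: field_simps)
  finally show ?thesis by (simp add: algebra_simps)
qed

section \<open>Discrete energies and the estimate for one time step\<close>

definition kinetic_energy :: "('n cell \<Rightarrow> real) \<Rightarrow> ('n face \<Rightarrow> real) \<Rightarrow> real" where
  "kinetic_energy \<rho> u = (\<Sum>\<sigma>\<in>int_faces G. vol (dual_cell G \<sigma>) * dual_density G \<rho> \<sigma> * (u \<sigma>)\<^sup>2 / 2)"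

text \<open>A majorant of the squared \<open>H_norm\<close>, free of the viscosity and with the same
  index set \<open>near\<close> for all pairs of directions.\<close>

definition dissipation :: "('n face \<Rightarrow> real) \<Rightarrow> real" where
  "dissipation u = (\<Sum>i\<in>UNIV. \<Sum>j\<in>UNIV. \<Sum>K\<in>near. vol (diamond G (i, j, K)) * (ddiff G u (i, j, K))\<^sup>2)"

text \<open>Restricted to interior faces so that it also measures averages of data, which need not
  vanish on exterior faces.\<close>

definition face_L2 :: "('n face \<Rightarrow> real) \<Rightarrow> real" where
  "face_L2 u = (\<Sum>\<sigma>\<in>int_faces G. vol (dual_cell G \<sigma>) * (u \<sigma>)\<^sup>2)"

lemma dissipation_nonneg: "0 \<le> dissipation u"
  unfolding dissipation_def by (intro sum_nonneg mult_nonneg_nonneg) auto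

lemma face_L2_nonneg: "0 \<le> face_L2 u"
  unfolding face_L2_def by (intro sum_nonneg mult_nonneg_nonneg) auto

lemma dual_density_bounds:
  assumes "\<sigma> \<in> int_faces G"
  shows "(\<And>K. K \<in> cells G \<Longrightarrow> a \<le> \<rho> K) \<Longrightarrow> a * vol (dual_cell G \<sigma>) \<le> vol (dual_cell G \<sigma>) * dual_density G \<rho> \<sigma>"
    and "(\<And>K. K \<in> cells G \<Longrightarrow> \<rho> K \<le> a) \<Longrightarrow> vol (dual_cell G \<sigma>) * dual_density G \<rho> \<sigma> \<le> a * vol (dual_cell G \<sigma>)"
proof -
  let ?l = "vol (cell_box G (lo_cell \<sigma>))" and ?u = "vol (cell_box G (up_cell \<sigma>))"
  have c: "lo_cell \<sigma> \<in> cells G" "up_cell \<sigma> \<in> cells G" using assms by (auto simp: int_faces_def)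
  have v: "a * vol (dual_cell G \<sigma>) = (?l * a + ?u * a) / 2"
    by (simp add: vol_dual_cell[OF assms] algebra_simps)
  show "a * vol (dual_cell G \<sigma>) \<le> vol (dual_cell G \<sigma>) * dual_density G \<rho> \<sigma>"
    if "\<And>K. K \<in> cells G \<Longrightarrow> a \<le> \<rho> K"
    unfolding v dual_density_eq[OF assms] using c that
    by (intro divide_right_mono add_mono mult_left_mono) auto
  show "vol (dual_cell G \<sigma>) * dual_density G \<rho> \<sigma> \<le> a * vol (dual_cell G \<sigma>)"
    if "\<And>K. K \<in> cells G \<Longrightarrow> \<rho> K \<le> a"
    unfolding v dual_density_eq[OF assms] using c that
    by (intro divide_right_mono add_mono mult_left_mono) auto
qed

lemma kinetic_energy_ge:
  assumes "\<And>K. K \<in> cells G \<Longrightarrow> a \<le> \<rho> K"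
  shows "a / 2 * face_L2 u \<le> kinetic_energy \<rho> u"
  unfolding face_L2_def kinetic_energy_def sum_distrib_left
proof (intro sum_mono)
  fix \<sigma> assume "\<sigma> \<in> int_faces G"
  then have "a * vol (dual_cell G \<sigma>) * ((u \<sigma>)\<^sup>2 / 2) \<le> vol (dual_cell G \<sigma>) * dual_density G \<rho> \<sigma> * ((u \<sigma>)\<^sup>2 / 2)"
    using assms by (intro mult_right_mono dual_density_bounds) auto
  then show "a / 2 * (vol (dual_cell G \<sigma>) * (u \<sigma>)\<^sup>2) \<le> vol (dual_cell G \<sigma>) * dual_density G \<rho> \<sigma> * (u \<sigma>)\<^sup>2 / 2"
    by (simp add: algebra_simps)
qed

lemma kinetic_energy_le:
  assumes "\<And>K. K \<in> cells G \<Longrightarrow> \<rho> K \<le> b"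
  shows "kinetic_energy \<rho> u \<le> b / 2 * face_L2 u"
  unfolding face_L2_def kinetic_energy_def sum_distrib_left
proof (intro sum_mono)
  fix \<sigma> assume "\<sigma> \<in> int_faces G"
  then have "vol (dual_cell G \<sigma>) * dual_density G \<rho> \<sigma> * ((u \<sigma>)\<^sup>2 / 2) \<le> b * vol (dual_cell G \<sigma>) * ((u \<sigma>)\<^sup>2 / 2)"
    using assms by (intro mult_right_mono dual_density_bounds) auto
  then show "vol (dual_cell G \<sigma>) * dual_density G \<rho> \<sigma> * (u \<sigma>)\<^sup>2 / 2 \<le> b / 2 * (vol (dual_cell G \<sigma>) * (u \<sigma>)\<^sup>2)"
    by (simp add: algebra_simps)
qed

lemma energy_step:
  assumes u: "u \<in> H_zero G" and "0 < \<delta>"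
    and mass: "\<And>K. K \<in> cells G \<Longrightarrow>
      (\<rho>' K - \<rho> K) / \<delta> + (\<Sum>\<sigma>\<in>cell_faces K. mass_flux G \<rho>' u K \<sigma>) / vol (cell_box G K) = 0"
    and div: "\<And>K. K \<in> cells G \<Longrightarrow> (\<Sum>\<sigma>\<in>cell_faces K. face_area G \<sigma> * out_vel u K \<sigma>) = 0"
    and momentum: "\<And>\<sigma>. \<sigma> \<in> int_faces G \<Longrightarrow>
      (dual_density G \<rho>' \<sigma> * u \<sigma> - dual_density G \<rho> \<sigma> * w \<sigma>) / \<delta> +
      (\<Sum>\<epsilon>\<in>dual_cell_faces \<sigma>. dual_flux G \<rho>' u \<sigma> \<epsilon> * upwind_vel G \<rho>' u \<sigma> \<epsilon>) / vol (dual_cell G \<sigma>) -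
      diffusion G \<mu> \<rho>' u \<sigma> + pressure_grad G p \<sigma> = F \<sigma>"
    and \<rho>: "\<And>K. K \<in> cells G \<Longrightarrow> 0 \<le> \<rho> K"
    and m: "0 \<le> m" "\<And>K. K \<in> cells G \<Longrightarrow> m \<le> \<mu> (\<rho>' K)"
  shows "kinetic_energy \<rho>' u - kinetic_energy \<rho> w + \<delta> * (m / 2) * dissipation u \<le>
    \<delta> * (sqrt (face_L2 F) * sqrt (face_L2 u))"
proof -
  define V D D' C S where "V \<sigma> = vol (dual_cell G \<sigma>)" and "D \<sigma> = V \<sigma> * dual_density G \<rho> \<sigma>"
    and "D' \<sigma> = V \<sigma> * dual_density G \<rho>' \<sigma>"
    and "C \<sigma> = (\<Sum>\<epsilon>\<in>dual_cell_faces \<sigma>. dual_flux G \<rho>' u \<sigma> \<epsilon> * upwind_vel G \<rho>' u \<sigma> \<epsilon>)"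
    and "S \<sigma> = (\<Sum>\<epsilon>\<in>dual_cell_faces \<sigma>. dual_flux G \<rho>' u \<sigma> \<epsilon>)" for \<sigma>
  have local: "(D' \<sigma> * (u \<sigma>)\<^sup>2 / 2 - D \<sigma> * (w \<sigma>)\<^sup>2 / 2) + \<delta> * (C \<sigma> * u \<sigma> - S \<sigma> * (u \<sigma>)\<^sup>2 / 2) -
      \<delta> * (V \<sigma> * diffusion G \<mu> \<rho>' u \<sigma> * u \<sigma>) + \<delta> * (V \<sigma> * pressure_grad G p \<sigma> * u \<sigma>) \<le> \<delta> * (V \<sigma> * F \<sigma> * u \<sigma>)"
    if \<sigma>: "\<sigma> \<in> int_faces G" for \<sigma>
  proof -
    have V: "0 < V \<sigma>" unfolding V_def by (rule vol_dual_cell_pos[OF \<sigma>])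
    have scale: "V * x + \<delta> * c - \<delta> * (V * d) + \<delta> * (V * p) = \<delta> * (V * F)"
      if "x / \<delta> + c / V - d + p = F" "0 < V" for V x c d p F :: real
      unfolding that(1)[symmetric] using that(2) \<open>0 < \<delta>\<close> by (simp add: field_simps)
    have eq: "(D' \<sigma> * u \<sigma> - D \<sigma> * w \<sigma>) + \<delta> * C \<sigma> - \<delta> * (V \<sigma> * diffusion G \<mu> \<rho>' u \<sigma>) +
        \<delta> * (V \<sigma> * pressure_grad G p \<sigma>) = \<delta> * (V \<sigma> * F \<sigma>)"
      using scale[OF momentum[OF \<sigma>, folded C_def V_def] V] by (simp add: D_def D'_def algebra_simps)
    have bal: "\<delta> * S \<sigma> = D \<sigma> - D' \<sigma>"
      using dual_mass_balance[OF \<sigma> _ mass] \<open>0 < \<delta>\<close> by (simp add: S_def D_def D'_def V_def algebra_simps)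
    have D0: "0 \<le> D \<sigma>"
      using dual_density_bounds(1)[OF \<sigma> \<rho>] by (simp add: D_def V_def)
    \<comment> \<open>Completing squares leaves
      \<open>(D' \<sigma> - D \<sigma>) * (u \<sigma>)\<^sup>2 / 2\<close>, which the dual mass
      balance turns into the flux term absorbed by \<open>convection_work\<close>. The term with
      \<open>(u \<sigma> - w \<sigma>)\<^sup>2\<close> is the dissipation of the implicit Euler step
      and is dropped, as the old density is nonnegative.\<close>
    have "(D' \<sigma> * u \<sigma> - D \<sigma> * w \<sigma>) * u \<sigma> =
        D' \<sigma> * (u \<sigma>)\<^sup>2 / 2 - D \<sigma> * (w \<sigma>)\<^sup>2 / 2 + D \<sigma> * (u \<sigma> - w \<sigma>)\<^sup>2 / 2 - \<delta> * S \<sigma> * (u \<sigma>)\<^sup>2 / 2"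
      unfolding bal by (simp add: power2_eq_square field_simps)
    moreover have "(D' \<sigma> * u \<sigma> - D \<sigma> * w \<sigma>) * u \<sigma> + \<delta> * C \<sigma> * u \<sigma> - \<delta> * (V \<sigma> * diffusion G \<mu> \<rho>' u \<sigma>) * u \<sigma> +
        \<delta> * (V \<sigma> * pressure_grad G p \<sigma>) * u \<sigma> = \<delta> * (V \<sigma> * F \<sigma>) * u \<sigma>"
      unfolding eq[symmetric] by (simp add: algebra_simps)
    moreover have "0 \<le> D \<sigma> * (u \<sigma> - w \<sigma>)\<^sup>2 / 2" using D0 by simp
    ultimately show ?thesis by (simp add: algebra_simps)
  qed
  have "kinetic_energy \<rho>' u - kinetic_energy \<rho> w +
      \<delta> * (\<Sum>\<sigma>\<in>int_faces G. C \<sigma> * u \<sigma> - S \<sigma> * (u \<sigma>)\<^sup>2 / 2) -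
      \<delta> * (\<Sum>\<sigma>\<in>int_faces G. V \<sigma> * diffusion G \<mu> \<rho>' u \<sigma> * u \<sigma>) +
      \<delta> * (\<Sum>\<sigma>\<in>int_faces G. V \<sigma> * pressure_grad G p \<sigma> * u \<sigma>) \<le> \<delta> * (\<Sum>\<sigma>\<in>int_faces G. V \<sigma> * F \<sigma> * u \<sigma>)"
    unfolding kinetic_energy_def sum_distrib_left V_def[symmetric] D_def[symmetric] D'_def[symmetric]
      sum.distrib[symmetric] sum_subtractf[symmetric]
    by (intro sum_mono local)
  moreover have "0 \<le> \<delta> * (\<Sum>\<sigma>\<in>int_faces G. C \<sigma> * u \<sigma> - S \<sigma> * (u \<sigma>)\<^sup>2 / 2)"
    unfolding C_def S_def using convection_work[OF u] \<open>0 < \<delta>\<close> by simp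
  moreover have "\<delta> * (\<Sum>\<sigma>\<in>int_faces G. V \<sigma> * diffusion G \<mu> \<rho>' u \<sigma> * u \<sigma>) \<le> \<delta> * (- (m / 2) * dissipation u)"
    unfolding V_def dissipation_def
    using \<open>0 < \<delta>\<close> by (intro mult_left_mono diffusion_energy_le[OF u div]) (use m in auto)
  moreover have "(\<Sum>\<sigma>\<in>int_faces G. V \<sigma> * pressure_grad G p \<sigma> * u \<sigma>) = 0"
    unfolding V_def by (rule pressure_work[OF u div])
  moreover have "\<delta> * (\<Sum>\<sigma>\<in>int_faces G. V \<sigma> * F \<sigma> * u \<sigma>) \<le> \<delta> * (sqrt (face_L2 F) * sqrt (face_L2 u))"
    unfolding face_L2_def V_def using \<open>0 < \<delta>\<close>
    by (intro mult_left_mono sum_weighted_cauchy_schwarz) auto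
  ultimately show ?thesis by simp
qed

end

section \<open>Norms of step functions and averages\<close>

text \<open>Closed cells may leave the open domain by a null set, on which nothing is known about
  \<open>g\<close>. Inserting \<open>indicator \<Omega>\<close> changes the integrand on that set
  only, and completeness of Lebesgue measure carries measurability over.\<close>

lemma
  fixes g :: "'a::euclidean_space \<Rightarrow> real"
  assumes sets: "S \<in> sets lebesgue" "\<Omega> \<in> sets lebesgue" and null: "negligible (S - \<Omega>)"
    and g: "integrable (lebesgue_on \<Omega>) g"
  shows integrable_lebesgue_on_null: "integrable (lebesgue_on S) g"
    and integral_lebesgue_on_null:
      "(LINT x|lebesgue_on S. g x) = (LINT x|lebesgue_on \<Omega>. indicator S x * g x)"
proof -
  let ?h = "\<lambda>x. indicator S x * (indicator \<Omega> x * g x)"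
  have "integrable lebesgue (\<lambda>x. indicator \<Omega> x * g x)"
    using g sets by (simp add: integrable_restrict_space)
  then have h: "integrable lebesgue ?h"
    using sets integrable_mult_indicator[of S lebesgue "\<lambda>x. indicator \<Omega> x * g x"] by simp
  have ae: "AE x in lebesgue. ?h x = indicator S x * g x"
  proof -
    have "AE x in lebesgue. x \<notin> S - \<Omega>"
      using null by (intro AE_not_in) (simp add: negligible_iff_null_sets)
    then show ?thesis by eventually_elim (auto simp: indicator_def)
  qed
  have m: "(\<lambda>x. indicator S x * g x) \<in> borel_measurable lebesgue"
    using borel_measurable_AE[OF borel_measurable_integrable[OF h] ae] .
  have "integrable lebesgue (\<lambda>x. indicator S x * g x)"
    using integrable_cong_AE[OF borel_measurable_integrable[OF h] m ae] h by simp
  then show "integrable (lebesgue_on S) g"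
    using sets by (simp add: integrable_restrict_space)
  have "(LINT x|lebesgue_on S. g x) = (LINT x|lebesgue. indicator S x * g x)"
    using sets by (simp add: integral_restrict_space)
  also have "\<dots> = (LINT x|lebesgue. ?h x)"
    using integral_cong_AE[OF m borel_measurable_integrable[OF h]] ae by auto
  also have "\<dots> = (LINT x|lebesgue. indicator \<Omega> x *\<^sub>R (indicator S x * g x))"
    by (simp add: mult.left_commute)
  also have "\<dots> = (LINT x|lebesgue_on \<Omega>. indicator S x * g x)"
    using sets by (simp add: integral_restrict_space)
  finally show "(LINT x|lebesgue_on S. g x) = (LINT x|lebesgue_on \<Omega>. indicator S x * g x)" .
qed

lemma AE_lebesgue_on_iff:
  "\<Omega> \<in> sets lebesgue \<Longrightarrow> (AE x in lebesgue_on \<Omega>. P x) \<longleftrightarrow> (AE x in lebesgue. x \<in> \<Omega> \<longrightarrow> P x)"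
  by (simp add: AE_restrict_space_iff)

lemma integrable_lebesgue_on_const:
  assumes "S \<in> lmeasurable"
  shows "integrable (lebesgue_on S) (\<lambda>x. c :: real)"
proof -
  have "integrable lebesgue (indicator S :: _ \<Rightarrow> real)"
    using assms by (simp only: lmeasurable_iff_integrable)
  then show ?thesis
    using fmeasurableD[OF assms] by (simp add: integrable_restrict_space)
qed

lemma integral_lebesgue_on_const:
  "S \<in> lmeasurable \<Longrightarrow> (LINT x|lebesgue_on S. c :: real) = c * vol S"
  by (simp add: fmeasurableD measure_restrict_space)

lemma integrable_of_square:
  fixes g :: "'a \<Rightarrow> real"
  assumes "g \<in> borel_measurable M" "integrable M (\<lambda>x. (g x)\<^sup>2)" "integrable M (\<lambda>x. 1 :: real)"
  shows "integrable M g"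
proof (rule Bochner_Integration.integrable_bound)
  show "integrable M (\<lambda>x. 1 + (g x)\<^sup>2)" using assms by auto
  have "\<bar>y\<bar> \<le> 1 + y\<^sup>2" for y :: real
  proof -
    have "0 \<le> (\<bar>y\<bar> - 1 / 2)\<^sup>2" by simp
    then show ?thesis by (simp add: power2_eq_square algebra_simps)
  qed
  then show "AE x in M. norm (g x) \<le> norm (1 + (g x)\<^sup>2)" by simp
qed (use assms in auto)

text \<open>Jensen's inequality for a mean value, obtained by expanding the nonnegative integral of
  \<open>(g x - average S g)\<^sup>2\<close>.\<close>

lemma average_square_le:
  assumes S: "S \<in> lmeasurable" and \<Omega>: "\<Omega> \<in> lmeasurable" and null: "negligible (S - \<Omega>)"
    and g: "g \<in> borel_measurable (lebesgue_on \<Omega>)" "integrable (lebesgue_on \<Omega>) (\<lambda>x. (g x)\<^sup>2)"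
  shows "vol S * (average S g)\<^sup>2 \<le> (LINT x|lebesgue_on \<Omega>. indicator S x * (g x)\<^sup>2)"
proof -
  let ?a = "average S g"
  have sets: "S \<in> sets lebesgue" "\<Omega> \<in> sets lebesgue" using S \<Omega> by (auto simp: fmeasurableD)
  have "integrable (lebesgue_on \<Omega>) g"
    by (rule integrable_of_square[OF g integrable_lebesgue_on_const[OF \<Omega>]])
  note gS = integrable_lebesgue_on_null[OF sets null this]
  note g2S = integrable_lebesgue_on_null[OF sets null g(2)]
  have "0 \<le> (LINT x|lebesgue_on S. (g x - ?a)\<^sup>2)"
    by (rule integral_nonneg_AE) simp
  also have "\<dots> = (LINT x|lebesgue_on S. (g x)\<^sup>2 - 2 * ?a * g x + ?a\<^sup>2)"
    by (simp add: power2_eq_square algebra_simps)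
  also have "\<dots> = (LINT x|lebesgue_on S. (g x)\<^sup>2) - 2 * ?a * (LINT x|lebesgue_on S. g x) + ?a\<^sup>2 * vol S"
    using gS g2S integrable_lebesgue_on_const[OF S] integral_lebesgue_on_const[OF S, of "?a\<^sup>2"] by simp
  finally have "2 * ?a * (LINT x|lebesgue_on S. g x) - ?a\<^sup>2 * vol S \<le> (LINT x|lebesgue_on S. (g x)\<^sup>2)"
    by simp
  moreover have "2 * ?a * (LINT x|lebesgue_on S. g x) - ?a\<^sup>2 * vol S = vol S * ?a\<^sup>2"
    \<comment> \<open>A null set \<open>S\<close> fits in because division by zero makes its average
      0.\<close>
    by (cases "vol S = 0") (simp_all add: average_def power2_eq_square)
  ultimately show ?thesis
    using integral_lebesgue_on_null[OF sets null g(2)] by simp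
qed

lemma average_bounds:
  assumes S: "S \<in> lmeasurable" "0 < vol S" and \<Omega>: "\<Omega> \<in> lmeasurable" and null: "negligible (S - \<Omega>)"
    and g: "g \<in> borel_measurable (lebesgue_on \<Omega>)" "AE x in lebesgue_on \<Omega>. a \<le> g x \<and> g x \<le> b"
  shows "a \<le> average S g" "average S g \<le> b"
proof -
  have sets: "S \<in> sets lebesgue" "\<Omega> \<in> sets lebesgue" using S \<Omega> by (auto simp: fmeasurableD)
  have "integrable (lebesgue_on \<Omega>) g"
  proof (rule Bochner_Integration.integrable_bound[OF integrable_lebesgue_on_const[OF \<Omega>, of "\<bar>a\<bar> + \<bar>b\<bar>"] g(1)])
    show "AE x in lebesgue_on \<Omega>. norm (g x) \<le> norm (\<bar>a\<bar> + \<bar>b\<bar>)"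
      using g(2) by eventually_elim auto
  qed
  note gS = integrable_lebesgue_on_null[OF sets null this]
  have "AE x in lebesgue. x \<notin> S - \<Omega>"
    using null by (intro AE_not_in) (simp add: negligible_iff_null_sets)
  moreover have "AE x in lebesgue. x \<in> \<Omega> \<longrightarrow> a \<le> g x \<and> g x \<le> b"
    using g(2) by (simp only: AE_lebesgue_on_iff[OF sets(2)])
  ultimately have "AE x in lebesgue. x \<in> S \<longrightarrow> a \<le> g x \<and> g x \<le> b"
    by eventually_elim auto
  then have ae: "AE x in lebesgue_on S. a \<le> g x \<and> g x \<le> b"
    by (simp only: AE_lebesgue_on_iff[OF sets(1)])
  have "a * vol S \<le> (LINT x|lebesgue_on S. g x)"
    unfolding integral_lebesgue_on_const[OF S(1), symmetric]
    by (rule integral_mono_AE[OF integrable_lebesgue_on_const[OF S(1)] gS]) (use ae in eventually_elim, auto)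
  then show "a \<le> average S g"
    using S by (simp add: average_def pos_le_divide_eq)
  have "(LINT x|lebesgue_on S. g x) \<le> b * vol S"
    unfolding integral_lebesgue_on_const[OF S(1), symmetric]
    by (rule integral_mono_AE[OF gS integrable_lebesgue_on_const[OF S(1)]]) (use ae in eventually_elim, auto)
  then show "average S g \<le> b"
    using S by (simp add: average_def pos_divide_le_eq)
qed

section \<open>Step functions over almost disjoint sets\<close>

lemma AE_almost_disjoint:
  assumes "finite I" and null: "\<And>k l. k \<in> I \<Longrightarrow> l \<in> I \<Longrightarrow> k \<noteq> l \<Longrightarrow> negligible (D k \<inter> D l)"
    and "\<Omega> \<in> sets lebesgue"
  shows "AE x in lebesgue_on \<Omega>. \<forall>k\<in>I. \<forall>l\<in>I. k \<noteq> l \<longrightarrow> x \<notin> D k \<inter> D l"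
proof -
  have "AE x in lebesgue. k \<noteq> l \<longrightarrow> x \<notin> D k \<inter> D l" if "k \<in> I" "l \<in> I" for k l
  proof (cases "k = l")
    case False
    then show ?thesis
      using AE_not_in[of "D k \<inter> D l" lebesgue] null[OF that] by (simp add: negligible_iff_null_sets)
  qed simp
  then have "AE x in lebesgue. \<forall>k\<in>I. \<forall>l\<in>I. k \<noteq> l \<longrightarrow> x \<notin> D k \<inter> D l"
    using assms(1) by (intro AE_finite_allI) auto
  then show ?thesis
    unfolding AE_lebesgue_on_iff[OF assms(3)] by eventually_elim blast
qed

lemma sum_indicator_disjoint:
  fixes c :: "'k \<Rightarrow> real"
  assumes "finite I" "\<forall>k\<in>I. \<forall>l\<in>I. k \<noteq> l \<longrightarrow> x \<notin> D k \<inter> D l"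
  shows "(\<Sum>k\<in>I. c k * indicator (D k) x)\<^sup>2 = (\<Sum>k\<in>I. (c k)\<^sup>2 * indicator (D k) x)"
    and "(\<Sum>k\<in>I. indicator (D k) x) \<le> (1 :: real)"
proof -
  have "(\<Sum>k\<in>I. c k * indicator (D k) x)\<^sup>2 = (\<Sum>k\<in>I. (c k)\<^sup>2 * indicator (D k) x) \<and>
      (\<Sum>k\<in>I. indicator (D k) x) \<le> (1 :: real)"
  proof (cases "\<exists>k\<in>I. x \<in> D k")
    case True
    then obtain k where k: "k \<in> I" "x \<in> D k" by auto
    then have ind: "f l * indicator (D l) x = (if l = k then f l else 0)" if "l \<in> I" for l and f :: "'k \<Rightarrow> real"
      using assms(2) that by (auto simp: indicator_def)
    have "(\<Sum>l\<in>I. f l * indicator (D l) x) = f k" for f :: "'k \<Rightarrow> real"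
    proof -
      have "(\<Sum>l\<in>I. f l * indicator (D l) x) = (\<Sum>l\<in>I. if l = k then f l else 0)"
        by (rule sum.cong[OF refl ind])
      then show ?thesis using k assms(1) by simp
    qed
    from this[of c] this[of "\<lambda>l. (c l)\<^sup>2"] this[of "\<lambda>_. 1"] show ?thesis
      by (simp only: mult_1 order_refl simp_thms)
  next
    case False
    then show ?thesis by simp
  qed
  then show "(\<Sum>k\<in>I. c k * indicator (D k) x)\<^sup>2 = (\<Sum>k\<in>I. (c k)\<^sup>2 * indicator (D k) x)"
    "(\<Sum>k\<in>I. indicator (D k) x) \<le> (1 :: real)" by auto
qed

lemma
  assumes \<Omega>: "\<Omega> \<in> lmeasurable" and S: "S \<in> lmeasurable"
  shows integrable_lebesgue_on_indicator: "integrable (lebesgue_on \<Omega>) (indicator S :: _ \<Rightarrow> real)"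
    and integral_lebesgue_on_indicator_le: "(LINT x|lebesgue_on \<Omega>. indicator S x :: real) \<le> vol S"
proof -
  have s: "\<Omega> \<in> sets lebesgue" using \<Omega> by (rule fmeasurableD)
  have eq: "indicator \<Omega> x * indicator S x = (indicator (\<Omega> \<inter> S) x :: real)" for x
    by (simp add: indicator_inter_arith)
  have m: "\<Omega> \<inter> S \<in> lmeasurable" using \<Omega> S by (rule fmeasurable.Int)
  then show "integrable (lebesgue_on \<Omega>) (indicator S :: _ \<Rightarrow> real)"
    using s by (simp add: integrable_restrict_space eq lmeasurable_iff_integrable del: indicator_inter_arith)
  have "(LINT x|lebesgue_on \<Omega>. indicator S x :: real) = vol (\<Omega> \<inter> S)"
    using s by (simp add: measure_restrict_space Int_commute)
  also have "\<dots> \<le> vol S"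
    using m S by (intro measure_mono_fmeasurable) (auto simp: fmeasurableD)
  finally show "(LINT x|lebesgue_on \<Omega>. indicator S x :: real) \<le> vol S" .
qed

text \<open>Almost everywhere at most one indicator is nonzero, so the square of the sum is the sum
  of the squares. The second claim is only an inequality because the sets \<open>D k\<close> may
  stick out of \<open>\<Omega>\<close>.\<close>

lemma
  fixes c :: "'k \<Rightarrow> real" and D :: "'k \<Rightarrow> 'a::euclidean_space set"
  assumes I: "finite I" and D: "\<And>k. k \<in> I \<Longrightarrow> D k \<in> lmeasurable"
    and null: "\<And>k l. k \<in> I \<Longrightarrow> l \<in> I \<Longrightarrow> k \<noteq> l \<Longrightarrow> negligible (D k \<inter> D l)"
    and \<Omega>: "\<Omega> \<in> lmeasurable"
  shows integrable_step_square: "integrable (lebesgue_on \<Omega>) (\<lambda>x. (\<Sum>k\<in>I. c k * indicator (D k) x)\<^sup>2)"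
    and integral_step_square:
      "(LINT x|lebesgue_on \<Omega>. (\<Sum>k\<in>I. c k * indicator (D k) x)\<^sup>2) \<le> (\<Sum>k\<in>I. vol (D k) * (c k)\<^sup>2)"
proof -
  have s: "\<Omega> \<in> sets lebesgue" using \<Omega> by (rule fmeasurableD)
  let ?f = "\<lambda>x. (\<Sum>k\<in>I. c k * indicator (D k) x)\<^sup>2" and ?g = "\<lambda>x. \<Sum>k\<in>I. (c k)\<^sup>2 * indicator (D k) x"
  note ind = integrable_lebesgue_on_indicator[OF \<Omega> D] integral_lebesgue_on_indicator_le[OF \<Omega> D]
  have g: "integrable (lebesgue_on \<Omega>) ?g"
    using ind by (intro Bochner_Integration.integrable_sum integrable_mult_right) auto
  have f: "?f \<in> borel_measurable (lebesgue_on \<Omega>)"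
    using borel_measurable_integrable[OF ind(1)]
    by (intro borel_measurable_power borel_measurable_sum borel_measurable_times) auto
  have ae: "AE x in lebesgue_on \<Omega>. ?g x = ?f x"
  proof -
    have "AE x in lebesgue_on \<Omega>. \<forall>k\<in>I. \<forall>l\<in>I. k \<noteq> l \<longrightarrow> x \<notin> D k \<inter> D l"
      by (rule AE_almost_disjoint[OF I _ s]) (rule null)
    then show ?thesis
      by eventually_elim (rule sum_indicator_disjoint(1)[OF I, symmetric])
  qed
  show "integrable (lebesgue_on \<Omega>) ?f"
    using integrable_cong_AE[OF borel_measurable_integrable[OF g] f ae] g by simp
  have "(LINT x|lebesgue_on \<Omega>. ?f x) = (LINT x|lebesgue_on \<Omega>. ?g x)"
    by (rule integral_cong_AE[OF borel_measurable_integrable[OF g] f ae, symmetric])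
  also have "\<dots> = (\<Sum>k\<in>I. (c k)\<^sup>2 * (LINT x|lebesgue_on \<Omega>. indicator (D k) x))"
    using ind by (subst Bochner_Integration.integral_sum) auto
  also have "\<dots> \<le> (\<Sum>k\<in>I. (c k)\<^sup>2 * vol (D k))"
    using ind by (intro sum_mono mult_left_mono) auto
  finally show "(LINT x|lebesgue_on \<Omega>. ?f x) \<le> (\<Sum>k\<in>I. vol (D k) * (c k)\<^sup>2)"
    by (simp add: mult.commute)
qed

lemma norm_square_vec: "(norm (v :: real ^ 'n::finite))\<^sup>2 = (\<Sum>i\<in>UNIV. (v $ i)\<^sup>2)"
  by (simp add: power2_norm_eq_inner inner_vec_def flip: power2_eq_square)

lemma borel_measurable_vec_nth_comp:
  fixes v :: "'a \<Rightarrow> real ^ 'n::finite"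
  assumes "v \<in> borel_measurable M"
  shows "(\<lambda>x. v x $ i) \<in> borel_measurable M"
  using measurable_compose[OF assms, of "\<lambda>y. y $ i" borel]
  by (simp add: borel_measurable_continuous_onI continuous_on_component)

lemma in_L2_component:
  fixes v :: "'a::euclidean_space \<Rightarrow> real ^ 'n::finite"
  assumes "in_L2 \<Omega> v"
  shows "(\<lambda>x. v x $ i) \<in> borel_measurable (lebesgue_on \<Omega>)"
    and "integrable (lebesgue_on \<Omega>) (\<lambda>x. (v x $ i)\<^sup>2)"
proof -
  show m: "(\<lambda>x. v x $ i) \<in> borel_measurable (lebesgue_on \<Omega>)"
    using assms by (intro borel_measurable_vec_nth_comp) (simp add: in_L2_def)
  show "integrable (lebesgue_on \<Omega>) (\<lambda>x. (v x $ i)\<^sup>2)"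
  proof (rule Bochner_Integration.integrable_bound)
    show "integrable (lebesgue_on \<Omega>) (\<lambda>x. (norm (v x))\<^sup>2)" using assms by (simp add: in_L2_def)
    show "AE x in lebesgue_on \<Omega>. norm ((v x $ i)\<^sup>2) \<le> norm ((norm (v x))\<^sup>2)"
      unfolding norm_square_vec
      by (intro AE_I2) (auto simp: sum_nonneg intro: member_le_sum[where f = "\<lambda>i. (_ $ i)\<^sup>2"])
  qed (use m in auto)
qed

context mac_mesh
begin

section \<open>Comparison of the discrete sums with norms over the domain\<close>

lemma finite_faces: "finite (faces G)"
proof (rule finite_subset)
  show "faces G \<subseteq> UNIV \<times> near"
    using near_shift(1) near_shift(2)[of "shift K i (- 1)" 1 i for K i] by (force simp: faces_def)
  show "finite ((UNIV :: 'n set) \<times> near)" by (simp add: finite_near)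
qed

lemma negligible_dual_cell_minus_region: "negligible (dual_cell G \<sigma> - region G)"
  using dual_cell_subset[of \<sigma>] by (intro negligible_subset[OF negligible_cells_minus_region]) blast

lemma negligible_cell_box_minus_region: "K \<in> cells G \<Longrightarrow> negligible (cell_box G K - region G)"
  by (intro negligible_subset[OF negligible_cells_minus_region]) auto

lemma int_faces_subset: "int_faces G \<subseteq> faces G"
  by (auto simp: int_faces_def faces_def)

lemma sum_by_direction:
  "(\<Sum>\<sigma>\<in>int_faces G. g \<sigma>) = (\<Sum>i\<in>UNIV. \<Sum>\<sigma>\<in>{\<sigma> \<in> int_faces G. fst \<sigma> = i}. (g \<sigma> :: real))"
  by (rule sum.group[symmetric]) (auto simp: finite_int_faces)

text \<open>Jensen's inequality holds on each dual cell; the bounds add up one component at a time,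
  as only dual cells of the same direction are known to be almost disjoint. Serves for the initial
  velocity and for each sampled source.\<close>

lemma face_L2_average_le:
  assumes v: "in_L2 (region G) v"
  shows "face_L2 (\<lambda>\<sigma>. average (dual_cell G \<sigma>) (\<lambda>x. v x $ fst \<sigma>)) \<le> (L2norm (region G) v)\<^sup>2"
proof -
  let ?M = "lebesgue_on (region G)"
  have rs: "region G \<in> sets lebesgue" using region_lmeasurable by (rule fmeasurableD)
  have int: "integrable ?M (\<lambda>x. indicator (dual_cell G \<sigma>) x * (v x $ i)\<^sup>2)" for \<sigma> i
  proof (rule Bochner_Integration.integrable_bound[OF in_L2_component(2)[OF v, of i]])
    have "dual_cell G \<sigma> \<in> sets lebesgue" using dual_cell_lmeasurable by (rule fmeasurableD)
    then have "indicator (dual_cell G \<sigma>) \<in> borel_measurable ?M"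
      by (intro measurable_restrict_space1) simp
    then show "(\<lambda>x. indicator (dual_cell G \<sigma>) x * (v x $ i)\<^sup>2) \<in> borel_measurable ?M"
      using in_L2_component(1)[OF v, of i] by (intro borel_measurable_times borel_measurable_power)
  qed (auto simp: indicator_def)
  have "(\<Sum>\<sigma>\<in>{\<sigma> \<in> int_faces G. fst \<sigma> = i}. vol (dual_cell G \<sigma>) * (average (dual_cell G \<sigma>) (\<lambda>x. v x $ fst \<sigma>))\<^sup>2)
      \<le> (LINT x|?M. (v x $ i)\<^sup>2)" for i
  proof -
    let ?I = "{\<sigma> \<in> int_faces G. fst \<sigma> = i}"
    have I: "finite ?I" by (simp add: finite_int_faces)
    have "(\<Sum>\<sigma>\<in>?I. vol (dual_cell G \<sigma>) * (average (dual_cell G \<sigma>) (\<lambda>x. v x $ fst \<sigma>))\<^sup>2) \<le>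
        (\<Sum>\<sigma>\<in>?I. (LINT x|?M. indicator (dual_cell G \<sigma>) x * (v x $ i)\<^sup>2))"
      using in_L2_component[OF v, of i]
      by (intro sum_mono) (auto intro!: average_square_le negligible_dual_cell_minus_region)
    also have "\<dots> = (LINT x|?M. (\<Sum>\<sigma>\<in>?I. indicator (dual_cell G \<sigma>) x * (v x $ i)\<^sup>2))"
      using int by (subst Bochner_Integration.integral_sum) auto
    also have "\<dots> \<le> (LINT x|?M. (v x $ i)\<^sup>2)"
    proof (rule integral_mono_AE)
      have "AE x in ?M. \<forall>k\<in>?I. \<forall>l\<in>?I. k \<noteq> l \<longrightarrow> x \<notin> dual_cell G k \<inter> dual_cell G l"
        by (rule AE_almost_disjoint[OF I _ rs]) (auto intro: negligible_dual_cell_Int)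
      then show "AE x in ?M. (\<Sum>\<sigma>\<in>?I. indicator (dual_cell G \<sigma>) x * (v x $ i)\<^sup>2) \<le> (v x $ i)\<^sup>2"
      proof eventually_elim
        case (elim x)
        have "(\<Sum>\<sigma>\<in>?I. indicator (dual_cell G \<sigma>) x) * (v x $ i)\<^sup>2 \<le> 1 * (v x $ i)\<^sup>2"
          by (intro mult_right_mono sum_indicator_disjoint(2)[OF I elim]) simp
        then show ?case by (simp add: sum_distrib_right)
      qed
    qed (use int in_L2_component(2)[OF v] in auto)
    finally show ?thesis .
  qed
  then have "face_L2 (\<lambda>\<sigma>. average (dual_cell G \<sigma>) (\<lambda>x. v x $ fst \<sigma>)) \<le> (\<Sum>i\<in>UNIV. LINT x|?M. (v x $ i)\<^sup>2)"
    unfolding face_L2_def sum_by_direction by (rule sum_mono)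
  also have "\<dots> = (LINT x|?M. (norm (v x))\<^sup>2)"
    unfolding norm_square_vec
    using in_L2_component(2)[OF v] by (subst Bochner_Integration.integral_sum) auto
  also have "\<dots> = (L2norm (region G) v)\<^sup>2"
    unfolding L2norm_def by (simp add: real_sqrt_pow2 integral_nonneg_AE)
  finally show ?thesis .
qed

lemma velocity_L2_le:
  assumes u: "u \<in> H_zero G"
  shows "L2norm (region G) (velocity G u) \<le> sqrt (face_L2 u)"
proof -
  let ?M = "lebesgue_on (region G)" and ?I = "\<lambda>i. {\<sigma> \<in> faces G. fst \<sigma> = i}"
  have nz: "\<sigma> \<notin> int_faces G \<Longrightarrow> vol (dual_cell G \<sigma>) * (u \<sigma>)\<^sup>2 = 0" for \<sigma>
    using H_zeroD[OF u] by simp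
  have I: "finite (?I i)" for i using finite_faces by simp
  have int: "integrable ?M (\<lambda>x. (velocity G u x $ i)\<^sup>2)" for i
    unfolding velocity_def vec_lambda_beta
    by (rule integrable_step_square[OF I]) (auto intro: negligible_dual_cell_Int)
  have "(LINT x|?M. (norm (velocity G u x))\<^sup>2) = (\<Sum>i\<in>UNIV. LINT x|?M. (velocity G u x $ i)\<^sup>2)"
    unfolding norm_square_vec using int by (subst Bochner_Integration.integral_sum) auto
  also have "\<dots> \<le> (\<Sum>i\<in>UNIV. \<Sum>\<sigma>\<in>?I i. vol (dual_cell G \<sigma>) * (u \<sigma>)\<^sup>2)"
    unfolding velocity_def vec_lambda_beta
    by (intro sum_mono integral_step_square[OF I]) (auto intro: negligible_dual_cell_Int)
  also have "\<dots> = face_L2 u"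
    unfolding face_L2_def sum_by_direction
    using int_faces_subset nz by (intro sum.cong[OF refl] sum.mono_neutral_right) (auto simp: finite_faces)
  finally show ?thesis
    unfolding L2norm_def by (rule real_sqrt_le_mono)
qed

text \<open>Only an inequality, because \<open>near\<close> also contains indices that belong to no
  dual face; their terms are nonnegative.\<close>

lemma H_norm_le: "(H_norm G u)\<^sup>2 \<le> dissipation u"
proof -
  let ?M = "lebesgue_on (region G)"
  have "(L2norm (region G) (ddiff_fun G u i j))\<^sup>2 \<le> (\<Sum>K\<in>near. vol (diamond G (i, j, K)) * (ddiff G u (i, j, K))\<^sup>2)" for i j
  proof -
    have sub: "dual_faces G i j \<subseteq> (\<lambda>K. (i, j, K)) ` near"
    proof
      fix \<epsilon> assume "\<epsilon> \<in> dual_faces G i j"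
      then have mem: "fst \<epsilon> = i" "fst (snd \<epsilon>) = j" and
        K': "if i = j then snd (snd \<epsilon>) \<in> cells G else lo_face \<epsilon> \<in> faces G \<or> up_face \<epsilon> \<in> faces G"
        unfolding dual_faces_def by blast+
      obtain K where e: "\<epsilon> = (i, j, K)"
        using mem by (cases \<epsilon>) simp
      have K: "if i = j then K \<in> cells G else lo_face \<epsilon> \<in> faces G \<or> up_face \<epsilon> \<in> faces G"
        using K' unfolding e fst_conv snd_conv .
      have "K \<in> near"
        using K near_shift(1)[of K] near_shift(2)[of "shift K j (- 1)" 1 j] near_shift(2)[of "shift K i (- 1)" 1 i]
          near_shift(3)[of "shift (shift K j (- 1)) i (- 1)" 1 1 i j]
        by (auto simp: e faces_def split: if_splits)
      then show "\<epsilon> \<in> (\<lambda>K. (i, j, K)) ` near" by (auto simp: e)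
    qed
    have fin: "finite (dual_faces G i j)"
      using finite_near by (intro finite_subset[OF sub]) auto
    have "(L2norm (region G) (ddiff_fun G u i j))\<^sup>2 = (LINT x|?M. (ddiff_fun G u i j x)\<^sup>2)"
      unfolding L2norm_def by (simp add: real_sqrt_pow2 integral_nonneg_AE)
    also have "\<dots> \<le> (\<Sum>\<epsilon>\<in>dual_faces G i j. vol (diamond G \<epsilon>) * (ddiff G u \<epsilon>)\<^sup>2)"
      unfolding ddiff_fun_def
    proof (rule integral_step_square[OF fin])
      fix k l assume "k \<in> dual_faces G i j" "l \<in> dual_faces G i j" "k \<noteq> l"
      moreover from this obtain K L where "k = (i, j, K)" "l = (i, j, L)" using sub by blast
      ultimately show "negligible (diamond G k \<inter> diamond G l)"
        using negligible_diamond_Int[of K L i j] by blast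
    qed auto
    also have "\<dots> \<le> (\<Sum>\<epsilon>\<in>(\<lambda>K. (i, j, K)) ` near. vol (diamond G \<epsilon>) * (ddiff G u \<epsilon>)\<^sup>2)"
      using finite_near by (intro sum_mono2 sub) auto
    also have "\<dots> = (\<Sum>K\<in>near. vol (diamond G (i, j, K)) * (ddiff G u (i, j, K))\<^sup>2)"
      by (subst sum.reindex) (auto simp: inj_on_def)
    finally show ?thesis .
  qed
  then show ?thesis
    unfolding H_norm_def dissipation_def by (simp add: real_sqrt_pow2 sum_nonneg sum_mono)
qed

end

section \<open>Piecewise constant functions of time\<close>

lemma ceiling_step_iff:
  assumes "0 < \<delta>"
  shows "t \<in> {real n * \<delta><..real (Suc n) * \<delta>} \<longleftrightarrow> nat \<lceil>t / \<delta>\<rceil> = Suc n"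
proof -
  have "nat \<lceil>t / \<delta>\<rceil> = Suc n \<longleftrightarrow> \<lceil>t / \<delta>\<rceil> = int (Suc n)" by linarith
  also have "\<dots> \<longleftrightarrow> real n < t / \<delta> \<and> t / \<delta> \<le> real (Suc n)" by (simp add: ceiling_eq_iff)
  also have "\<dots> \<longleftrightarrow> t \<in> {real n * \<delta><..real (Suc n) * \<delta>}"
    using assms by (simp add: pos_less_divide_eq pos_divide_le_eq)
  finally show ?thesis ..
qed

lemma ceiling_step_obtain:
  assumes "0 < \<delta>" "t \<in> {0<..<real N * \<delta>}"
  obtains n where "n < N" "nat \<lceil>t / \<delta>\<rceil> = Suc n"
proof -
  have "0 < t / \<delta>" "t / \<delta> < real N"
    using assms by (simp_all add: pos_divide_less_eq)
  then have "0 < \<lceil>t / \<delta>\<rceil>" "\<lceil>t / \<delta>\<rceil> \<le> int N" by linarith+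
  then show ?thesis
    by (intro that[of "nat \<lceil>t / \<delta>\<rceil> - 1"]) linarith+
qed

lemma lmeasurable_Ioc [simp]: "{a<..b :: real} \<in> lmeasurable"
  by (rule bounded_set_imp_lmeasurable) (auto intro: bounded_subset[of "{a..b}"])

lemma measure_time_step:
  assumes "0 < \<delta>" "n < N"
  shows "measure (lebesgue_on {0<..<real N * \<delta>}) ({real n * \<delta><..real (Suc n) * \<delta>} \<inter> {0<..<real N * \<delta>}) = \<delta>"
    (is "measure _ (?A \<inter> ?T) = _")
proof -
  have len: "real (Suc n) * \<delta> - real n * \<delta> = \<delta>" by (simp add: algebra_simps)
  have le: "real n * \<delta> \<le> real (Suc n) * \<delta>" "real (Suc n) * \<delta> \<le> real N * \<delta>" "0 \<le> real n * \<delta>"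
    using assms by (auto intro: mult_right_mono)
  \<comment> \<open>The open time interval cuts the end point off the last step, so the measure is
    squeezed between those of the open and of the half-open step.\<close>
  then have sub: "{real n * \<delta><..<real (Suc n) * \<delta>} \<subseteq> ?A \<inter> ?T" by auto
  have "measure lebesgue {real n * \<delta><..<real (Suc n) * \<delta>} \<le> measure lebesgue (?A \<inter> ?T)"
    by (rule measure_mono_fmeasurable[OF sub]) (simp_all add: fmeasurable.Int del: of_nat_Suc)
  moreover have "measure lebesgue (?A \<inter> ?T) \<le> measure lebesgue ?A"
    by (rule measure_mono_fmeasurable) (auto simp del: of_nat_Suc)
  moreover have "measure lebesgue {real n * \<delta><..<real (Suc n) * \<delta>} = \<delta>" "measure lebesgue ?A = \<delta>"
    using le len by (simp_all add: measure_completion del: of_nat_Suc)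
  ultimately show ?thesis by (simp add: measure_restrict_space)
qed

lemma integral_time_steps:
  fixes g :: "nat \<Rightarrow> real"
  assumes "0 < \<delta>"
  shows "(LINT t|lebesgue_on {0<..<real N * \<delta>}. g (nat \<lceil>t / \<delta>\<rceil>)) = (\<Sum>n<N. \<delta> * g (Suc n))"
proof -
  let ?T = "{0<..<real N * \<delta>}" and ?A = "\<lambda>n. {real n * \<delta><..real (Suc n) * \<delta>}"
  have "(LINT t|lebesgue_on ?T. g (nat \<lceil>t / \<delta>\<rceil>)) =
      (LINT t|lebesgue_on ?T. (\<Sum>n<N. g (Suc n) * indicator (?A n \<inter> ?T) t))"
  proof (rule Bochner_Integration.integral_cong[OF refl])
    fix t assume "t \<in> space (lebesgue_on ?T)"
    then have t: "t \<in> ?T" by simp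
    then obtain k where k: "k < N" "nat \<lceil>t / \<delta>\<rceil> = Suc k"
      using ceiling_step_obtain[OF assms] by blast
    have "(\<Sum>n<N. g (Suc n) * indicator (?A n \<inter> ?T) t) = (\<Sum>n<N. if n = k then g (Suc n) else 0)"
      using t k ceiling_step_iff[OF assms, of t] by (intro sum.cong refl) (simp add: indicator_def del: greaterThanAtMost_iff)
    then show "g (nat \<lceil>t / \<delta>\<rceil>) = (\<Sum>n<N. g (Suc n) * indicator (?A n \<inter> ?T) t)"
      using k by simp
  qed
  also have "\<dots> = (\<Sum>n<N. (LINT t|lebesgue_on ?T. g (Suc n) * indicator (?A n \<inter> ?T) t))"
  proof (rule Bochner_Integration.integral_sum)
    fix n
    have "?A n \<inter> ?T \<in> lmeasurable" by (simp add: fmeasurable.Int)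
    then have "integrable (lebesgue_on ?T) (indicator (?A n \<inter> ?T) :: real \<Rightarrow> real)"
      by (intro integrable_lebesgue_on_indicator) simp_all
    then show "integrable (lebesgue_on ?T) (\<lambda>t. g (Suc n) * indicator (?A n \<inter> ?T) t)"
      by simp
  qed
  also have "\<dots> = (\<Sum>n<N. \<delta> * g (Suc n))"
    using measure_time_step[OF assms] by (intro sum.cong refl) simp
  finally show ?thesis .
qed

text \<open>Each value of the step function is taken on a set of positive measure
  \<open>\<delta>\<close>, so the essential supremum cannot miss the maximum.\<close>

lemma esssup_time_steps:
  fixes g :: "nat \<Rightarrow> real"
  assumes "0 < \<delta>" "0 < N"
  shows "esssup (lebesgue_on {0<..<real N * \<delta>}) (\<lambda>t. ereal (g (nat \<lceil>t / \<delta>\<rceil>))) =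
    ereal (Max ((\<lambda>n. g (Suc n)) ` {..<N}))" (is "esssup ?M ?f = ereal (Max ?S)")
proof (rule antisym)
  have fin: "finite ?S" "?S \<noteq> {}" using assms by auto
  have meas: "?f \<in> borel_measurable ?M"
  proof -
    have "(\<lambda>t. ereal (g (nat \<lceil>t / \<delta>\<rceil>))) \<in> borel_measurable borel"
      by (rule measurable_compose[of "\<lambda>t. \<lceil>t / \<delta>\<rceil>" _ "count_space UNIV"]) measurable
    then show ?thesis
      by (intro measurable_restrict_space1 measurable_completion) simp
  qed
  show "esssup ?M ?f \<le> ereal (Max ?S)"
  proof (rule esssup_I[OF meas], rule AE_I2)
    fix t assume "t \<in> space ?M"
    then obtain k where "k < N" "nat \<lceil>t / \<delta>\<rceil> = Suc k"
      using ceiling_step_obtain[OF assms(1), of t N] by auto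
    then show "?f t \<le> ereal (Max ?S)"
      using fin by (auto intro!: Max_ge)
  qed
  have "Max ?S \<in> ?S" using fin by (rule Max_in)
  then obtain n where n: "n < N" "Max ?S = g (Suc n)" by auto
  let ?A = "{real n * \<delta><..real (Suc n) * \<delta>} \<inter> {0<..<real N * \<delta>}"
  show "ereal (Max ?S) \<le> esssup ?M ?f"
  proof (rule ccontr)
    assume "\<not> ereal (Max ?S) \<le> esssup ?M ?f"
    then have less: "esssup ?M ?f < ereal (g (Suc n))" using n by simp
    have "AE t in ?M. t \<notin> ?A"
      using esssup_AE[of ?f ?M]
    proof eventually_elim
      case (elim t)
      show ?case
      proof
        assume "t \<in> ?A"
        then have "nat \<lceil>t / \<delta>\<rceil> = Suc n" using ceiling_step_iff[OF assms(1)] by blast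
        with elim less show False by simp
      qed
    qed
    moreover have A: "?A \<in> sets ?M" by (simp add: sets_restrict_space_iff)
    ultimately have "emeasure ?M ?A = 0"
      using AE_iff_null_sets[OF A] null_setsD1 by blast
    then show False
      using measure_time_step[OF assms(1) n(1)] assms(1) by (simp add: measure_def)
  qed
qed

section \<open>Constants extracted from the data\<close>

lemma Linf_positive_bounds:
  assumes "in_Linf \<Omega> g" "ess_inf (lebesgue_on \<Omega>) g > 0"
  obtains a b where "0 < a" "0 \<le> b" "AE x in lebesgue_on \<Omega>. a \<le> g x \<and> g x \<le> b"
proof -
  let ?M = "lebesgue_on \<Omega>"
  have "esssup ?M (\<lambda>x. ereal \<bar>g x\<bar>) < \<infinity>" using assms by (simp add: in_Linf_def)
  then obtain r where r: "esssup ?M (\<lambda>x. ereal \<bar>g x\<bar>) < ereal r"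
    using ereal_dense2 by blast
  have "esssup ?M (\<lambda>x. ereal (- g x)) < 0"
    using assms(2) by (simp add: ess_inf_def ereal_less_uminus_reorder)
  then obtain s where s: "esssup ?M (\<lambda>x. ereal (- g x)) < ereal s" "ereal s < 0"
    using ereal_dense2 by blast
  have "AE x in ?M. - s \<le> g x \<and> g x \<le> max 0 r"
    using esssup_AE[of "\<lambda>x. ereal \<bar>g x\<bar>" ?M] esssup_AE[of "\<lambda>x. ereal (- g x)" ?M]
  proof eventually_elim
    case (elim x)
    have "ereal \<bar>g x\<bar> < ereal r" "ereal (- g x) < ereal s"
      by (rule le_less_trans[OF elim(1) r], rule le_less_trans[OF elim(2) s(1)])
    then show ?case by auto
  qed
  then show ?thesis using s(2) by (intro that[of "- s" "max 0 r"]) auto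
qed

text \<open>Compactness supplies the bound: \<open>\<mu>\<close> may approach zero on the whole
  line, but the density stays in \<open>{a..b}\<close>.\<close>

lemma positive_lower_bound_on_interval:
  fixes \<mu> :: "real \<Rightarrow> real"
  assumes "continuous_on UNIV \<mu>" "\<And>r. \<mu> r > 0"
  obtains m where "0 < m" "\<And>r. a \<le> r \<Longrightarrow> r \<le> b \<Longrightarrow> m \<le> \<mu> r"
proof (cases "a \<le> b")
  case True
  then have "\<exists>x\<in>{a..b}. \<forall>y\<in>{a..b}. \<mu> x \<le> \<mu> y"
    using assms(1) by (intro continuous_attains_inf) (auto intro: continuous_on_subset)
  then obtain x where "\<And>y. y \<in> {a..b} \<Longrightarrow> \<mu> x \<le> \<mu> y" by blast
  then show ?thesis using assms(2) by (intro that[of "\<mu> x"]) auto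
next
  case False
  then show ?thesis using that[of 1] by auto
qed

lemma L2norm_nonneg: "0 \<le> L2norm S v"
  unfolding L2norm_def by (simp add: integral_nonneg_AE)

theorem lemma5p5:
  fixes \<Omega> :: "(real ^ 'n::finite) set"
    and T :: real
    and \<rho>0 :: "real ^ 'n \<Rightarrow> real"
    and u0 :: "real ^ 'n \<Rightarrow> real ^ 'n"
    and \<mu> :: "real \<Rightarrow> real"
    and f :: "real \<Rightarrow> real ^ 'n \<Rightarrow> real ^ 'n"
  assumes dim: "CARD('n) \<in> {2, 3}"
    and T_pos: "T > 0"
    and domain: "rectangular_domain \<Omega>"
    and rho0: "in_Linf \<Omega> \<rho>0" "ess_inf (lebesgue_on \<Omega>) \<rho>0 > 0"
    and u0: "in_L2 \<Omega> u0"
    and mu: "continuous_on UNIV \<mu>" "\<And>r. \<mu> r > 0"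
    and f: "in_L2 ({0<..<T} \<times> \<Omega>) (\<lambda>(t, x). f t x)" "\<And>t. t \<in> {0<..T} \<Longrightarrow> in_L2 \<Omega> (f t)"
    and f_samples: "bounded_samples T \<Omega> f"
  shows "\<exists>C>0. \<forall>(G :: 'n grid) (N :: nat) (\<delta>t :: real) \<rho> u p.
    mac_grid \<Omega> G \<longrightarrow> N \<ge> 1 \<longrightarrow> T = real N * \<delta>t \<longrightarrow> mac_scheme G N \<delta>t \<rho>0 u0 \<mu> f \<rho> u p \<longrightarrow>
      (LINT t|lebesgue_on {0<..<T}. (H_norm G (in_time \<delta>t u t))\<^sup>2)
        = (\<Sum>n<N. \<delta>t * (H_norm G (u (Suc n)))\<^sup>2) \<and>
      (\<Sum>n<N. \<delta>t * (H_norm G (u (Suc n)))\<^sup>2) \<le> C \<and>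
      esssup (lebesgue_on {0<..<T}) (\<lambda>t. ereal (L2norm \<Omega> (velocity G (in_time \<delta>t u t))))
        = ereal (Max ((\<lambda>n. L2norm \<Omega> (velocity G (u (Suc n)))) ` {..<N})) \<and>
      Max ((\<lambda>n. L2norm \<Omega> (velocity G (u (Suc n)))) ` {..<N}) \<le> C"
proof -
  obtain a b where a: "0 < a" and b: "0 \<le> b" and ab: "AE x in lebesgue_on \<Omega>. a \<le> \<rho>0 x \<and> \<rho>0 x \<le> b"
    using Linf_positive_bounds[OF rho0] .
  obtain m where m: "0 < m" "\<And>r. a \<le> r \<Longrightarrow> r \<le> b \<Longrightarrow> m \<le> \<mu> r"
    using positive_lower_bound_on_interval[OF mu, of a b] by metis
  obtain B where B: "\<And>N. N \<ge> 1 \<Longrightarrow>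
      (\<Sum>n<N. T / real N * (L2norm \<Omega> (f (real (Suc n) * (T / real N))))\<^sup>2) \<le> B"
    using f_samples unfolding bounded_samples_def by blast
  \<comment> \<open>All constants are fixed before a grid and a time step are introduced, so that
    \<open>C\<close> depends on the data of the problem only.\<close>
  define A R where "A = b / 2 * (L2norm \<Omega> u0)\<^sup>2" and "R = (T + B) / 2"
  define M where "M = 1 + 4 * A / a + 4 * R\<^sup>2 / a\<^sup>2"
  \<comment> \<open>The absolute values let one positive number dominate both bounds without a
    discussion of signs.\<close>
  define C where "C = 1 + \<bar>M\<bar> + \<bar>2 / m * (A + R * M)\<bar>"
  have "x \<le> 1 + \<bar>x\<bar> + \<bar>y\<bar>" "y \<le> 1 + \<bar>x\<bar> + \<bar>y\<bar>" for x y :: real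
    by linarith+
  note C = this[where x = M and y = "2 / m * (A + R * M)", folded C_def]
  show ?thesis
  proof (intro exI[of _ C] conjI allI impI)
    show "0 < C" by (simp add: C_def add_pos_nonneg)
  next
    fix G :: "'n grid" and N :: nat and \<delta>t :: real and \<rho> u p
    assume grid: "mac_grid \<Omega> G" and N: "N \<ge> 1" and T: "T = real N * \<delta>t"
      and scheme: "mac_scheme G N \<delta>t \<rho>0 u0 \<mu> f \<rho> u p"
    interpret mac_mesh G
      using grid by unfold_locales (auto simp: mac_grid_def)
    have \<Omega>: "\<Omega> = region G" using grid by (simp add: mac_grid_def)
    have \<delta>: "0 < \<delta>t" using T T_pos N by (simp add: zero_less_mult_iff)
    have \<rho>_init: "\<And>K. K \<in> cells G \<Longrightarrow> \<rho> 0 K = average (cell_box G K) \<rho>0"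
      and u_init: "\<And>\<sigma>. \<sigma> \<in> int_faces G \<Longrightarrow> u 0 \<sigma> = average (dual_cell G \<sigma>) (\<lambda>x. u0 x $ fst \<sigma>)"
      and uH: "\<And>n. n < N \<Longrightarrow> u (Suc n) \<in> H_zero G"
      and mass: "\<And>n K. n < N \<Longrightarrow> K \<in> cells G \<Longrightarrow> (\<rho> (Suc n) K - \<rho> n K) / \<delta>t +
          (\<Sum>\<sigma>\<in>cell_faces K. mass_flux G (\<rho> (Suc n)) (u (Suc n)) K \<sigma>) / vol (cell_box G K) = 0"
      and div: "\<And>n K. n < N \<Longrightarrow> K \<in> cells G \<Longrightarrow>
          (\<Sum>\<sigma>\<in>cell_faces K. face_area G \<sigma> * out_vel (u (Suc n)) K \<sigma>) = 0"
      and momentum: "\<And>n \<sigma>. n < N \<Longrightarrow> \<sigma> \<in> int_faces G \<Longrightarrow>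
          (dual_density G (\<rho> (Suc n)) \<sigma> * u (Suc n) \<sigma> - dual_density G (\<rho> n) \<sigma> * u n \<sigma>) / \<delta>t +
          (\<Sum>\<epsilon>\<in>dual_cell_faces \<sigma>. dual_flux G (\<rho> (Suc n)) (u (Suc n)) \<sigma> \<epsilon> *
              upwind_vel G (\<rho> (Suc n)) (u (Suc n)) \<sigma> \<epsilon>) / vol (dual_cell G \<sigma>) -
          diffusion G \<mu> (\<rho> (Suc n)) (u (Suc n)) \<sigma> + pressure_grad G (p (Suc n)) \<sigma>
          = average (dual_cell G \<sigma>) (\<lambda>x. f (real (Suc n) * \<delta>t) x $ fst \<sigma>)"
      using scheme unfolding mac_scheme_def by blast+
    \<comment> \<open>Induction over the time levels: cell means of \<open>\<rho>0\<close> at the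
      start, then the two discrete maximum principles.\<close>
    have density: "a \<le> \<rho> n K \<and> \<rho> n K \<le> b" if "n \<le> N" "K \<in> cells G" for n K
      using that
    proof (induction n arbitrary: K)
      case 0
      have "\<rho>0 \<in> borel_measurable (lebesgue_on (region G))"
        using rho0(1) by (simp add: in_Linf_def \<Omega>)
      from average_bounds[OF cell_box_lmeasurable vol_cell_box_pos region_lmeasurable
          negligible_cell_box_minus_region[OF 0(2)] this ab[unfolded \<Omega>]]
      show ?case unfolding \<rho>_init[OF 0(2)] by (rule conjI)
    next
      case (Suc n)
      then have n: "n < N" by simp
      show ?case
        using density_ge[OF uH[OF n] mass[OF n] div[OF n] _ \<delta> Suc.prems(2), of a]
          density_le[OF uH[OF n] mass[OF n] div[OF n] _ \<delta> Suc.prems(2), of b] Suc.IH n by auto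
    qed
    define \<phi> where "\<phi> n = L2norm \<Omega> (f (real n * \<delta>t))" for n
    have step: "kinetic_energy (\<rho> (Suc n)) (u (Suc n)) - kinetic_energy (\<rho> n) (u n) +
        \<delta>t * (m / 2) * dissipation (u (Suc n)) \<le> \<delta>t * (\<phi> (Suc n) * sqrt (face_L2 (u (Suc n))))"
      if n: "n < N" for n
    proof -
      let ?F = "\<lambda>\<sigma>. average (dual_cell G \<sigma>) (\<lambda>x. f (real (Suc n) * \<delta>t) x $ fst \<sigma>)"
      \<comment> \<open>The last sample is taken at the end point \<open>T\<close>, hence the
        half-open interval.\<close>
      have t: "real (Suc n) * \<delta>t \<in> {0<..T}"
        using n \<delta> unfolding T by (auto intro!: mult_right_mono simp del: of_nat_Suc)
      have "face_L2 ?F \<le> (\<phi> (Suc n))\<^sup>2"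
        unfolding \<phi>_def using face_L2_average_le f(2)[OF t] by (simp only: \<Omega>)
      then have "sqrt (face_L2 ?F) \<le> \<phi> (Suc n)"
        by (intro real_le_lsqrt) (auto simp: \<phi>_def L2norm_nonneg face_L2_nonneg)
      then have F: "\<delta>t * (sqrt (face_L2 ?F) * sqrt (face_L2 (u (Suc n)))) \<le> \<delta>t * (\<phi> (Suc n) * sqrt (face_L2 (u (Suc n))))"
        using \<delta> by (intro mult_left_mono mult_right_mono) (auto simp: face_L2_nonneg)
      have "0 \<le> \<rho> n K" "m \<le> \<mu> (\<rho> (Suc n) K)" if "K \<in> cells G" for K
        using density[of n K] density[of "Suc n" K] that n a m(2) by force+
      then show ?thesis
        using energy_step[OF uH[OF n] \<delta> mass[OF n] div[OF n] momentum[OF n], of m] m(1) F by force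
    qed
    have e0: "kinetic_energy (\<rho> 0) (u 0) \<le> A"
    proof -
      have "kinetic_energy (\<rho> 0) (u 0) \<le> b / 2 * face_L2 (u 0)"
        using density[of 0] by (intro kinetic_energy_le) auto
      also have "face_L2 (u 0) = face_L2 (\<lambda>\<sigma>. average (dual_cell G \<sigma>) (\<lambda>x. u0 x $ fst \<sigma>))"
        unfolding face_L2_def using u_init by (intro sum.cong refl) simp
      also have "b / 2 * \<dots> \<le> A"
        unfolding A_def using b face_L2_average_le u0 by (intro mult_left_mono) (auto simp: \<Omega>)
      finally show ?thesis .
    qed
    \<comment> \<open>Since \<open>T / real N = \<delta>t\<close>, these are the sums controlled by
      \<open>bounded_samples\<close>.\<close>
    have sources: "(\<Sum>n<N. \<delta>t * (\<phi> (Suc n))\<^sup>2) \<le> B"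
      using B[OF N] N unfolding \<phi>_def T by simp
    have coercive: "a / 2 * face_L2 (u (Suc n)) \<le> kinetic_energy (\<rho> (Suc n)) (u (Suc n))" if "n < N" for n
      using density[of "Suc n"] that by (intro kinetic_energy_ge) auto
    have N0: "0 < N" using N by simp
    note bounds = discrete_energy_bound[where e = "\<lambda>n. kinetic_energy (\<rho> n) (u n)" and
        s = "\<lambda>n. face_L2 (u n)" and h = "\<lambda>n. dissipation (u n)" and \<phi> = \<phi>,
        OF step coercive e0 sources a m(1) \<delta> N0 T[symmetric] face_L2_nonneg dissipation_nonneg,
        folded R_def, folded M_def]
    have \<phi>: "0 \<le> \<phi> n" for n by (simp add: \<phi>_def L2norm_nonneg)
    show "(LINT t|lebesgue_on {0<..<T}. (H_norm G (in_time \<delta>t u t))\<^sup>2)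
        = (\<Sum>n<N. \<delta>t * (H_norm G (u (Suc n)))\<^sup>2)"
      unfolding T in_time_def by (rule integral_time_steps[OF \<delta>])
    show "esssup (lebesgue_on {0<..<T}) (\<lambda>t. ereal (L2norm \<Omega> (velocity G (in_time \<delta>t u t))))
        = ereal (Max ((\<lambda>n. L2norm \<Omega> (velocity G (u (Suc n)))) ` {..<N}))"
      unfolding T in_time_def by (rule esssup_time_steps[OF \<delta> N0])
    have "(\<Sum>n<N. \<delta>t * (H_norm G (u (Suc n)))\<^sup>2) \<le> (\<Sum>n<N. \<delta>t * dissipation (u (Suc n)))"
      using \<delta> by (intro sum_mono mult_left_mono H_norm_le) auto
    also have "\<dots> \<le> 2 / m * (A + R * M)"
      by (rule bounds(2)) (use \<phi> in auto)
    also have "\<dots> \<le> C" by (rule C(2))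
    finally show "(\<Sum>n<N. \<delta>t * (H_norm G (u (Suc n)))\<^sup>2) \<le> C" .
    have "L2norm \<Omega> (velocity G (u (Suc n))) \<le> C" if n: "n < N" for n
    proof -
      have "L2norm \<Omega> (velocity G (u (Suc n))) \<le> sqrt (face_L2 (u (Suc n)))"
        unfolding \<Omega> by (rule velocity_L2_le[OF uH[OF n]])
      also have "\<dots> \<le> M"
        by (rule bounds(1)) (use \<phi> n in auto)
      also have "\<dots> \<le> C" by (rule C(1))
      finally show ?thesis .
    qed
    then show "Max ((\<lambda>n. L2norm \<Omega> (velocity G (u (Suc n)))) ` {..<N}) \<le> C"
      using N0 by (subst Max_le_iff) auto
  qed
qed

end
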